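(* Let $(\mathfrak{B}_i)_{i\ge 1}$ be a sequence of i.i.d. two-sided standard Brownian motions, and let $\mathcal{I}_i$ ($i\ge 1$) be the random compact intervals $$\mathcal{I}_i=\lim_{m\to\infty}\mathfrak{B}_i\big(\mathfrak{B}_{i+1}(\cdots(\mathfrak{B}_{i+m}(J))\cdots)\big),$$ where $J$ is any bounded interval of $\mathbb{R}$ with $0\in J$ and $J\ne\{0\}$ (almost surely the limit exists and does not depend on $J$). Let $\mathcal{C}$ be the random chainable continuum obtained as the inverse limit of the system $\cdots\xrightarrow{\mathfrak{B}_3}\mathcal{I}_3\xrightarrow{\mathfrak{B}_2}\mathcal{I}_2\xrightarrow{\mathfrak{B}_1}\mathcal{I}_1$, i.e. $$\mathcal{C}=\Big\{(x_i)_{i\ge 1}\in\prod_{i\ge 1}\mathcal{I}_i:\ \mathfrak{B}_i(x_{i+1})=x_i\ \text{for all } i\ge 1\Big\}.$$ Then, almost surely, $\mathcal{C}$ is not hereditarily indecomposable (hence $\mathcal{C}$ is not the pseudo-arc).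
   Context: A two-sided Brownian motion $\mathfrak{B}$ is a random continuous function $\mathfrak{B}:\mathbb{R}\to\mathbb{R}$ such that $(\mathfrak{B}(t))_{t\ge 0}$ and $(\mathfrak{B}(-t))_{t\ge 0}$ are independent standard linear Brownian motions started from $0$. The limit of intervals defining $\mathcal{I}_i$ is understood as convergence of both endpoints, $\mathcal{I}_i$ being the compact interval with the limiting endpoints. It is a known result of Kiss and Solecki that, for every such $J$, this limit exists almost surely and does not depend on $J$ (so one may take $J=[0,1]$). The maps $\mathfrak{B}_i:\mathcal{I}_{i+1}\to\mathcal{I}_i$ are continuous and surjective. The set $\mathcal{C}$ carries the topology induced by the product topology. A continuum is a nonempty, compact, connected metric space; a subcontinuum is a subset that is itself a continuum. A continuum $C$ is chainable if for each $\varepsilon>0$ there is a continuous function $f:C\to[0,1]$ such that the pre-images of points under $f$ have diameter less than $\varepsilon$. A continuum $C$ is decomposable if there exist two subcontinua $A,B$ of $C$ with $A\ne C$, $B\ne C$ and $C=A\cup B$; otherwise it is indecomposable. A continuum is hereditarily indecomposable if each of its subcontinua not reduced to a singleton is indecomposable. The pseudo-arc is the unique (up to homeomorphism) chainable and hereditarily indecomposable continuum not reduced to a singleton. *)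

theory Defs
  imports "HOL-Probability.Probability"
begin

definition std_brownian_motion :: "'a measure \<Rightarrow> ('a \<Rightarrow> real \<Rightarrow> real) \<Rightarrow> bool" where
  "std_brownian_motion M W \<longleftrightarrow>
     (\<forall>t\<ge>0. (\<lambda>\<omega>. W \<omega> t) \<in> borel_measurable M) \<and>
     (\<forall>\<omega>\<in>space M. continuous_on {0..} (W \<omega>)) \<and>
     (AE \<omega> in M. W \<omega> 0 = 0) \<and>
     (\<forall>s t. 0 \<le> s \<and> s < t \<longrightarrow>
        distributed M lborel (\<lambda>\<omega>. W \<omega> t - W \<omega> s) (normal_density 0 (sqrt (t - s)))) \<and>
     (\<forall>(ts :: nat \<Rightarrow> real) n. 0 \<le> ts 0 \<and> (\<forall>k<n. ts k \<le> ts (Suc k)) \<longrightarrow>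
        prob_space.indep_vars M (\<lambda>_. borel) (\<lambda>k \<omega>. W \<omega> (ts (Suc k)) - W \<omega> (ts k)) {..<n})"

definition two_sided_brownian_motion :: "'a measure \<Rightarrow> ('a \<Rightarrow> real \<Rightarrow> real) \<Rightarrow> bool" where
  "two_sided_brownian_motion M B \<longleftrightarrow>
     (\<forall>\<omega>\<in>space M. continuous_on UNIV (B \<omega>)) \<and>
     std_brownian_motion M B \<and>
     std_brownian_motion M (\<lambda>\<omega> t. B \<omega> (- t)) \<and>
     prob_space.indep_var M
       (\<Pi>\<^sub>M t\<in>{0..}. borel) (\<lambda>\<omega>. \<lambda>t\<in>{0..}. B \<omega> t)
       (\<Pi>\<^sub>M t\<in>{0..}. borel) (\<lambda>\<omega>. \<lambda>t\<in>{0..}. B \<omega> (- t))"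

(* The processes are independent as random elements of the path space; they are identically
   distributed because two_sided_brownian_motion determines the finite-dimensional
   distributions, hence the law on the path space. *)
definition iid_two_sided_brownian_motions ::
    "'a measure \<Rightarrow> (nat \<Rightarrow> 'a \<Rightarrow> real \<Rightarrow> real) \<Rightarrow> bool" where
  "iid_two_sided_brownian_motions M B \<longleftrightarrow>
     (\<forall>i. two_sided_brownian_motion M (B i)) \<and>
     prob_space.indep_vars M (\<lambda>_. \<Pi>\<^sub>M t\<in>UNIV. borel) B UNIV"

(* iterated_image f i m J = f i (f (i + 1) (... (f (i + m) J) ...)) *)
primrec iterated_image :: "(nat \<Rightarrow> real \<Rightarrow> real) \<Rightarrow> nat \<Rightarrow> nat \<Rightarrow> real set \<Rightarrow> real set" where
  "iterated_image f i 0 J = f i ` J"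
| "iterated_image f i (Suc m) J = f i ` iterated_image f (Suc i) m J"

(* Both endpoints are taken to their limits; Inf and Sup are the endpoints of an interval
   whether or not it contains them. *)
definition limit_interval :: "(nat \<Rightarrow> real \<Rightarrow> real) \<Rightarrow> real set \<Rightarrow> nat \<Rightarrow> real set" where
  "limit_interval f J i =
     {lim (\<lambda>m. Inf (iterated_image f i m J)) .. lim (\<lambda>m. Sup (iterated_image f i m J))}"

(* A subset of nat \<Rightarrow> real, whose type class topology is the product topology. *)
definition inverse_limit :: "(nat \<Rightarrow> real set) \<Rightarrow> (nat \<Rightarrow> real \<Rightarrow> real) \<Rightarrow> (nat \<Rightarrow> real) set" where
  "inverse_limit I f = {x. (\<forall>i. x i \<in> I i) \<and> (\<forall>i. f i (x (Suc i)) = x i)}"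

definition continuum :: "'a::metric_space set \<Rightarrow> bool" where
  "continuum C \<longleftrightarrow> C \<noteq> {} \<and> compact C \<and> connected C"

definition chainable :: "'a::metric_space set \<Rightarrow> bool" where
  "chainable C \<longleftrightarrow>
     (\<forall>\<epsilon>>0. \<exists>f :: 'a \<Rightarrow> real. continuous_on C f \<and> f ` C \<subseteq> {0..1} \<and>
        (\<forall>y\<in>{0..1}. diameter {x\<in>C. f x = y} < \<epsilon>))"

definition decomposable :: "'a::metric_space set \<Rightarrow> bool" where
  "decomposable C \<longleftrightarrow>
     (\<exists>A B. continuum A \<and> continuum B \<and> A \<noteq> C \<and> B \<noteq> C \<and> C = A \<union> B)"

definition hereditarily_indecomposable :: "'a::metric_space set \<Rightarrow> bool" where
  "hereditarily_indecomposable C \<longleftrightarrow>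
     (\<forall>K\<subseteq>C. continuum K \<and> \<not> is_singleton K \<longrightarrow> \<not> decomposable K)"

(* These properties are invariant under homeomorphism of compact sets and characterise the
   pseudo-arc up to homeomorphism. *)
definition is_pseudo_arc :: "'a::metric_space set \<Rightarrow> bool" where
  "is_pseudo_arc C \<longleftrightarrow>
     continuum C \<and> chainable C \<and> hereditarily_indecomposable C \<and> \<not> is_singleton C"

end

theory Submission
  imports Defs "HOL-Real_Asymp.Real_Asymp"
begin

text \<open>
  A decomposable subcontinuum is built from overlapping intervals \<open>A\<^sub>i = [a\<^sub>i, d\<^sub>i]\<close> and \<open>D\<^sub>i = [c\<^sub>i, b\<^sub>i]\<close>
  with \<open>a\<^sub>i < c\<^sub>i < d\<^sub>i < b\<^sub>i\<close> that the \<open>i\<close>-th path maps onto each other, \<open>B\<^sub>i(A\<^sub>i\<^sub>+\<^sub>1) = A\<^sub>i\<close> and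
  \<open>B\<^sub>i(D\<^sub>i\<^sub>+\<^sub>1) = D\<^sub>i\<close>: the inverse limit of the \<open>A\<^sub>i \<union> D\<^sub>i\<close> is the union of the two proper subcontinua
  given by the \<open>A\<^sub>i\<close> and by the \<open>D\<^sub>i\<close>. Since a Brownian path has no point of increase, the two intervals
  must overlap; it suffices that \<open>B\<^sub>i\<close> follows a staircase across the levels \<open>a\<^sub>i, c\<^sub>i, d\<^sub>i, b\<^sub>i\<close>.
  If the intervals at level \<open>i\<close> have length of order \<open>l\<close>, such a staircase takes time of order \<open>l\<^sup>2\<close> and
  has a scale-invariant positive probability, and on each of \<open>n\<close> separated time scales the path gets a fresh
  attempt when it first passes the level \<open>a\<^sub>i\<close>. Hence failure is exponentially unlikely in \<open>n\<close>, while the distance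
  of the intervals from the origin is multiplied only by \<open>exp (O(n\<^sup>2))\<close> after squaring. With \<open>n = i + L\<close> the failure
  probabilities are summable, with a sum that vanishes as \<open>L\<close> grows, and the intervals still shrink to the origin.

  The iterated images are eventually constant: with probability bounded below uniformly in \<open>m\<close>, all later
  images stay between two fixed neighbourhoods of \<open>0\<close> and \<open>B\<^sub>m\<close> has the same image on both; by the zero-one law
  this happens for infinitely many \<open>m\<close>. An interval chain that shrinks into \<open>J\<close> is therefore contained in the
  limit intervals.
\<close>

section \<open>Brownian motion and the Markov property\<close>

text \<open>The chain is constructed from level 0 upwards, whereas the limit intervals come down
  from infinity. The obstacle is that the place where path i has to climb depends on all earlier
  paths. The probabilistic part therefore never fixes the endpoints of the intervals: a climb only
  concerns four unit windows at a start position, and exact endpoints inside the windows are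
  selected afterwards, path by path, with intermediate values. Start positions are taken from finite
  sets of times that are fixed in advance and serve all targets up to a given distance. Hence the
  random position has finitely many values and is independent of the next path, and the Markov
  property at deterministic times suffices where the strong Markov property would be natural. The
  length unit is squared from level to level, because the time unit of one path is the length unit
  of the next; Brownian scaling then reduces every level to the same estimate, with the distance
  from 0 measured in the current unit. Paths are treated on both sides of 0, since J may have 0 as
  an endpoint.\<close>

definition brownian_motion :: "'a measure \<Rightarrow> ('a \<Rightarrow> real \<Rightarrow> real) \<Rightarrow> bool" where
  "brownian_motion M W \<longleftrightarrow>
     prob_space M \<and> std_brownian_motion M W \<and> (\<forall>\<omega>\<in>space M. W \<omega> 0 = 0)"

lemma brownian_motionD:
  assumes "brownian_motion M W"
  shows brownian_motion_prob_space: "prob_space M"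
    and brownian_motion_measurable: "0 \<le> t \<Longrightarrow> (\<lambda>\<omega>. W \<omega> t) \<in> borel_measurable M"
    and brownian_motion_continuous: "\<omega> \<in> space M \<Longrightarrow> continuous_on {0..} (W \<omega>)"
    and brownian_motion_zero: "\<omega> \<in> space M \<Longrightarrow> W \<omega> 0 = 0"
    and brownian_motion_increment: "0 \<le> s \<Longrightarrow> s < t \<Longrightarrow>
      distributed M lborel (\<lambda>\<omega>. W \<omega> t - W \<omega> s) (normal_density 0 (sqrt (t - s)))"
    and brownian_motion_indep: "0 \<le> ts 0 \<Longrightarrow> (\<And>k::nat. k < n \<Longrightarrow> ts k \<le> ts (Suc k)) \<Longrightarrow>
      prob_space.indep_vars M (\<lambda>_. borel) (\<lambda>k \<omega>. W \<omega> (ts (Suc k)) - W \<omega> (ts k)) {..<n}"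
  using assms by (auto simp: brownian_motion_def std_brownian_motion_def)

text \<open>Negation, Brownian scaling and the shift in time are special cases;
  \<open>\<bar>\<alpha>\<bar> * sqrt \<kappa> = 1\<close> is what preserves the variance. The
  function \<open>c\<close> stands for W at time s, so that the constant 0 can be inserted when s =
  0.\<close>

lemma brownian_motion_affine:
  assumes W: "brownian_motion M W" and s: "0 \<le> s" and \<kappa>: "0 < \<kappa>" and \<alpha>: "\<bar>\<alpha>\<bar> * sqrt \<kappa> = 1"
    and c: "c \<in> borel_measurable M" "\<And>\<omega>. \<omega> \<in> space M \<Longrightarrow> c \<omega> = W \<omega> s"
  shows "brownian_motion M (\<lambda>\<omega> t. \<alpha> * (W \<omega> (s + \<kappa> * t) - c \<omega>))"
proof -
  interpret prob_space M by (rule brownian_motion_prob_space[OF W])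
  let ?V = "\<lambda>\<omega> t. \<alpha> * (W \<omega> (s + \<kappa> * t) - c \<omega>)"
  have \<alpha>0: "\<alpha> \<noteq> 0" using \<alpha> by auto
  have cont: "continuous_on {0..} (?V \<omega>)" if "\<omega> \<in> space M" for \<omega>
  proof -
    have "continuous_on {0..} (\<lambda>t. W \<omega> (s + \<kappa> * t))"
      by (rule continuous_on_compose2[OF brownian_motion_continuous[OF W that]])
        (use s \<kappa> in \<open>auto intro!: continuous_intros\<close>)
    then show ?thesis by (intro continuous_intros)
  qed
  have meas: "(\<lambda>\<omega>. ?V \<omega> t) \<in> borel_measurable M" if "0 \<le> t" for t
    using s \<kappa> that
    by (intro borel_measurable_times borel_measurable_diff brownian_motion_measurable[OF W] c) auto
  have dist: "distributed M lborel (\<lambda>\<omega>. ?V \<omega> t - ?V \<omega> r) (normal_density 0 (sqrt (t - r)))"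
    if "0 \<le> r" "r < t" for r t
  proof -
    have "distributed M lborel (\<lambda>\<omega>. W \<omega> (s + \<kappa> * t) - W \<omega> (s + \<kappa> * r))
        (normal_density 0 (sqrt (s + \<kappa> * t - (s + \<kappa> * r))))"
      using s \<kappa> that by (intro brownian_motion_increment[OF W]) auto
    from normal_density_affine[OF this, of \<alpha> 0]
    have "distributed M lborel (\<lambda>\<omega>. \<alpha> * (W \<omega> (s + \<kappa> * t) - W \<omega> (s + \<kappa> * r)))
        (normal_density 0 (\<bar>\<alpha>\<bar> * sqrt (\<kappa> * (t - r))))"
      using \<alpha>0 \<kappa> that by (simp add: algebra_simps)
    also have "\<bar>\<alpha>\<bar> * sqrt (\<kappa> * (t - r)) = sqrt (t - r)"
      using \<alpha> by (simp add: real_sqrt_mult flip: mult.assoc)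
    finally show ?thesis by (simp add: algebra_simps)
  qed
  have ind: "indep_vars (\<lambda>_. borel) (\<lambda>k \<omega>. ?V \<omega> (ts (Suc k)) - ?V \<omega> (ts k)) {..<n}"
    if "0 \<le> ts 0" "\<forall>k<n. ts k \<le> ts (Suc k)" for ts :: "nat \<Rightarrow> real" and n
  proof -
    have "indep_vars (\<lambda>_. borel)
        (\<lambda>k \<omega>. W \<omega> (s + \<kappa> * ts (Suc k)) - W \<omega> (s + \<kappa> * ts k)) {..<n}"
      by (rule brownian_motion_indep[OF W, of "\<lambda>k. s + \<kappa> * ts k"]) (use that s \<kappa> in auto)
    from indep_vars_compose2[OF this, of "\<lambda>_ x. \<alpha> * x" "\<lambda>_. borel"]
    show ?thesis by (simp add: algebra_simps)
  qed
  show ?thesis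
    unfolding brownian_motion_def std_brownian_motion_def
    using cont meas dist ind c(2) by (auto intro: prob_space_axioms)
qed

lemma brownian_motion_uminus:
  assumes "brownian_motion M W"
  shows "brownian_motion M (\<lambda>\<omega> t. - W \<omega> t)"
  using brownian_motion_affine[OF assms, of 0 1 "-1" "\<lambda>_. 0"] brownian_motion_zero[OF assms] by simp

lemma brownian_motion_scale:
  assumes "brownian_motion M W" and "0 < c"
  shows "brownian_motion M (\<lambda>\<omega> t. W \<omega> (c\<^sup>2 * t) / c)"
  using brownian_motion_affine[OF assms(1), of 0 "c\<^sup>2" "1 / c" "\<lambda>_. 0"]
    brownian_motion_zero[OF assms(1)] assms(2) by simp

lemma brownian_motion_shift:
  assumes "brownian_motion M W" and "0 \<le> s"
  shows "brownian_motion M (\<lambda>\<omega> t. W \<omega> (s + t) - W \<omega> s)"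
  using brownian_motion_affine[OF assms, of 1 1 "\<lambda>\<omega>. W \<omega> s"] brownian_motion_measurable[OF assms]
  by simp

section \<open>Sigma-algebras of the past and of the future increments\<close>

definition generated :: "'a measure \<Rightarrow> ('i \<Rightarrow> 'a \<Rightarrow> real) \<Rightarrow> 'i set \<Rightarrow> 'a measure" where
  "generated M X T = sigma (space M) {X t -` A \<inter> space M | t A. t \<in> T \<and> A \<in> sets borel}"

lemma space_generated [simp]: "space (generated M X T) = space M"
  unfolding generated_def by (rule space_measure_of) auto

lemma sets_generated:
  "sets (generated M X T) =
    sigma_sets (space M) {X t -` A \<inter> space M | t A. t \<in> T \<and> A \<in> sets borel}"
  unfolding generated_def by (rule sets_measure_of) auto

lemma measurable_generated: "t \<in> T \<Longrightarrow> X t \<in> borel_measurable (generated M X T)"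
  by (rule measurableI) (auto simp: sets_generated intro!: sigma_sets.Basic)

lemma sets_generated_subset:
  assumes "space N = space M" and "\<And>t. t \<in> T \<Longrightarrow> X t \<in> borel_measurable N"
  shows "sets (generated M X T) \<subseteq> sets N"
proof -
  have "X t -` A \<inter> space M \<in> sets N" if "t \<in> T" "A \<in> sets borel" for t A
    using measurable_sets[OF assms(2)[OF that(1)] that(2)] assms(1) by simp
  then show ?thesis
    unfolding sets_generated assms(1)[symmetric] by (intro sets.sigma_sets_subset) auto
qed

definition past :: "'a measure \<Rightarrow> ('a \<Rightarrow> real \<Rightarrow> real) \<Rightarrow> real \<Rightarrow> 'a measure" where
  "past M W s = generated M (\<lambda>t \<omega>. W \<omega> t) {0..s}"

definition future :: "'a measure \<Rightarrow> ('a \<Rightarrow> real \<Rightarrow> real) \<Rightarrow> real \<Rightarrow> 'a measure" where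
  "future M W s = generated M (\<lambda>t \<omega>. W \<omega> (s + t) - W \<omega> s) {0..}"

lemma space_past [simp]: "space (past M W s) = space M"
  and space_future [simp]: "space (future M W s) = space M"
  by (simp_all add: past_def future_def)

lemma measurable_past: "0 \<le> t \<Longrightarrow> t \<le> s \<Longrightarrow> (\<lambda>\<omega>. W \<omega> t) \<in> borel_measurable (past M W s)"
  unfolding past_def by (rule measurable_generated[where X="\<lambda>t \<omega>. W \<omega> t"]) auto

lemma measurable_future:
  "0 \<le> t \<Longrightarrow> (\<lambda>\<omega>. W \<omega> (s + t) - W \<omega> s) \<in> borel_measurable (future M W s)"
  unfolding future_def by (rule measurable_generated[where X="\<lambda>t \<omega>. W \<omega> (s + t) - W \<omega> s"]) auto

lemma sets_past_mono: "s \<le> t \<Longrightarrow> sets (past M W s) \<subseteq> sets (past M W t)"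
  unfolding past_def[of M W s] by (rule sets_generated_subset) (auto intro!: measurable_past)

context
  fixes M :: "'a measure" and W :: "'a \<Rightarrow> real \<Rightarrow> real"
  assumes W: "brownian_motion M W"
begin

lemma sets_past_subset: "sets (past M W s) \<subseteq> sets M"
  unfolding past_def
  by (rule sets_generated_subset) (auto intro!: brownian_motion_measurable[OF W])

lemma sets_future_subset: "0 \<le> s \<Longrightarrow> sets (future M W s) \<subseteq> sets M"
  unfolding future_def
  by (rule sets_generated_subset)
    (auto intro!: borel_measurable_diff brownian_motion_measurable[OF W])

end

text \<open>The pi-system of finite-dimensional rectangles, on which product formulas are checked
  before they are extended to \<open>generated\<close>.\<close>

definition cylinders :: "'a measure \<Rightarrow> ('i \<Rightarrow> 'a \<Rightarrow> real) \<Rightarrow> 'i set \<Rightarrow> 'a set set" where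
  "cylinders M X T =
    {{\<omega>\<in>space M. \<forall>t\<in>F. X t \<omega> \<in> A t} | F A. finite F \<and> F \<subseteq> T \<and> (\<forall>t. A t \<in> sets borel)}"

lemma Int_stable_cylinders: "Int_stable (cylinders M X T)"
proof (rule Int_stableI)
  fix a b assume "a \<in> cylinders M X T" "b \<in> cylinders M X T"
  then obtain F A G B where
    a: "a = {\<omega>\<in>space M. \<forall>t\<in>F. X t \<omega> \<in> A t}" "finite F" "F \<subseteq> T" "\<forall>t. A t \<in> sets borel" and
    b: "b = {\<omega>\<in>space M. \<forall>t\<in>G. X t \<omega> \<in> B t}" "finite G" "G \<subseteq> T" "\<forall>t. B t \<in> sets borel"
    unfolding cylinders_def by blast
  define C where "C t = (if t \<in> F then A t else UNIV) \<inter> (if t \<in> G then B t else UNIV)" for t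
  have "a \<inter> b = {\<omega>\<in>space M. \<forall>t\<in>F \<union> G. X t \<omega> \<in> C t}"
    unfolding a(1) b(1) C_def by auto
  moreover have "C t \<in> sets borel" for t
    unfolding C_def using a(4) b(4) by auto
  moreover have "finite (F \<union> G)" "F \<union> G \<subseteq> T"
    using a(2,3) b(2,3) by blast+
  ultimately show "a \<inter> b \<in> cylinders M X T"
    unfolding cylinders_def by blast
qed

lemma sets_generated_cylinders: "sets (generated M X T) \<subseteq> sigma_sets (space M) (cylinders M X T)"
proof -
  have "X t -` A \<inter> space M \<in> cylinders M X T" if "t \<in> T" "A \<in> sets borel" for t A
    unfolding cylinders_def using that
    by (intro CollectI exI[of _ "{t}"] exI[of _ "\<lambda>_. A"]) auto
  then show ?thesis
    unfolding sets_generated by (intro sigma_sets_mono) (auto intro: sigma_sets.Basic)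
qed

lemma sets_Collect_Ball_borel:
  assumes "finite F" "\<And>t. t \<in> F \<Longrightarrow> g t \<in> borel_measurable N" "\<And>t. A t \<in> sets borel"
  shows "{x\<in>space N. \<forall>t\<in>F. g t x \<in> A t} \<in> sets N"
proof (rule sets.sets_Collect_finite_All[OF _ assms(1)])
  fix t assume "t \<in> F"
  from measurable_sets[OF assms(2)[OF this] assms(3)]
  show "{x\<in>space N. g t x \<in> A t} \<in> sets N" by (simp add: vimage_def Int_def conj_commute)
qed

text \<open>Both events are expressed by increments over one common partition. Values up to time s
  are sums of increments before index m, later displacements are sums from m on, and disjoint blocks
  of independent increments are independent.\<close>

lemma markov_cylinders:
  assumes W: "brownian_motion M W" and s: "0 \<le> s"
    and a: "a \<in> cylinders M (\<lambda>t \<omega>. W \<omega> t) {0..s}"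
    and b: "b \<in> cylinders M (\<lambda>t \<omega>. W \<omega> (s + t) - W \<omega> s) {0..}"
  shows "measure M (a \<inter> b) = measure M a * measure M b"
proof -
  interpret prob_space M by (rule brownian_motion_prob_space[OF W])
  obtain F A G B where
    a: "a = {\<omega>\<in>space M. \<forall>t\<in>F. W \<omega> t \<in> A t}" "finite F" "F \<subseteq> {0..s}" "\<forall>t. A t \<in> sets borel" and
    b: "b = {\<omega>\<in>space M. \<forall>t\<in>G. W \<omega> (s + t) - W \<omega> s \<in> B t}" "finite G" "G \<subseteq> {0..}" "\<forall>t. B t \<in> sets borel"
    using a b unfolding cylinders_def by blast
  \<comment> \<open>The time s is the last entry of \<open>xs\<close> and again the first of
    \<open>ys\<close>, so the increment at index m is 0. The entry 0 makes sums from index 0 equal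
    to W itself.\<close>
  define xs where "xs = sorted_list_of_set (insert 0 (insert s F))"
  define ys where "ys = sorted_list_of_set (insert s ((+) s ` G))"
  define ts where "ts k = (xs @ ys) ! k" for k
  define m where "m = length xs - 1"
  define n where "n = length (xs @ ys) - 1"
  have setx: "set xs = insert 0 (insert s F)" and sety: "set ys = insert s ((+) s ` G)"
    using a b by (simp_all add: xs_def ys_def del: sorted_list_of_set_insert_remove)
  have srt: "sorted (xs @ ys)"
  proof -
    have "sorted xs" "sorted ys" by (simp_all add: xs_def ys_def)
    moreover have "x \<le> y" if "x \<in> set xs" "y \<in> set ys" for x y
    proof -
      have "x \<le> s" using that(1) a(3) s unfolding setx by auto
      moreover have "s \<le> y" using that(2) b(3) unfolding sety by auto
      ultimately show ?thesis by simp
    qed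
    ultimately show ?thesis unfolding sorted_append by blast
  qed
  have "xs \<noteq> []" "ys \<noteq> []" using setx sety by fastforce+
  then have "0 < length xs" "0 < length ys" by blast+
  then have lx: "length xs = Suc m" and ly: "length ys = n - m" and mn: "m < n"
    unfolding m_def n_def length_append by linarith+
  have mono: "ts i \<le> ts j" if "i \<le> j" "j \<le> n" for i j
    unfolding ts_def using srt that lx ly mn by (intro sorted_nth_mono) auto
  have ts0: "ts 0 = 0"
  proof -
    have "0 \<in> set xs" by (simp add: setx)
    then obtain j where j: "j < length xs" "xs ! j = 0" unfolding in_set_conv_nth by blast
    then have "ts 0 \<le> 0" using mono[of 0 j] lx mn by (simp add: ts_def nth_append)
    moreover have "ts 0 \<in> set xs" using lx by (simp add: ts_def nth_append)
    then have "0 \<le> ts 0" using a(3) s unfolding setx by auto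
    ultimately show ?thesis by simp
  qed
  have tsm: "ts m = s"
  proof -
    have "s \<in> set xs" by (simp add: setx)
    then obtain j where j: "j < length xs" "xs ! j = s" unfolding in_set_conv_nth by blast
    then have "s \<le> ts m" using mono[of j m] lx mn by (simp add: ts_def nth_append)
    moreover have "ts m \<in> set xs" using lx by (simp add: ts_def nth_append)
    then have "ts m \<le> s" using a(3) s unfolding setx by auto
    ultimately show ?thesis by simp
  qed
  have "\<exists>j. j \<le> m \<and> ts j = t" if "t \<in> F" for t
  proof -
    have "t \<in> set xs" using that by (simp add: setx)
    then obtain j where "j < length xs" "xs ! j = t" unfolding in_set_conv_nth by blast
    then show ?thesis using lx by (intro exI[of _ j]) (simp add: ts_def nth_append)
  qed
  then obtain jF where jF: "\<And>t. t \<in> F \<Longrightarrow> jF t \<le> m \<and> ts (jF t) = t" by metis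
  have "\<exists>j. m \<le> j \<and> j \<le> n \<and> ts j = s + t" if "t \<in> G" for t
  proof -
    have "s + t \<in> set ys" using that by (simp add: sety)
    then obtain j where "j < length ys" "ys ! j = s + t" unfolding in_set_conv_nth by blast
    then show ?thesis using lx ly by (intro exI[of _ "Suc m + j"]) (auto simp: ts_def nth_append)
  qed
  then obtain jG where jG: "\<And>t. t \<in> G \<Longrightarrow> m \<le> jG t \<and> jG t \<le> n \<and> ts (jG t) = s + t" by metis
  define D where "D k \<omega> = W \<omega> (ts (Suc k)) - W \<omega> (ts k)" for k \<omega>
  have "indep_vars (\<lambda>_. borel) D {..<n}"
    unfolding D_def by (rule brownian_motion_indep[OF W]) (auto simp: ts0 intro!: mono)
  then have ind: "indep_var (Pi\<^sub>M {..<m} (\<lambda>_. borel)) (\<lambda>\<omega>. \<lambda>k\<in>{..<m}. D k \<omega>)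
      (Pi\<^sub>M {m..<n} (\<lambda>_. borel)) (\<lambda>\<omega>. \<lambda>k\<in>{m..<n}. D k \<omega>)"
    by (rule indep_var_restrict) (use mn in auto)
  define a' where "a' = {x\<in>space (Pi\<^sub>M {..<m} (\<lambda>_. borel)). \<forall>t\<in>F. (\<Sum>k\<in>{0..<jF t}. x k) \<in> A t}"
  define b' where "b' = {x\<in>space (Pi\<^sub>M {m..<n} (\<lambda>_. borel)). \<forall>t\<in>G. (\<Sum>k\<in>{m..<jG t}. x k) \<in> B t}"
  have 1: "a' \<in> sets (Pi\<^sub>M {..<m} (\<lambda>_. borel))"
  proof -
    have "(\<lambda>x. \<Sum>k\<in>{0..<jF t}. x k) \<in> borel_measurable (Pi\<^sub>M {..<m} (\<lambda>_. borel :: real measure))"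
      if "t \<in> F" for t
      using jF[OF that] by (intro borel_measurable_sum measurable_component_singleton) auto
    then show ?thesis
      unfolding a'_def by (intro sets_Collect_Ball_borel a(2) a(4)[rule_format])
  qed
  have 2: "b' \<in> sets (Pi\<^sub>M {m..<n} (\<lambda>_. borel))"
  proof -
    have "(\<lambda>x. \<Sum>k\<in>{m..<jG t}. x k) \<in> borel_measurable (Pi\<^sub>M {m..<n} (\<lambda>_. borel :: real measure))"
      if "t \<in> G" for t
      using jG[OF that] by (intro borel_measurable_sum measurable_component_singleton) auto
    then show ?thesis
      unfolding b'_def by (intro sets_Collect_Ball_borel b(2) b(4)[rule_format])
  qed
  have eqF: "(\<Sum>k\<in>{0..<jF t}. (\<lambda>k\<in>{..<m}. D k \<omega>) k) = W \<omega> t" if "t \<in> F" "\<omega> \<in> space M" for t \<omega>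
  proof -
    have "(\<Sum>k\<in>{0..<jF t}. (\<lambda>k\<in>{..<m}. D k \<omega>) k) = (\<Sum>k\<in>{0..<jF t}. D k \<omega>)"
      using jF[OF that(1)] by (intro sum.cong) auto
    then show ?thesis
      unfolding D_def using sum_Suc_diff'[of 0 "jF t" "\<lambda>k. W \<omega> (ts k)"] jF[OF that(1)] ts0
      by (simp add: brownian_motion_zero[OF W that(2)])
  qed
  have eqG: "(\<Sum>k\<in>{m..<jG t}. (\<lambda>k\<in>{m..<n}. D k \<omega>) k) = W \<omega> (s + t) - W \<omega> s" if "t \<in> G" for t \<omega>
  proof -
    have "(\<Sum>k\<in>{m..<jG t}. (\<lambda>k\<in>{m..<n}. D k \<omega>) k) = (\<Sum>k\<in>{m..<jG t}. D k \<omega>)"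
      using jG[OF that(1)] by (intro sum.cong) auto
    then show ?thesis
      unfolding D_def using sum_Suc_diff'[of m "jG t" "\<lambda>k. W \<omega> (ts k)"] jG[OF that(1)] tsm by simp
  qed
  have "(\<lambda>k\<in>{..<m}. D k \<omega>) \<in> a' \<longleftrightarrow> (\<forall>t\<in>F. W \<omega> t \<in> A t)" if "\<omega> \<in> space M" for \<omega>
  proof -
    have "(\<lambda>k\<in>{..<m}. D k \<omega>) \<in> space (Pi\<^sub>M {..<m} (\<lambda>_. borel))" by (simp add: space_PiM)
    then show ?thesis unfolding a'_def mem_Collect_eq using eqF[OF _ that] by metis
  qed
  then have 3: "a = (\<lambda>\<omega>. \<lambda>k\<in>{..<m}. D k \<omega>) -` a' \<inter> space M"
    unfolding a(1) by blast
  have "(\<lambda>k\<in>{m..<n}. D k \<omega>) \<in> b' \<longleftrightarrow> (\<forall>t\<in>G. W \<omega> (s + t) - W \<omega> s \<in> B t)" for \<omega>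
  proof -
    have "(\<lambda>k\<in>{m..<n}. D k \<omega>) \<in> space (Pi\<^sub>M {m..<n} (\<lambda>_. borel))" by (simp add: space_PiM)
    then show ?thesis unfolding b'_def mem_Collect_eq using eqG by metis
  qed
  then have 4: "b = (\<lambda>\<omega>. \<lambda>k\<in>{m..<n}. D k \<omega>) -` b' \<inter> space M"
    unfolding b(1) by blast
  have "a \<inter> b = (\<lambda>\<omega>. (\<lambda>k\<in>{..<m}. D k \<omega>, \<lambda>k\<in>{m..<n}. D k \<omega>)) -` (a' \<times> b') \<inter> space M"
    unfolding 3 4 by blast
  then show ?thesis
    using indep_varD[OF ind 1 2] unfolding 3[symmetric] 4[symmetric] by simp
qed

lemma cylinders_subset_events:
  assumes "\<And>t. t \<in> T \<Longrightarrow> X t \<in> borel_measurable M"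
  shows "cylinders M X T \<subseteq> sets M"
proof
  fix a assume "a \<in> cylinders M X T"
  then obtain F A where a: "a = {\<omega>\<in>space M. \<forall>t\<in>F. X t \<omega> \<in> A t}" "finite F" "F \<subseteq> T"
    "\<forall>t. A t \<in> sets borel"
    unfolding cylinders_def by blast
  show "a \<in> sets M"
    unfolding a(1) using a(3,4) by (intro sets_Collect_Ball_borel a(2) assms) auto
qed

lemma markov:
  assumes W: "brownian_motion M W" and s: "0 \<le> s"
    and a: "a \<in> sets (past M W s)" and b: "b \<in> sets (future M W s)"
  shows "measure M (a \<inter> b) = measure M a * measure M b"
proof -
  interpret prob_space M by (rule brownian_motion_prob_space[OF W])
  note m = brownian_motion_measurable[OF W]
  have "indep_set (cylinders M (\<lambda>t \<omega>. W \<omega> t) {0..s})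
      (cylinders M (\<lambda>t \<omega>. W \<omega> (s + t) - W \<omega> s) {0..})"
    using s by (intro indep_setI markov_cylinders[OF W s] cylinders_subset_events)
      (auto intro!: m borel_measurable_diff)
  then have "indep_set (sigma_sets (space M) (cylinders M (\<lambda>t \<omega>. W \<omega> t) {0..s}))
      (sigma_sets (space M) (cylinders M (\<lambda>t \<omega>. W \<omega> (s + t) - W \<omega> s) {0..}))"
    by (rule indep_set_sigma_sets) (rule Int_stable_cylinders)+
  from indep_setD[OF this] show ?thesis
    using a b sets_generated_cylinders unfolding past_def future_def by blast
qed

section \<open>Maximal inequality and support theorem\<close>

lemma brownian_motion_Chebyshev:
  assumes W: "brownian_motion M W" and st: "0 \<le> s" "s \<le> t" and a: "0 < a"
  shows "measure M {\<omega>\<in>space M. a \<le> \<bar>W \<omega> t - W \<omega> s\<bar>} \<le> (t - s) / a\<^sup>2"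
proof (cases "s = t")
  case True then show ?thesis using a by simp
next
  case False
  interpret prob_space M by (rule brownian_motion_prob_space[OF W])
  define \<sigma> where "\<sigma> = sqrt (t - s)"
  have \<sigma>: "0 < \<sigma>" using False st by (simp add: \<sigma>_def)
  have D: "distributed M lborel (\<lambda>\<omega>. W \<omega> t - W \<omega> s) (normal_density 0 \<sigma>)"
    unfolding \<sigma>_def using False st by (intro brownian_motion_increment[OF W]) auto
  have m: "(\<lambda>\<omega>. W \<omega> t - W \<omega> s) \<in> borel_measurable M"
    using st by (intro borel_measurable_diff brownian_motion_measurable[OF W]) auto
  have "integrable lborel (\<lambda>x. normal_density 0 \<sigma> x * x\<^sup>2)"
    using integrable_normal_moment[OF \<sigma>, of 0 2] by simp
  then have i: "integrable M (\<lambda>\<omega>. (W \<omega> t - W \<omega> s)\<^sup>2)"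
    by (subst (asm) distributed_integrable[OF D]) auto
  show ?thesis
    using Chebyshev_inequality[OF m i a] normal_distributed_variance[OF \<sigma> D] st
    unfolding normal_distributed_expectation[OF \<sigma> D] by (simp add: \<sigma>_def)
qed

text \<open>On [x - e, x + e] the density is smallest at the point farthest from 0, whose modulus is
  |x| + e; the bound is this value times the length of the window.\<close>

lemma brownian_motion_window:
  assumes W: "brownian_motion M W" and t: "0 < t" and e: "0 \<le> e"
  shows "2 * e * normal_density 0 (sqrt t) (\<bar>x\<bar> + e) \<le> measure M {\<omega>\<in>space M. \<bar>W \<omega> t - x\<bar> \<le> e}"
proof -
  interpret prob_space M by (rule brownian_motion_prob_space[OF W])
  define X where "X \<omega> = W \<omega> t - W \<omega> 0" for \<omega>
  have D: "distributed M lborel X (normal_density 0 (sqrt t))"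
    unfolding X_def using brownian_motion_increment[OF W, of 0 t] t by simp
  have X: "X \<in> borel_measurable M" using distributed_measurable[OF D] by simp
  have A: "{x - e..x + e} \<in> sets lborel" by simp
  have mono: "normal_density 0 (sqrt t) (\<bar>x\<bar> + e) \<le> normal_density 0 (sqrt t) y"
    if "y \<in> {x - e..x + e}" for y
  proof -
    have "\<bar>y\<bar> \<le> \<bar>\<bar>x\<bar> + e\<bar>" using that e by auto
    then have "y\<^sup>2 \<le> (\<bar>x\<bar> + e)\<^sup>2" using abs_le_square_iff by blast
    then show ?thesis
      unfolding normal_density_def using t by (auto intro!: mult_left_mono divide_right_mono)
  qed
  have "emeasure M (X -` {x - e..x + e} \<inter> space M)
      = (\<integral>\<^sup>+y. ennreal (normal_density 0 (sqrt t) y) * indicator {x - e..x + e} y \<partial>lborel)"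
    using distributed_emeasure[OF D A] by simp
  also have "\<dots> \<ge> (\<integral>\<^sup>+y. ennreal (normal_density 0 (sqrt t) (\<bar>x\<bar> + e)) * indicator {x - e..x + e} y \<partial>lborel)"
    by (intro nn_integral_mono) (use mono in \<open>auto simp: indicator_def ennreal_leI\<close>)
  also have "(\<integral>\<^sup>+y. ennreal (normal_density 0 (sqrt t) (\<bar>x\<bar> + e)) * indicator {x - e..x + e} y \<partial>lborel)
      = ennreal (normal_density 0 (sqrt t) (\<bar>x\<bar> + e) * (2 * e))"
    using e by (subst nn_integral_cmult_indicator) (auto simp: ennreal_mult)
  finally have "ennreal (normal_density 0 (sqrt t) (\<bar>x\<bar> + e) * (2 * e))
      \<le> emeasure M (X -` {x - e..x + e} \<inter> space M)" .
  then have "normal_density 0 (sqrt t) (\<bar>x\<bar> + e) * (2 * e) \<le> prob (X -` {x - e..x + e} \<inter> space M)"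
    by (simp add: emeasure_eq_measure)
  also have "X -` {x - e..x + e} \<inter> space M = {\<omega>\<in>space M. \<bar>W \<omega> t - x\<bar> \<le> e}"
    by (auto simp: X_def brownian_motion_zero[OF W] abs_le_iff)
  finally show ?thesis by (simp add: mult.commute)
qed

section \<open>Events over uncountable sets of times\<close>

lemma countable_dense_subset:
  fixes T :: "real set"
  assumes "closed T"
  obtains D where "countable D" "D \<subseteq> T" "closure D = T"
proof -
  obtain D where "countable D" "D \<subseteq> T" "T \<subseteq> closure D" using separable by metis
  then show ?thesis using that assms closure_minimal by blast
qed

lemma Ball_le_dense:
  fixes g :: "real \<Rightarrow> real"
  assumes "continuous_on T g" "D \<subseteq> T" "closure D = T" "\<And>t. t \<in> D \<Longrightarrow> g t \<le> e" "t \<in> T"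
  shows "g t \<le> e"
  using continuous_le_on_closure[of D g t e] assms by auto

text \<open>By continuity the condition may be tested on a countable dense subset of T, which turns
  the event into a countable intersection.\<close>

lemma sets_Collect_Ball_le:
  fixes X :: "real \<Rightarrow> 'a \<Rightarrow> real"
  assumes T: "closed T" and X: "\<And>t. t \<in> T \<Longrightarrow> X t \<in> borel_measurable N"
    and c: "\<And>\<omega>. \<omega> \<in> space N \<Longrightarrow> continuous_on T (\<lambda>t. X t \<omega>)"
  shows "{\<omega>\<in>space N. \<forall>t\<in>T. X t \<omega> \<le> e} \<in> sets N"
proof -
  obtain D where D: "countable D" "D \<subseteq> T" "closure D = T"
    using countable_dense_subset[OF T] .
  show ?thesis
  proof (cases "D = {}")
    case True
    then show ?thesis using D by simp
  next
    case False
    have "{\<omega>\<in>space N. \<forall>t\<in>T. X t \<omega> \<le> e} = (\<Inter>t\<in>D. {\<omega>\<in>space N. X t \<omega> \<le> e})"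
      using Ball_le_dense[OF c D(2,3)] D(2) False by blast
    also have "\<dots> \<in> sets N"
    proof (rule sets.countable_INT'[OF D(1) False], safe)
      fix t assume "t \<in> D"
      then have [measurable]: "X t \<in> borel_measurable N" using X D by blast
      show "{\<omega>\<in>space N. X t \<omega> \<le> e} \<in> sets N" by measurable
    qed
    finally show ?thesis .
  qed
qed

text \<open>Ottaviani's argument: after the first time with modulus above \<open>2 * a\<close> the path ends with modulus above \<open>a\<close> with probability at least \<open>1 / 2\<close>.\<close>

lemma brownian_motion_maximal_finite:
  assumes W: "brownian_motion M W" and S: "finite S" "S \<subseteq> {0..T}"
    and T: "0 \<le> T" and a: "0 < a" "2 * T \<le> a\<^sup>2"
  shows "measure M {\<omega>\<in>space M. \<exists>t\<in>S. 2 * a < \<bar>W \<omega> t\<bar>} \<le> 2 * T / a\<^sup>2"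
proof -
  interpret prob_space M by (rule brownian_motion_prob_space[OF W])
  define V where "V t = {\<omega>\<in>space M. 2 * a < \<bar>W \<omega> t\<bar> \<and> (\<forall>s\<in>{s\<in>S. s < t}. \<bar>W \<omega> s\<bar> \<le> 2 * a)}" for t
  define G where "G t = {\<omega>\<in>space M. \<bar>W \<omega> T - W \<omega> t\<bar> < a}" for t
  have mV: "V t \<in> sets (past M W t)" if "t \<in> S" for t
  proof -
    have m: "(\<lambda>\<omega>. \<bar>W \<omega> s\<bar>) \<in> borel_measurable (past M W t)" if "s \<in> S" "s \<le> t" for s
      using that S by (intro borel_measurable_abs measurable_past) auto
    have "{\<omega>\<in>space (past M W t). 2 * a < \<bar>W \<omega> t\<bar> \<and> (\<forall>s\<in>{s\<in>S. s < t}. \<bar>W \<omega> s\<bar> \<le> 2 * a)} \<in> sets (past M W t)"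
      using S m that
      by (intro sets.sets_Collect_conj sets.sets_Collect_finite_All borel_measurable_less borel_measurable_le)
        auto
    then show ?thesis by (simp add: V_def)
  qed
  have mG: "G t \<in> sets (future M W t)" if "t \<in> S" for t
  proof -
    have "(\<lambda>\<omega>. \<bar>W \<omega> (t + (T - t)) - W \<omega> t\<bar>) \<in> borel_measurable (future M W t)"
      using that S by (intro borel_measurable_abs measurable_future) auto
    then have "{\<omega>\<in>space (future M W t). \<bar>W \<omega> (t + (T - t)) - W \<omega> t\<bar> < a} \<in> sets (future M W t)"
      by (intro borel_measurable_less) auto
    then show ?thesis by (simp add: G_def)
  qed
  have ev: "V t \<in> events" "G t \<in> events" if "t \<in> S" for t
    using subsetD[OF sets_past_subset[OF W] mV[OF that]]
      subsetD[OF sets_future_subset[OF W] mG[OF that]] that S by auto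
  have half: "1 / 2 \<le> prob (G t)" if "t \<in> S" for t
  proof -
    have t: "0 \<le> t" "t \<le> T" using that S by auto
    have "prob (space M - G t) = prob {\<omega>\<in>space M. a \<le> \<bar>W \<omega> T - W \<omega> t\<bar>}"
      by (rule arg_cong[where f=prob]) (auto simp: G_def)
    also have "\<dots> \<le> (T - t) / a\<^sup>2" by (rule brownian_motion_Chebyshev[OF W t a(1)])
    also have "\<dots> \<le> 1 / 2" using a t by (simp add: field_simps)
    finally show ?thesis using prob_compl[OF ev(2)[OF that]] by simp
  qed
  have disj: "disjoint_family_on (\<lambda>t. V t \<inter> G t) S"
  proof -
    have "V s \<inter> V t = {}" if "s \<in> S" "t \<in> S" "s < t" for s t
      using that unfolding V_def by fastforce
    then show ?thesis
      unfolding disjoint_family_on_def by (metis Int_assoc Int_commute Int_empty_right linorder_neqE)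
  qed
  have cover: "{\<omega>\<in>space M. \<exists>t\<in>S. 2 * a < \<bar>W \<omega> t\<bar>} \<subseteq> (\<Union>t\<in>S. V t)"
  proof safe
    fix \<omega> t assume w: "\<omega> \<in> space M" "t \<in> S" "2 * a < \<bar>W \<omega> t\<bar>"
    define A where "A = {t\<in>S. 2 * a < \<bar>W \<omega> t\<bar>}"
    have A: "finite A" "A \<noteq> {}" using w S by (auto simp: A_def)
    have m: "Min A \<in> S" "2 * a < \<bar>W \<omega> (Min A)\<bar>" using Min_in[OF A] by (simp_all add: A_def)
    have "\<bar>W \<omega> s\<bar> \<le> 2 * a" if "s \<in> S" "s < Min A" for s
      using Min_le[OF A(1), of s] that by (force simp: A_def)
    then have "\<omega> \<in> V (Min A)"
      unfolding V_def using w(1) m by blast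
    then show "\<omega> \<in> (\<Union>t\<in>S. V t)" using m by blast
  qed
  have "prob {\<omega>\<in>space M. \<exists>t\<in>S. 2 * a < \<bar>W \<omega> t\<bar>} \<le> prob (\<Union>t\<in>S. V t)"
    using cover ev S by (intro finite_measure_mono) auto
  also have "\<dots> \<le> (\<Sum>t\<in>S. prob (V t))"
    using ev S by (intro finite_measure_subadditive_finite) auto
  also have "\<dots> \<le> (\<Sum>t\<in>S. 2 * prob (V t \<inter> G t))"
  proof (rule sum_mono)
    fix t assume t: "t \<in> S"
    then have "prob (V t \<inter> G t) = prob (V t) * prob (G t)"
      using S by (intro markov[OF W _ mV mG]) auto
    then show "prob (V t) \<le> 2 * prob (V t \<inter> G t)"
      using mult_left_mono[OF half[OF t], of "prob (V t)"] by simp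
  qed
  also have "\<dots> = 2 * prob (\<Union>t\<in>S. V t \<inter> G t)"
    using ev S disj
    by (subst finite_measure_finite_Union) (auto simp: sum_distrib_left)
  also have "prob (\<Union>t\<in>S. V t \<inter> G t) \<le> prob {\<omega>\<in>space M. a \<le> \<bar>W \<omega> T - W \<omega> 0\<bar>}"
  proof (rule finite_measure_mono)
    show "(\<Union>t\<in>S. V t \<inter> G t) \<subseteq> {\<omega>\<in>space M. a \<le> \<bar>W \<omega> T - W \<omega> 0\<bar>}"
      by (auto simp: V_def G_def brownian_motion_zero[OF W])
    have [measurable]: "(\<lambda>\<omega>. W \<omega> T) \<in> borel_measurable M" "(\<lambda>\<omega>. W \<omega> 0) \<in> borel_measurable M"
      using T by (auto intro: brownian_motion_measurable[OF W])
    show "{\<omega>\<in>space M. a \<le> \<bar>W \<omega> T - W \<omega> 0\<bar>} \<in> events" by measurable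
  qed
  also have "prob {\<omega>\<in>space M. a \<le> \<bar>W \<omega> T - W \<omega> 0\<bar>} \<le> (T - 0) / a\<^sup>2"
    by (rule brownian_motion_Chebyshev[OF W _ _ a(1)]) (use T in auto)
  finally show ?thesis by simp
qed

text \<open>The finite bound does not depend on the finite set, so it survives the exhaustion of a
  countable dense set of times. For 2 * T > a^2 the left-hand side is negative.\<close>

lemma brownian_motion_maximal:
  assumes W: "brownian_motion M W" and T: "0 \<le> T" and a: "0 < a"
  shows "1 - 2 * T / a\<^sup>2 \<le> measure M {\<omega>\<in>space M. \<forall>t\<in>{0..T}. \<bar>W \<omega> t\<bar> \<le> 2 * a}"
proof (cases "2 * T \<le> a\<^sup>2")
  case False
  then have "1 - 2 * T / a\<^sup>2 \<le> 0" using a by (simp add: field_simps)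
  also have "\<dots> \<le> measure M {\<omega>\<in>space M. \<forall>t\<in>{0..T}. \<bar>W \<omega> t\<bar> \<le> 2 * a}" by simp
  finally show ?thesis .
next
  case True
  interpret prob_space M by (rule brownian_motion_prob_space[OF W])
  obtain D where D: "countable D" "D \<subseteq> {0..T}" "closure D = {0..T}"
    using countable_dense_subset[of "{0..T}"] by auto
  have "D \<noteq> {}" using D(3) T by (metis atLeastatMost_empty_iff2 closure_empty not_less)
  define F where "F n = from_nat_into D ` {..n}" for n
  define E where "E n = {\<omega>\<in>space M. \<forall>t\<in>F n. \<bar>W \<omega> t\<bar> \<le> 2 * a}" for n
  have F: "finite (F n)" "F n \<subseteq> {0..T}" for n
    using D(2) from_nat_into[OF \<open>D \<noteq> {}\<close>] by (auto simp: F_def)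
  have UF: "(\<Union>n. F n) = D"
    using range_from_nat_into[OF \<open>D \<noteq> {}\<close> D(1)] unfolding F_def by blast
  have m: "(\<lambda>\<omega>. \<bar>W \<omega> t\<bar>) \<in> borel_measurable M" if "0 \<le> t" for t
    using that by (intro borel_measurable_abs brownian_motion_measurable[OF W])
  have E: "E n \<in> events" for n
    unfolding E_def
    by (intro sets.sets_Collect_finite_All[OF _ F(1)] borel_measurable_le m)
      (use F(2)[of n] in auto)
  have lower: "1 - 2 * T / a\<^sup>2 \<le> prob (E n)" for n
  proof -
    have "prob (space M - E n) = prob {\<omega>\<in>space M. \<exists>t\<in>F n. 2 * a < \<bar>W \<omega> t\<bar>}"
      by (rule arg_cong[where f=prob]) (auto simp: E_def not_le)
    also have "\<dots> \<le> 2 * T / a\<^sup>2"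
      by (rule brownian_motion_maximal_finite[OF W F T a True])
    finally show ?thesis using prob_compl[OF E] by simp
  qed
  have "decseq E" by (rule decseq_SucI) (auto simp: E_def F_def atMost_Suc)
  then have "(\<lambda>n. prob (E n)) \<longlonglongrightarrow> prob (\<Inter>n. E n)"
    using E by (intro finite_Lim_measure_decseq) auto
  moreover have "(\<Inter>n. E n) = {\<omega>\<in>space M. \<forall>t\<in>{0..T}. \<bar>W \<omega> t\<bar> \<le> 2 * a}"
  proof -
    have "(\<Inter>n. E n) = {\<omega>\<in>space M. \<forall>t\<in>D. \<bar>W \<omega> t\<bar> \<le> 2 * a}"
      unfolding UF[symmetric] E_def by blast
    moreover have "(\<forall>t\<in>D. \<bar>W \<omega> t\<bar> \<le> 2 * a) \<longleftrightarrow> (\<forall>t\<in>{0..T}. \<bar>W \<omega> t\<bar> \<le> 2 * a)"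
      if w: "\<omega> \<in> space M" for \<omega>
    proof -
      have "continuous_on {0..T} (\<lambda>t. \<bar>W \<omega> t\<bar>)"
        using continuous_on_subset[OF brownian_motion_continuous[OF W w], of "{0..T}"]
        by (intro continuous_intros) auto
      from Ball_le_dense[OF this D(2,3)] show ?thesis using D(2) by blast
    qed
    ultimately show ?thesis by (simp cong: conj_cong)
  qed
  ultimately have "(\<lambda>n. prob (E n)) \<longlonglongrightarrow> prob {\<omega>\<in>space M. \<forall>t\<in>{0..T}. \<bar>W \<omega> t\<bar> \<le> 2 * a}"
    by simp
  then show ?thesis by (rule LIMSEQ_le_const) (use lower in blast)
qed

text \<open>With \<open>N\<close> steps the increment hits its window with probability of order \<open>N powr (- 1 / 2)\<close>, whereas a large
  oscillation within one step has probability of order \<open>1 / N\<close>.\<close>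

lemma support_step_positive:
  fixes T L e :: real
  assumes "0 < T" "0 < L" "0 < e"
  shows "\<exists>N. 0 < N \<and> L * (T / real N) \<le> e / 4 \<and>
    0 < 2 * (e / (2 * real N)) * normal_density 0 (sqrt (T / real N)) (L * (T / real N) + e / (2 * real N))
      - 2 * (T / real N) / (e / 8)\<^sup>2"
proof -
  have 1: "\<forall>\<^sub>F x in at_top. L * (T / x) \<le> e / 4"
    using assms by real_asymp
  \<comment> \<open>After multiplication by x, the difference to be made positive equals
    \<open>K * sqrt x * exp (- (A / x)) - B\<close>, which tends to infinity.\<close>
  define A where "A = (L * T + e / 2)\<^sup>2 / (2 * T)"
  define B where "B = 128 * T / e\<^sup>2"
  define K where "K = e / sqrt (2 * pi * T)"
  have pos: "0 < K" "0 < B" "0 < A"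
    using assms by (auto simp: K_def B_def A_def intro!: divide_pos_pos zero_less_power add_nonneg_pos)
  have "\<forall>\<^sub>F x::real in at_top. 0 < K * sqrt x * exp (- (A / x)) - B"
    using pos by real_asymp
  then have 2: "\<forall>\<^sub>F x in at_top. 0 < 2 * (e / (2 * x)) * (1 / sqrt (2 * pi * (T / x)) * exp (- (L * (T / x) + e / (2 * x))\<^sup>2 / (2 * (T / x)))) - 2 * (T / x) / (e / 8)\<^sup>2"
    using eventually_gt_at_top[of 0]
  proof eventually_elim
    case (elim x)
    have "L * (T / x) + e / (2 * x) = (L * T + e / 2) / x" by (simp add: add_divide_distrib)
    then have 1: "- (L * (T / x) + e / (2 * x))\<^sup>2 / (2 * (T / x)) = - (A / x)"
      using elim assms by (simp add: A_def power2_eq_square field_simps)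
    have 2: "2 * (e / (2 * x)) * (1 / sqrt (2 * pi * (T / x))) = K * sqrt x / x"
      using elim assms by (simp add: K_def real_sqrt_mult real_sqrt_divide field_simps)
    have 3: "2 * (T / x) / (e / 8)\<^sup>2 = B / x"
      using elim assms by (simp add: B_def power2_eq_square)
    have "2 * (e / (2 * x)) * (1 / sqrt (2 * pi * (T / x)) * exp (- (L * (T / x) + e / (2 * x))\<^sup>2 / (2 * (T / x)))) - 2 * (T / x) / (e / 8)\<^sup>2
        = (K * sqrt x * exp (- (A / x)) - B) / x"
      unfolding 1 3 mult.assoc[symmetric] 2[unfolded mult.assoc[symmetric]]
      by (simp add: diff_divide_distrib)
    then show ?case using elim by (metis divide_pos_pos)
  qed
  have "\<forall>\<^sub>F N in sequentially. 0 < N \<and> L * (T / real N) \<le> e / 4 \<and>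
    0 < 2 * (e / (2 * real N)) * (1 / sqrt (2 * pi * (T / real N)) * exp (- (L * (T / real N) + e / (2 * real N))\<^sup>2 / (2 * (T / real N))))
      - 2 * (T / real N) / (e / 8)\<^sup>2"
    by (intro eventually_conj eventually_gt_at_top
        eventually_compose_filterlim[OF 1 filterlim_real_sequentially]
        eventually_compose_filterlim[OF 2 filterlim_real_sequentially])
  then show ?thesis
    using eventually_happens'[OF trivial_limit_sequentially] assms
    by (simp add: normal_density_def)
qed

section \<open>Tubes around a function and the support theorem\<close>

abbreviation tube :: "'a measure \<Rightarrow> ('a \<Rightarrow> real \<Rightarrow> real) \<Rightarrow> real \<Rightarrow> (real \<Rightarrow> real) \<Rightarrow> real \<Rightarrow> 'a set" where
  "tube M W T \<gamma> e \<equiv> {\<omega>\<in>space M. \<forall>t\<in>{0..T}. \<bar>W \<omega> t - \<gamma> t\<bar> \<le> e}"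

lemma sets_Collect_tube:
  fixes W :: "'a \<Rightarrow> real \<Rightarrow> real"
  assumes m: "\<And>t. 0 \<le> t \<Longrightarrow> t \<le> T \<Longrightarrow> (\<lambda>\<omega>. W \<omega> t) \<in> borel_measurable N"
    and c: "\<And>\<omega>. \<omega> \<in> space N \<Longrightarrow> continuous_on {0..T} (W \<omega>)" and \<gamma>: "continuous_on {0..T} \<gamma>"
  shows "{\<omega>\<in>space N. \<forall>t\<in>{0..T}. \<bar>W \<omega> t - \<gamma> t\<bar> \<le> e} \<in> sets N"
proof (rule sets_Collect_Ball_le)
  show "(\<lambda>\<omega>. \<bar>W \<omega> t - \<gamma> t\<bar>) \<in> borel_measurable N" if "t \<in> {0..T}" for t
    using that by (intro borel_measurable_abs borel_measurable_diff m) auto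
  show "continuous_on {0..T} (\<lambda>t. \<bar>W \<omega> t - \<gamma> t\<bar>)" if "\<omega> \<in> space N" for \<omega>
    by (intro continuous_intros c[OF that] \<gamma>)
qed simp

lemma brownian_motion_continuous_shift:
  assumes "brownian_motion M W" "\<omega> \<in> space M" "0 \<le> s"
  shows "continuous_on {0..T} (\<lambda>t. W \<omega> (s + t) - W \<omega> s)"
  using continuous_on_subset[OF brownian_motion_continuous[OF brownian_motion_shift[OF assms(1,3)] assms(2)],
      of "{0..T}"] by auto

lemma tube_in_future:
  assumes W: "brownian_motion M W" and s: "0 \<le> s" and \<gamma>: "continuous_on {0..T} \<gamma>"
  shows "{\<omega>\<in>space M. \<forall>t\<in>{0..T}. \<bar>W \<omega> (s + t) - W \<omega> s - \<gamma> t\<bar> \<le> e} \<in> sets (future M W s)"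
proof -
  have "{\<omega>\<in>space (future M W s). \<forall>t\<in>{0..T}. \<bar>(W \<omega> (s + t) - W \<omega> s) - \<gamma> t\<bar> \<le> e}
      \<in> sets (future M W s)"
    using brownian_motion_continuous_shift[OF W _ s] \<gamma>
    by (intro sets_Collect_tube measurable_future) auto
  then show ?thesis by simp
qed

lemma tube_in_past:
  assumes W: "brownian_motion M W" and s: "0 \<le> s" "s + T \<le> u" and \<gamma>: "continuous_on {0..T} \<gamma>"
  shows "{\<omega>\<in>space M. \<forall>t\<in>{0..T}. \<bar>W \<omega> (s + t) - W \<omega> s - \<gamma> t\<bar> \<le> e} \<in> sets (past M W u)"
proof -
  have "{\<omega>\<in>space (past M W u). \<forall>t\<in>{0..T}. \<bar>(W \<omega> (s + t) - W \<omega> s) - \<gamma> t\<bar> \<le> e}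
      \<in> sets (past M W u)"
    using brownian_motion_continuous_shift[OF W _ s(1)] s \<gamma>
    by (intro sets_Collect_tube borel_measurable_diff measurable_past) auto
  then show ?thesis by simp
qed

text \<open>Events of probabilities p and p' meet with probability at least p + p' - 1. The maximal
  inequality is used with a = e / 8 because it bounds the path by 2 * a; y makes the estimate
  uniform in the target x.\<close>

lemma support_step:
  assumes W: "brownian_motion M W" and \<tau>: "0 < \<tau>" and b: "0 < b" and e: "0 < e"
    and x: "\<bar>x\<bar> \<le> y"
  shows "2 * b * normal_density 0 (sqrt \<tau>) (y + b) - 2 * \<tau> / (e / 8)\<^sup>2
    \<le> measure M {\<omega>\<in>space M. \<bar>W \<omega> \<tau> - x\<bar> \<le> b \<and> (\<forall>t\<in>{0..\<tau>}. \<bar>W \<omega> t\<bar> \<le> e / 4)}"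
proof -
  interpret prob_space M by (rule brownian_motion_prob_space[OF W])
  let ?A = "{\<omega>\<in>space M. \<bar>W \<omega> \<tau> - x\<bar> \<le> b}"
  let ?B = "{\<omega>\<in>space M. \<forall>t\<in>{0..\<tau>}. \<bar>W \<omega> t\<bar> \<le> e / 4}"
  have "(\<lambda>\<omega>. \<bar>W \<omega> \<tau> - x\<bar>) \<in> borel_measurable M"
    using \<tau> by (intro borel_measurable_abs borel_measurable_diff brownian_motion_measurable[OF W]) auto
  then have A: "?A \<in> events" by measurable
  have B: "?B \<in> events"
    using sets_Collect_tube[of \<tau> W M "\<lambda>_. 0" "e / 4"] brownian_motion_measurable[OF W]
      continuous_on_subset[OF brownian_motion_continuous[OF W], of _ "{0..\<tau>}"] by auto
  have "normal_density 0 (sqrt \<tau>) (y + b) \<le> normal_density 0 (sqrt \<tau>) (\<bar>x\<bar> + b)"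
    unfolding normal_density_def using \<tau> x b
    by (auto intro!: mult_left_mono divide_right_mono power_mono)
  then have 1: "2 * b * normal_density 0 (sqrt \<tau>) (y + b) \<le> prob ?A"
    using brownian_motion_window[OF W \<tau>, of b x] b
    by (smt (verit) mult_left_mono)
  have 2: "1 - 2 * \<tau> / (e / 8)\<^sup>2 \<le> prob ?B"
    using brownian_motion_maximal[OF W, of \<tau> "e / 8"] \<tau> e by simp
  have "prob ?A + prob ?B - prob (?A \<inter> ?B) = prob (?A \<union> ?B)"
    using finite_measure_Union'[OF A B] finite_measure_Diff'[OF B A] by (simp add: Int_commute)
  also have "\<dots> \<le> 1" by simp
  finally have "prob ?A + prob ?B - 1 \<le> prob (?A \<inter> ?B)" by simp
  also have "?A \<inter> ?B = {\<omega>\<in>space M. \<bar>W \<omega> \<tau> - x\<bar> \<le> b \<and> (\<forall>t\<in>{0..\<tau>}. \<bar>W \<omega> t\<bar> \<le> e / 4)}"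
    by blast
  finally show ?thesis using 1 2 by simp
qed

text \<open>The path is made to follow \<gamma> over N short steps, and the Markov property
  multiplies their probabilities. The constant p is chosen before M and W because it is applied to
  shifted and rescaled paths of all levels.\<close>

lemma brownian_motion_support:
  fixes \<gamma> :: "real \<Rightarrow> real"
  assumes T: "0 < T" and e: "0 < e" and \<gamma>: "L-lipschitz_on {0..T} \<gamma>" "\<gamma> 0 = 0"
  shows "\<exists>p>0. \<forall>(M :: 'a measure) W. brownian_motion M W \<longrightarrow>
    p \<le> measure M (tube M W T \<gamma> e)"
proof -
  have L: "0 \<le> L" using lipschitz_on_nonneg[OF \<gamma>(1)] .
  define L' where "L' = L + 1"
  have L': "0 < L'" using L by (simp add: L'_def)
  have lip: "\<bar>\<gamma> u - \<gamma> v\<bar> \<le> L' * \<bar>u - v\<bar>" if "u \<in> {0..T}" "v \<in> {0..T}" for u v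
    using lipschitz_onD[OF \<gamma>(1) that] mult_right_mono[of L L' "\<bar>u - v\<bar>"]
    by (simp add: dist_real_def L'_def)
  obtain N where N: "0 < N" "L' * (T / real N) \<le> e / 4" and
    pos: "0 < 2 * (e / (2 * real N)) * normal_density 0 (sqrt (T / real N)) (L' * (T / real N) + e / (2 * real N))
      - 2 * (T / real N) / (e / 8)\<^sup>2"
    using support_step_positive[OF T L' e] by (elim exE conjE) (rule that)
  define \<tau> where "\<tau> = T / N"
  \<comment> \<open>The error budget: N increments with error at most b add up to e / 2 at the grid
    times, and within one step the path and \<gamma> each move by at most e / 4.\<close>
  define b where "b = e / (2 * N)"
  define c where "c = 2 * b * normal_density 0 (sqrt \<tau>) (L' * \<tau> + b) - 2 * \<tau> / (e / 8)\<^sup>2"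
  have c: "0 < c" using pos by (simp add: c_def b_def \<tau>_def)
  have \<tau>: "0 < \<tau>" and b: "0 < b" and N\<tau>: "N * \<tau> = T" and Nb: "N * b = e / 2"
    using T N e by (simp_all add: \<tau>_def b_def)
  define G where "G M W j = {\<omega>\<in>space M. \<bar>W \<omega> (j * \<tau> + \<tau>) - W \<omega> (j * \<tau>) - (\<gamma> (j * \<tau> + \<tau>) - \<gamma> (j * \<tau>))\<bar> \<le> b
      \<and> (\<forall>t\<in>{0..\<tau>}. \<bar>W \<omega> (j * \<tau> + t) - W \<omega> (j * \<tau>) - 0\<bar> \<le> e / 4)}"
    for M :: "'a measure" and W :: "'a \<Rightarrow> real \<Rightarrow> real" and j :: nat
  have main: "c ^ N \<le> measure M (tube M W T \<gamma> e)"
    if W: "brownian_motion M W" for M :: "'a measure" and W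
  proof -
    interpret prob_space M by (rule brownian_motion_prob_space[OF W])
    have j0: "0 \<le> j * \<tau>" for j :: nat using \<tau> by simp
    have G_future: "G M W j \<in> sets (future M W (j * \<tau>))" for j
    proof -
      have "(\<lambda>\<omega>. \<bar>W \<omega> (j * \<tau> + \<tau>) - W \<omega> (j * \<tau>) - (\<gamma> (j * \<tau> + \<tau>) - \<gamma> (j * \<tau>))\<bar>) \<in> borel_measurable (future M W (j * \<tau>))"
        using \<tau> by (intro borel_measurable_abs borel_measurable_diff measurable_future) auto
      then have "{\<omega>\<in>space (future M W (j * \<tau>)). \<bar>W \<omega> (j * \<tau> + \<tau>) - W \<omega> (j * \<tau>) - (\<gamma> (j * \<tau> + \<tau>) - \<gamma> (j * \<tau>))\<bar> \<le> b}
          \<in> sets (future M W (j * \<tau>))"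
        by (intro borel_measurable_le) auto
      from sets.Int[OF this tube_in_future[OF W j0[of j], where T=\<tau> and \<gamma>="\<lambda>_. 0" and e="e / 4"]]
      show ?thesis unfolding G_def by (simp add: Int_def conj_ac cong: conj_cong)
    qed
    have G_past: "G M W j \<in> sets (past M W (Suc j * \<tau>))" for j
    proof -
      have "(\<lambda>\<omega>. \<bar>W \<omega> (j * \<tau> + \<tau>) - W \<omega> (j * \<tau>) - (\<gamma> (j * \<tau> + \<tau>) - \<gamma> (j * \<tau>))\<bar>) \<in> borel_measurable (past M W (Suc j * \<tau>))"
        using \<tau> by (intro borel_measurable_abs borel_measurable_diff measurable_past) (auto simp: algebra_simps)
      then have "{\<omega>\<in>space (past M W (Suc j * \<tau>)). \<bar>W \<omega> (j * \<tau> + \<tau>) - W \<omega> (j * \<tau>) - (\<gamma> (j * \<tau> + \<tau>) - \<gamma> (j * \<tau>))\<bar> \<le> b}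
          \<in> sets (past M W (Suc j * \<tau>))"
        by (intro borel_measurable_le) auto
      from sets.Int[OF this tube_in_past[OF W j0[of j], where T=\<tau> and u="Suc j * \<tau>" and \<gamma>="\<lambda>_. 0" and e="e / 4"]]
      show ?thesis unfolding G_def by (simp add: Int_def conj_ac algebra_simps cong: conj_cong)
    qed
    have G_prob: "c \<le> prob (G M W j)" if j: "j < N" for j
    proof -
      have "Suc j * \<tau> \<le> N * \<tau>" using j \<tau> by (intro mult_right_mono) auto
      then have "\<bar>\<gamma> (j * \<tau> + \<tau>) - \<gamma> (j * \<tau>)\<bar> \<le> L' * \<tau>"
        using lip[of "j * \<tau> + \<tau>" "j * \<tau>"] \<tau> N\<tau> by (simp add: algebra_simps)
      from support_step[OF brownian_motion_shift[OF W j0] \<tau> b e this, of j]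
      show ?thesis unfolding c_def G_def by simp
    qed
    define A where "A k = {\<omega>\<in>space M. \<forall>j<k. \<omega> \<in> G M W j}" for k
    have A_Suc: "A (Suc k) = A k \<inter> G M W k" for k
      unfolding A_def by (auto simp: less_Suc_eq G_def)
    have A_past: "A k \<in> sets (past M W (k * \<tau>))" for k
    proof (induction k)
      case 0 then show ?case using sets.top[of "past M W 0"] by (simp add: A_def)
    next
      case (Suc k)
      have "k * \<tau> \<le> Suc k * \<tau>" using \<tau> by simp
      from sets_past_mono[OF this, of M W] have "A k \<in> sets (past M W (Suc k * \<tau>))"
        using Suc by blast
      then show ?case unfolding A_Suc using G_past[of k] by (rule sets.Int)
    qed
    have "k \<le> N \<Longrightarrow> c ^ k \<le> prob (A k)" for k
    proof (induction k)
      case 0 then show ?case by (simp add: A_def prob_space)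
    next
      case (Suc k)
      have "c ^ Suc k \<le> prob (A k) * prob (G M W k)"
        using Suc G_prob[of k] c mult_mono[of "c ^ k" "prob (A k)" c "prob (G M W k)"]
        by (simp add: mult.commute)
      also have "\<dots> = prob (A (Suc k))"
        unfolding A_Suc by (rule markov[OF W j0 A_past G_future, symmetric])
      finally show ?case .
    qed
    then have "c ^ N \<le> prob (A N)" by simp
    also have "\<dots> \<le> prob (tube M W T \<gamma> e)"
    proof (rule finite_measure_mono)
      show "tube M W T \<gamma> e \<in> events"
        using continuous_on_subset[OF brownian_motion_continuous[OF W], of _ "{0..T}"]
          lipschitz_on_continuous_on[OF \<gamma>(1)]
        by (intro sets_Collect_tube brownian_motion_measurable[OF W]) auto
      show "A N \<subseteq> tube M W T \<gamma> e"
      proof safe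
        fix \<omega> assume "\<omega> \<in> A N"
        then have w: "\<omega> \<in> space M" and GG: "\<And>j. j < N \<Longrightarrow> \<omega> \<in> G M W j" by (auto simp: A_def)
        then show "\<omega> \<in> space M" by simp
        have grid: "k \<le> N \<Longrightarrow> \<bar>W \<omega> (k * \<tau>) - \<gamma> (k * \<tau>)\<bar> \<le> k * b" for k :: nat
        proof (induction k)
          case 0 then show ?case using brownian_motion_zero[OF W w] \<gamma>(2) by simp
        next
          case (Suc k)
          have "\<bar>W \<omega> (k * \<tau> + \<tau>) - W \<omega> (k * \<tau>) - (\<gamma> (k * \<tau> + \<tau>) - \<gamma> (k * \<tau>))\<bar> \<le> b"
            using GG[of k] Suc.prems by (simp add: G_def)
          moreover have "Suc k * \<tau> = k * \<tau> + \<tau>" "Suc k * b = k * b + b" by (simp_all add: algebra_simps)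
          ultimately show ?case using Suc by simp
        qed
        fix t assume t: "t \<in> {0..T}"
        obtain j :: nat where j: "j < N" "j * \<tau> \<le> t" "t \<le> j * \<tau> + \<tau>"
        \<comment> \<open>At t = T the floor would give the index N, which lies past the last
          step.\<close>
        proof (cases "t = T")
          case True
          have "real (N - 1) * \<tau> + \<tau> = T" using N(1) N\<tau> by (cases N) (simp_all add: algebra_simps)
          then show ?thesis using that[of "N - 1"] N(1) True \<tau> by simp
        next
          case False
          define j where "j = nat \<lfloor>t / \<tau>\<rfloor>"
          have "real j \<le> t / \<tau>" "t / \<tau> < real j + 1"
            using t \<tau> by (simp_all add: j_def of_nat_nat)
          moreover from this have "real j < N"
            using t False N\<tau> \<tau> by (smt (verit) atLeastAtMost_iff divide_less_eq)
          ultimately show ?thesis using that[of j] \<tau> by (simp add: field_simps)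
        qed
        have "j * \<tau> \<in> {0..T}" using j t \<tau> by auto
        from lip[OF t this] have "\<bar>\<gamma> t - \<gamma> (j * \<tau>)\<bar> \<le> L' * \<bar>t - j * \<tau>\<bar>" .
        also have "\<dots> \<le> L' * \<tau>" using j L' by (intro mult_left_mono) auto
        also have "\<dots> \<le> e / 4" using N(2) by (simp add: \<tau>_def)
        finally have 1: "\<bar>\<gamma> t - \<gamma> (j * \<tau>)\<bar> \<le> e / 4" .
        have "\<forall>r\<in>{0..\<tau>}. \<bar>W \<omega> (j * \<tau> + r) - W \<omega> (j * \<tau>) - 0\<bar> \<le> e / 4"
          using GG[OF j(1)] unfolding G_def by blast
        from this[rule_format, of "t - j * \<tau>"] have 2: "\<bar>W \<omega> t - W \<omega> (j * \<tau>)\<bar> \<le> e / 4"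
          using j by simp
        have "j * b \<le> N * b" using j b by (intro mult_right_mono) auto
        then have "\<bar>W \<omega> (j * \<tau>) - \<gamma> (j * \<tau>)\<bar> \<le> e / 2" using grid[of j] j(1) Nb by simp
        then show "\<bar>W \<omega> t - \<gamma> t\<bar> \<le> e" using 1 2 by linarith
      qed
    qed
    finally show ?thesis .
  qed
  show ?thesis using main c by (intro exI[of _ "c ^ N"]) simp
qed

section \<open>Staircases\<close>

definition ramp :: "real \<Rightarrow> real" where
  "ramp x = max 0 (min 1 x)"

definition staircase :: "real \<Rightarrow> real" where
  "staircase t = 2 * (ramp t + ramp (t - 2) + ramp (t - 4) + ramp (t - 6))"

text \<open>The path crosses \<open>[z, z + 1]\<close>, \<open>[z + 2, z + 3]\<close>, \<open>[z + 4, z + 5]\<close>, \<open>[z + 6, z + 7]\<close> during \<open>[s, s + 1]\<close>,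
  \<open>[s + 2, s + 3]\<close>, \<open>[s + 4, s + 5]\<close>, \<open>[s + 6, s + 7]\<close>, with plateaus in between.\<close>

definition climbs :: "(real \<Rightarrow> real) \<Rightarrow> real \<Rightarrow> real \<Rightarrow> bool" where
  "climbs g z s \<longleftrightarrow> - 5 / 8 \<le> g s - z \<and> g s - z \<le> - 1 / 2 \<and>
     (\<forall>t\<in>{0..7}. \<bar>g (s + t) - g s - staircase t\<bar> \<le> 1 / 8)"

lemma staircase_0: "staircase 0 = 0"
  by (simp add: staircase_def ramp_def)

lemma staircase_lipschitz: "8-lipschitz_on S staircase"
proof (rule lipschitz_onI)
  fix x y :: real
  have "ramp (x - c) - ramp (y - c) \<le> \<bar>x - y\<bar> \<and> ramp (y - c) - ramp (x - c) \<le> \<bar>x - y\<bar>" for c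
    by (auto simp: ramp_def max_def min_def)
  from this[of 0] this[of 2] this[of 4] this[of 6]
  show "dist (staircase x) (staircase y) \<le> 8 * dist x y"
    unfolding staircase_def dist_real_def diff_zero by (intro abs_leI) argo+
qed simp

lemma staircase_continuous: "continuous_on S staircase"
  using lipschitz_on_continuous_on[OF staircase_lipschitz] .

abbreviation no_climb :: "'a measure \<Rightarrow> ('a \<Rightarrow> real \<Rightarrow> real) \<Rightarrow> real \<Rightarrow> real set \<Rightarrow> 'a set" where
  "no_climb M W z S \<equiv> {\<omega>\<in>space M. \<forall>s\<in>S. \<not> climbs (W \<omega>) z s}"

text \<open>N is left open because three choices occur: M itself, the past of a later time, and the
  sigma-algebra of a single path.\<close>

lemma climbs_measurable:
  assumes W: "brownian_motion M W" and s: "0 \<le> s" and N: "space N = space M"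
    and m: "\<And>t. s \<le> t \<Longrightarrow> t \<le> s + 7 \<Longrightarrow> (\<lambda>\<omega>. W \<omega> t) \<in> borel_measurable N"
  shows "{\<omega>\<in>space M. climbs (W \<omega>) z s} \<in> sets N"
proof -
  have [measurable]: "(\<lambda>\<omega>. W \<omega> s) \<in> borel_measurable N" by (rule m) auto
  have "{\<omega>\<in>space N. \<forall>t\<in>{0..7}. \<bar>(W \<omega> (s + t) - W \<omega> s) - staircase t\<bar> \<le> 1 / 8} \<in> sets N"
    using brownian_motion_continuous_shift[OF W _ s] staircase_continuous m N
    by (intro sets_Collect_tube borel_measurable_diff) auto
  moreover have "{\<omega>\<in>space N. - 5 / 8 \<le> W \<omega> s - z \<and> W \<omega> s - z \<le> - 1 / 2} \<in> sets N"
    by measurable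
  ultimately have "{\<omega>\<in>space N. - 5 / 8 \<le> W \<omega> s - z \<and> W \<omega> s - z \<le> - 1 / 2} \<inter>
      {\<omega>\<in>space N. \<forall>t\<in>{0..7}. \<bar>(W \<omega> (s + t) - W \<omega> s) - staircase t\<bar> \<le> 1 / 8} \<in> sets N"
    by (intro sets.Int)
  then show ?thesis
    unfolding N climbs_def by (simp add: Int_def conj_ac cong: conj_cong)
qed

lemma no_climb_measurable:
  assumes W: "brownian_motion M W" and S: "finite S" "S \<subseteq> {0..}" and N: "space N = space M"
    and m: "\<And>t s. s \<in> S \<Longrightarrow> s \<le> t \<Longrightarrow> t \<le> s + 7 \<Longrightarrow> (\<lambda>\<omega>. W \<omega> t) \<in> borel_measurable N"
  shows "no_climb M W z S \<in> sets N"
proof -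
  have "{\<omega>\<in>space N. \<forall>s\<in>S. \<not> climbs (W \<omega>) z s} \<in> sets N"
  proof (rule sets.sets_Collect_finite_All[OF _ S(1)], rule sets.sets_Collect_neg)
    fix s assume "s \<in> S"
    then show "{\<omega>\<in>space N. climbs (W \<omega>) z s} \<in> sets N"
      using climbs_measurable[OF W _ N, of s z] m S(2) N by auto
  qed
  then show ?thesis by (simp add: N)
qed

section \<open>The two events that make up an attempt\<close>

definition stair_event :: "'a measure \<Rightarrow> ('a \<Rightarrow> real \<Rightarrow> real) \<Rightarrow> real \<Rightarrow> 'a set" where
  "stair_event M W s = {\<omega>\<in>space M. \<forall>t\<in>{0..7}. \<bar>W \<omega> (s + t) - W \<omega> s - staircase t\<bar> \<le> 1 / 8}"

text \<open>From a value in [-y, y] such a path is at most -3y at half time and at least 3y at the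
  end. It therefore passes every level z - 5/8 with |z| \<le> y in the second half, provided that y
  \<ge> 1.\<close>

definition swing_event :: "'a measure \<Rightarrow> ('a \<Rightarrow> real \<Rightarrow> real) \<Rightarrow> real \<Rightarrow> real \<Rightarrow> 'a set" where
  "swing_event M W s y = {\<omega>\<in>space M. W \<omega> (s + y\<^sup>2 / 2) - W \<omega> s \<le> - 4 * y \<and> 4 * y \<le> W \<omega> (s + y\<^sup>2) - W \<omega> s}"

lemma stair_event_prob:
  "\<exists>p>0. \<forall>(M :: 'a measure) W. brownian_motion M W \<longrightarrow> (\<forall>s\<ge>0. p \<le> measure M (stair_event M W s))"
proof -
  obtain p where p: "0 < p" "\<And>(M :: 'a measure) W. brownian_motion M W \<Longrightarrow>
      p \<le> measure M (tube M W 7 staircase (1 / 8))"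
    using brownian_motion_support[OF _ _ staircase_lipschitz staircase_0, of 7 "1 / 8"] by auto
  show ?thesis
    unfolding stair_event_def
    using p(1) p(2)[OF brownian_motion_shift] by (intro exI[of _ p]) auto
qed

lemma swing_event_future:
  assumes "brownian_motion M W" "0 \<le> s"
  shows "swing_event M W s y \<in> sets (future M W s)"
proof -
  have [measurable]: "(\<lambda>\<omega>. W \<omega> (s + y\<^sup>2 / 2) - W \<omega> s) \<in> borel_measurable (future M W s)"
    "(\<lambda>\<omega>. W \<omega> (s + y\<^sup>2) - W \<omega> s) \<in> borel_measurable (future M W s)"
    by (intro measurable_future; simp)+
  have "{\<omega>\<in>space (future M W s). W \<omega> (s + y\<^sup>2 / 2) - W \<omega> s \<le> - 4 * y \<and> 4 * y \<le> W \<omega> (s + y\<^sup>2) - W \<omega> s}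
      \<in> sets (future M W s)"
    by measurable
  then show ?thesis by (simp add: swing_event_def)
qed

lemma swing_event_prob:
  "\<exists>c>0. \<forall>(M :: 'a measure) W. brownian_motion M W \<longrightarrow>
    (\<forall>s\<ge>0. \<forall>y>0. c \<le> measure M (swing_event M W s y))"
proof -
  \<comment> \<open>The values -5 at 1/2 and 5 at 1 leave room for an error of 1 in a swing with y =
    1; scaling gives every other y.\<close>
  define \<gamma> :: "real \<Rightarrow> real" where "\<gamma> t = - 10 * t + 30 * max 0 (t - 1 / 2)" for t
  have "40-lipschitz_on {0..1} \<gamma>"
  proof (rule lipschitz_onI)
    show "dist (\<gamma> x) (\<gamma> y) \<le> 40 * dist x y" for x y
      by (auto simp: \<gamma>_def dist_real_def max_def abs_if)
  qed simp
  then obtain c where c: "0 < c" "\<And>(M :: 'a measure) W. brownian_motion M W \<Longrightarrow>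
      c \<le> measure M (tube M W 1 \<gamma> 1)"
    using brownian_motion_support[of 1 1 40 \<gamma>] by (auto simp: \<gamma>_def)
  have "c \<le> measure M (swing_event M W s y)"
    if W: "brownian_motion M W" and s: "0 \<le> s" and y: "0 < y" for M :: "'a measure" and W s y
  proof -
    interpret prob_space M by (rule brownian_motion_prob_space[OF W])
    have "c \<le> prob {\<omega>\<in>space M. \<forall>t\<in>{0..1}. \<bar>(W \<omega> (s + y\<^sup>2 * t) - W \<omega> s) / y - \<gamma> t\<bar> \<le> 1}"
      by (rule c(2)[OF brownian_motion_scale[OF brownian_motion_shift[OF W s] y]])
    also have "\<dots> \<le> prob (swing_event M W s y)"
    proof (rule finite_measure_mono)
      show "swing_event M W s y \<in> events"
        using swing_event_future[OF W s] sets_future_subset[OF W s] by blast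
      show "{\<omega>\<in>space M. \<forall>t\<in>{0..1}. \<bar>(W \<omega> (s + y\<^sup>2 * t) - W \<omega> s) / y - \<gamma> t\<bar> \<le> 1} \<subseteq> swing_event M W s y"
      proof
        fix \<omega> assume "\<omega> \<in> {\<omega>\<in>space M. \<forall>t\<in>{0..1}. \<bar>(W \<omega> (s + y\<^sup>2 * t) - W \<omega> s) / y - \<gamma> t\<bar> \<le> 1}"
        then have w: "\<omega> \<in> space M" and
          t: "\<And>t. t \<in> {0..1} \<Longrightarrow> \<bar>(W \<omega> (s + y\<^sup>2 * t) - W \<omega> s) / y - \<gamma> t\<bar> \<le> 1" by auto
        from t[of "1 / 2"] have "(W \<omega> (s + y\<^sup>2 / 2) - W \<omega> s) / y \<le> - 4" by (simp add: \<gamma>_def)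
        moreover from t[of 1] have "4 \<le> (W \<omega> (s + y\<^sup>2) - W \<omega> s) / y" by (simp add: \<gamma>_def)
        ultimately show "\<omega> \<in> swing_event M W s y"
          using w y by (simp add: swing_event_def pos_divide_le_eq pos_le_divide_eq)
      qed
    qed
    finally show ?thesis .
  qed
  then show ?thesis using c(1) by blast
qed

lemma fine_grid_oscillation:
  fixes l :: real
  assumes W: "brownian_motion M W" and u: "0 \<le> u" and l: "0 \<le> l" and \<epsilon>: "0 < \<epsilon>" and d: "0 < d"
  shows "\<exists>N. 0 < N \<and> measure M {\<omega>\<in>space M. \<exists>k<N.
    d < \<bar>W \<omega> (u + real (Suc k) * l / real N) - W \<omega> (u + real k * l / real N)\<bar>} \<le> \<epsilon>"
proof -
  interpret prob_space M by (rule brownian_motion_prob_space[OF W])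
  define E where "E N = {\<omega>\<in>space M. \<forall>k\<in>{..<N}. \<bar>W \<omega> (u + Suc k * l / N) - W \<omega> (u + k * l / N)\<bar> \<le> d}" for N
  have E: "E N \<in> events" for N
    unfolding E_def
    using u l by (intro sets.sets_Collect_finite_All borel_measurable_le borel_measurable_abs
        borel_measurable_diff brownian_motion_measurable[OF W]) auto
  \<comment> \<open>\<open>E N\<close> need not be monotone in N. The events \<open>G n\<close> that
    all grids from n on are good increase, and uniform continuity puts every path into one of
    them.\<close>
  define G where "G n = (\<Inter>N\<in>{n..}. E N)" for n
  have G: "G n \<in> events" for n
    unfolding G_def using E by (intro sets.countable_INT') auto
  have inc: "incseq G" unfolding G_def by (rule incseq_SucI) auto
  have "space M \<subseteq> (\<Union>n. G n)"
  proof
    fix \<omega> assume w: "\<omega> \<in> space M"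
    have "uniformly_continuous_on {u..u + l} (W \<omega>)"
      using u continuous_on_subset[OF brownian_motion_continuous[OF W w], of "{u..u + l}"]
      by (intro compact_uniformly_continuous) auto
    then obtain \<delta> where \<delta>: "0 < \<delta>" "\<And>x y. x \<in> {u..u + l} \<Longrightarrow> y \<in> {u..u + l} \<Longrightarrow> \<bar>y - x\<bar> < \<delta> \<Longrightarrow> \<bar>W \<omega> y - W \<omega> x\<bar> < d"
      unfolding uniformly_continuous_on_def dist_real_def using d by metis
    obtain n :: nat where n: "l / \<delta> < n" using reals_Archimedean2 by blast
    have "\<omega> \<in> E N" if N: "n \<le> N" for N
    proof -
      have n0: "0 < real n" using n \<delta>(1) l by (smt (verit) divide_nonneg_pos)
      have "l < \<delta> * n" using n \<delta>(1) by (simp add: field_simps)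
      also have "\<dots> \<le> \<delta> * N" using N \<delta>(1) by simp
      finally have lN: "l / N < \<delta>" using N n0 by (simp add: field_simps)
      have "\<bar>W \<omega> (u + Suc k * l / N) - W \<omega> (u + k * l / N)\<bar> \<le> d" if k: "k < N" for k
      proof -
        have "real (Suc k) * l \<le> N * l" "real k * l \<le> N * l"
          using k l by (auto intro!: mult_right_mono)
        then have "Suc k * l / N \<le> l" "k * l / N \<le> l" "0 \<le> Suc k * l / N" "0 \<le> k * l / N"
          using k l by (auto simp: field_simps)
        moreover have "(u + Suc k * l / N) - (u + k * l / N) = l / N"
          by (simp add: field_simps add_divide_distrib)
        moreover have "0 \<le> l / N" using l by simp
        ultimately have "\<bar>W \<omega> (u + Suc k * l / N) - W \<omega> (u + k * l / N)\<bar> < d"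
          using lN by (intro \<delta>(2)) auto
        then show ?thesis by simp
      qed
      then show ?thesis using w by (simp add: E_def)
    qed
    then show "\<omega> \<in> (\<Union>n. G n)" by (auto simp: G_def)
  qed
  then have U: "(\<Union>n. G n) = space M" using G sets.sets_into_space by blast
  have "(\<lambda>n. prob (G n)) \<longlonglongrightarrow> prob (\<Union>n. G n)"
    using G inc by (intro finite_Lim_measure_incseq) auto
  then have "(\<lambda>n. prob (G n)) \<longlonglongrightarrow> 1" by (simp add: U prob_space)
  then have "\<forall>\<^sub>F n in sequentially. 1 - \<epsilon> < prob (G n)"
    using \<epsilon> by (intro order_tendstoD) auto
  then obtain n where n: "1 - \<epsilon> < prob (G n)" by (auto simp: eventually_sequentially)
  have "prob {\<omega>\<in>space M. \<exists>k<Suc n. d < \<bar>W \<omega> (u + Suc k * l / Suc n) - W \<omega> (u + k * l / Suc n)\<bar>}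
      = prob (space M - E (Suc n))"
    by (rule arg_cong[where f=prob]) (auto simp: E_def not_le Ball_def simp del: of_nat_Suc)
  moreover have "prob (G n) \<le> prob (E (Suc n))"
    using E by (intro finite_measure_mono) (auto simp: G_def)
  ultimately show ?thesis
    using n prob_compl[OF E, of "Suc n"] by (intro exI[of _ "Suc n"]) (simp del: of_nat_Suc)
qed

text \<open>The attempt starts at the first passage of the level \<open>z - 5 / 8\<close> on a grid so fine that overshooting by more
  than \<open>1 / 8\<close> is unlikely.\<close>

lemma climbs_single_scale:
  assumes W: "brownian_motion M W" and t0: "0 \<le> t0" and y: "1 \<le> y" and \<epsilon>: "0 < \<epsilon>"
    and p: "0 \<le> p" "p \<le> 1" "\<And>s. 0 \<le> s \<Longrightarrow> p \<le> measure M (stair_event M W s)"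
    and c: "c \<le> measure M (swing_event M W t0 y)"
  shows "\<exists>S. finite S \<and> S \<subseteq> {t0..t0 + y\<^sup>2} \<and> (\<forall>z F. \<bar>z\<bar> \<le> y \<longrightarrow> F \<in> sets (past M W t0) \<longrightarrow>
    (\<forall>\<omega>\<in>F. \<bar>W \<omega> t0\<bar> \<le> y) \<longrightarrow>
    measure M (F \<inter> no_climb M W z S) \<le> (1 - p * c) * measure M F + \<epsilon>)"
proof -
  interpret prob_space M by (rule brownian_motion_prob_space[OF W])
  define u where "u = t0 + y\<^sup>2 / 2"
  define l where "l = y\<^sup>2 / 2"
  have u: "0 \<le> u" "t0 \<le> u" and l: "0 \<le> l" and ul: "u + l = t0 + y\<^sup>2"
    using t0 by (simp_all add: u_def l_def)
  obtain N where N: "0 < N" and osc: "prob {\<omega>\<in>space M. \<exists>k<N.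
      1 / 8 < \<bar>W \<omega> (u + real (Suc k) * l / real N) - W \<omega> (u + real k * l / real N)\<bar>} \<le> \<epsilon>"
    using fine_grid_oscillation[OF W u(1) l \<epsilon>, of "1 / 8", OF divide_pos_pos[OF zero_less_one zero_less_numeral]]
    by (elim exE conjE) (rule that)
  define g where "g k = u + real k * l / N" for k :: nat
  define Os where "Os = {\<omega>\<in>space M. \<exists>k<N. 1 / 8 < \<bar>W \<omega> (g (Suc k)) - W \<omega> (g k)\<bar>}"
  have g0: "g 0 = u" and gN: "g N = u + l" using N by (simp_all add: g_def)
  have g_mono: "g i \<le> g k" if "i \<le> k" for i k
    using that l N by (auto simp: g_def intro!: divide_right_mono mult_right_mono)
  have gu: "u \<le> g k" for k using g_mono[of 0 k] g0 by simp
  have g_bd: "t0 \<le> g k" "0 \<le> g k" for k using gu[of k] u by auto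
  have Os: "Os \<in> events"
  proof -
    have Os_eq: "Os = {\<omega>\<in>space M. \<exists>k\<in>{..<N}. 1 / 8 < \<bar>W \<omega> (g (Suc k)) - W \<omega> (g k)\<bar>}"
      unfolding Os_def by blast
    show ?thesis unfolding Os_eq
      using g_bd by (intro sets.sets_Collect_finite_Ex borel_measurable_less borel_measurable_abs
        borel_measurable_diff brownian_motion_measurable[OF W]) auto
  qed
  \<comment> \<open>The grid covers the second half of the time window and is fixed before z and
    F.\<close>
  define S where "S = g ` {..N}"
  have S: "finite S" "S \<subseteq> {t0..t0 + y\<^sup>2}"
    using g_bd g_mono[of _ N] gN ul by (auto simp: S_def)
  have stair_future: "stair_event M W s \<in> sets (future M W s)" if "0 \<le> s" for s
    unfolding stair_event_def by (rule tube_in_future[OF W that staircase_continuous])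
  have main: "prob (F \<inter> no_climb M W z S) \<le> (1 - p * c) * prob F + \<epsilon>"
    if z: "\<bar>z\<bar> \<le> y" and F: "F \<in> sets (past M W t0)" and Fy: "\<And>\<omega>. \<omega> \<in> F \<Longrightarrow> \<bar>W \<omega> t0\<bar> \<le> y" for z F
  proof -
    \<comment> \<open>Together with an overshoot of at most 1/8 this gives the starting window
      [z - 5/8, z - 1/2] of \<open>climbs\<close>.\<close>
    define a where "a = z - 5 / 8"
    define V where "V k = {\<omega>\<in>space M. (\<forall>i\<in>{..<k}. W \<omega> (g i) < a) \<and> a \<le> W \<omega> (g k) \<and> W \<omega> (g k) \<le> a + 1 / 8}" for k
    have V_past: "V k \<in> sets (past M W (g k))" for k
    proof -
      have "{\<omega>\<in>space (past M W (g k)). (\<forall>i\<in>{..<k}. W \<omega> (g i) < a) \<and> a \<le> W \<omega> (g k) \<and> W \<omega> (g k) \<le> a + 1 / 8}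
          \<in> sets (past M W (g k))"
        using g_bd g_mono by (intro sets.sets_Collect_conj sets.sets_Collect_finite_All
            borel_measurable_less borel_measurable_le measurable_past) auto
      then show ?thesis by (simp add: V_def)
    qed
    have FV_past: "F \<inter> V k \<in> sets (past M W (g k))" for k
      using V_past[of k] F sets_past_mono[OF g_bd(1)[of k], of M W] by blast
    have Fe: "F \<in> events" using F sets_past_subset[OF W] by blast
    have Ve: "V k \<in> events" for k using V_past[of k] sets_past_subset[OF W] by blast
    have Ee: "stair_event M W s \<in> events" if "0 \<le> s" for s
      using stair_future[OF that] sets_future_subset[OF W that] by blast
    have Ce: "swing_event M W t0 y \<in> events"
      using swing_event_future[OF W t0] sets_future_subset[OF W t0] by blast
    have disj_less: False if "i < k" "\<omega> \<in> V i" "\<omega> \<in> V k" for i k \<omega>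
    proof -
      have "W \<omega> (g i) < a" using that(1,3) by (simp add: V_def)
      moreover have "a \<le> W \<omega> (g i)" using that(2) by (simp add: V_def)
      ultimately show False by simp
    qed
    have disj: "V i \<inter> V k = {}" if "i \<noteq> k" for i k
      using disj_less that by (meson disjoint_iff linorder_neqE_nat)
    have disjV: "disjoint_family_on (\<lambda>k. F \<inter> V k) {..N}"
      unfolding disjoint_family_on_def using disj by blast
    have disjT: "disjoint_family_on (\<lambda>k. F \<inter> V k \<inter> stair_event M W (g k)) {..N}"
      unfolding disjoint_family_on_def using disj by blast
    have climb: "climbs (W \<omega>) z (g k)" if "\<omega> \<in> V k" "\<omega> \<in> stair_event M W (g k)" for \<omega> k
      using that by (auto simp: climbs_def V_def stair_event_def a_def)
    define T where "T = (\<Union>k\<in>{..N}. F \<inter> V k \<inter> stair_event M W (g k))"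
    have Te: "T \<in> events" unfolding T_def using Fe Ve Ee g_bd by (intro sets.finite_UN) auto
    \<comment> \<open>On the swing event the path is below a at the first grid point and not below a
      at the last one, so a first grid passage exists; it overshoots by at most 1/8 unless the grid
      oscillates.\<close>
    have "F \<inter> swing_event M W t0 y \<subseteq> (\<Union>k\<in>{..N}. F \<inter> V k) \<union> Os"
    proof
      fix \<omega> assume w: "\<omega> \<in> F \<inter> swing_event M W t0 y"
      then have ws: "\<omega> \<in> space M" using sets.sets_into_space[OF Fe] by blast
      have W0: "\<bar>W \<omega> t0\<bar> \<le> y" using w Fy by blast
      have sw: "W \<omega> u - W \<omega> t0 \<le> - 4 * y" "4 * y \<le> W \<omega> (u + l) - W \<omega> t0"
        using w unfolding swing_event_def u_def ul[unfolded u_def] by auto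
      have lo: "W \<omega> (g 0) < a" using sw(1) W0 y z unfolding g0 a_def by linarith
      have hi: "a \<le> W \<omega> (g N)" using sw(2) W0 y z unfolding gN a_def by linarith
      define k where "k = (LEAST k. a \<le> W \<omega> (g k))"
      have k: "a \<le> W \<omega> (g k)" unfolding k_def by (rule LeastI[of _ N]) (rule hi)
      have kN: "k \<le> N" unfolding k_def by (rule Least_le) (rule hi)
      have lt: "W \<omega> (g i) < a" if "i < k" for i
        using not_less_Least[of i "\<lambda>k. a \<le> W \<omega> (g k)"] that by (simp add: k_def)
      have "k \<noteq> 0" using k lo by (auto intro: ccontr)
      then obtain j where j: "k = Suc j" by (cases k) auto
      then have jN: "j < N" using kN by simp
      show "\<omega> \<in> (\<Union>k\<in>{..N}. F \<inter> V k) \<union> Os"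
      proof (cases "\<omega> \<in> Os")
        case False
        then have "\<bar>W \<omega> (g k) - W \<omega> (g j)\<bar> \<le> 1 / 8"
          using ws jN unfolding Os_def mem_Collect_eq j by (meson not_less)
        moreover have "W \<omega> (g j) < a" using lt[of j] j by simp
        ultimately have "W \<omega> (g k) \<le> a + 1 / 8" by linarith
        then have "\<omega> \<in> V k" using ws lt k by (simp add: V_def)
        then show ?thesis using kN w by blast
      qed simp
    qed
    then have "prob (F \<inter> swing_event M W t0 y) \<le> prob ((\<Union>k\<in>{..N}. F \<inter> V k) \<union> Os)"
      using Fe Ve Os by (intro finite_measure_mono) auto
    also have "\<dots> \<le> prob (\<Union>k\<in>{..N}. F \<inter> V k) + prob Os"
      using Fe Ve Os by (intro measure_Un_le) auto
    also have "prob Os \<le> \<epsilon>" using osc by (simp add: Os_def g_def)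
    also have "prob (F \<inter> swing_event M W t0 y) = prob F * prob (swing_event M W t0 y)"
      by (rule markov[OF W t0 F swing_event_future[OF W t0]])
    finally have 1: "prob F * prob (swing_event M W t0 y) - \<epsilon> \<le> prob (\<Union>k\<in>{..N}. F \<inter> V k)" by simp
    have "prob F * c \<le> prob F * prob (swing_event M W t0 y)" using c by (intro mult_left_mono) auto
    with 1 have 2: "prob F * c - \<epsilon> \<le> prob (\<Union>k\<in>{..N}. F \<inter> V k)" by simp
    \<comment> \<open>The events \<open>V k\<close> are disjoint, and the Markov property is used at
      each deterministic time \<open>g k\<close> instead of at the random first passage.\<close>
    have "p * prob (\<Union>k\<in>{..N}. F \<inter> V k) = (\<Sum>k\<in>{..N}. p * prob (F \<inter> V k))"
      using disjV Fe Ve by (subst finite_measure_finite_Union) (auto simp: sum_distrib_left)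
    also have "\<dots> \<le> (\<Sum>k\<in>{..N}. prob (F \<inter> V k \<inter> stair_event M W (g k)))"
    proof (rule sum_mono)
      fix k
      have "p * prob (F \<inter> V k) \<le> prob (F \<inter> V k) * prob (stair_event M W (g k))"
        using mult_left_mono[OF p(3)[OF g_bd(2)[of k]], of "prob (F \<inter> V k)"] by (simp add: mult.commute)
      also have "\<dots> = prob (F \<inter> V k \<inter> stair_event M W (g k))"
        by (rule markov[OF W g_bd(2) FV_past stair_future[OF g_bd(2)], symmetric])
      finally show "p * prob (F \<inter> V k) \<le> prob (F \<inter> V k \<inter> stair_event M W (g k))" .
    qed
    also have "\<dots> = prob T"
      unfolding T_def using disjT Fe Ve Ee g_bd by (subst finite_measure_finite_Union) auto
    finally have 3: "p * prob (\<Union>k\<in>{..N}. F \<inter> V k) \<le> prob T" .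
    have "prob (F \<inter> no_climb M W z S) \<le> prob (F - T)"
    proof (rule finite_measure_mono)
      show "F \<inter> no_climb M W z S \<subseteq> F - T"
      proof
        fix \<omega> assume w: "\<omega> \<in> F \<inter> no_climb M W z S"
        then have "\<not> climbs (W \<omega>) z (g k)" if "k \<le> N" for k using that by (simp add: S_def)
        then have "\<omega> \<notin> T" unfolding T_def using climb by blast
        then show "\<omega> \<in> F - T" using w by blast
      qed
    qed (use Fe Te in auto)
    also have "\<dots> = prob F - prob T"
      unfolding T_def using Fe Te[unfolded T_def] by (intro finite_measure_Diff) blast+
    also have "\<dots> \<le> prob F - p * (prob F * c - \<epsilon>)"
      using 3 mult_left_mono[OF 2 p(1)] by simp
    also have "\<dots> \<le> (1 - p * c) * prob F + \<epsilon>"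
      using mult_right_mono[OF p(2), of \<epsilon>] \<epsilon> by (simp add: algebra_simps)
    finally show ?thesis .
  qed
  show ?thesis using S main by (intro exI[of _ S]) blast
qed

text \<open>Origin of the base 16: there are n successive scales, each 8 + 2 ^ n times the previous
  one.\<close>

lemma scale_count_bound: "1 \<le> n \<Longrightarrow> (8 + 2 ^ n) ^ n \<le> (16 :: real) ^ n\<^sup>2"
proof -
  assume n: "1 \<le> n"
  have "(8 :: real) ^ 1 \<le> 8 ^ n" "(2 :: real) ^ 1 \<le> 2 ^ n"
    using n by (intro power_increasing; simp)+
  then have "8 + 2 ^ n \<le> 8 * (2 :: real) ^ n" "8 * (2 :: real) ^ n \<le> 8 ^ n * 2 ^ n"
    by simp_all
  then have "(8 + 2 ^ n :: real) \<le> 8 ^ n * 2 ^ n" by linarith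
  also have "\<dots> = (16 :: real) ^ n" by (simp flip: power_mult_distrib)
  finally have "(8 + 2 ^ n) ^ n \<le> ((16 :: real) ^ n) ^ n" by (intro power_mono) auto
  then show ?thesis by (simp add: power2_eq_square power_mult)
qed

text \<open>The finite set S of starting times is quantified before the target z. One set thus
  serves every target up to distance \<rho>, including a random target that is independent of the
  path.\<close>

definition climb_rate :: "'a measure \<Rightarrow> real \<Rightarrow> bool" where
  "climb_rate M q \<longleftrightarrow> (\<forall>W n \<rho>. brownian_motion M W \<longrightarrow> 1 \<le> n \<longrightarrow> 1 \<le> \<rho> \<longrightarrow>
    (\<exists>S. finite S \<and> S \<subseteq> {0..16 ^ n\<^sup>2 * \<rho>\<^sup>2} \<and> (\<forall>z. \<bar>z\<bar> \<le> \<rho> \<longrightarrow>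
      measure M (no_climb M W z S) \<le> 3 * real n * q ^ n)))"

text \<open>As long as |W| is moderate at the start of each scale, every scale multiplies the
  failure probability by 1 - p * c, up to an additive \<epsilon>. Immoderate starting values cost at
  most another \<epsilon> per scale.\<close>

lemma climbs_multi_scale: "\<exists>q. 0 < q \<and> q < 1 \<and> (\<forall>M :: 'a measure. climb_rate M q)"
proof -
  obtain p0 where p0: "0 < p0"
    "\<And>(M :: 'a measure) W s. brownian_motion M W \<Longrightarrow> 0 \<le> s \<Longrightarrow> p0 \<le> measure M (stair_event M W s)"
    using stair_event_prob by blast
  obtain c0 where c0: "0 < c0"
    "\<And>(M :: 'a measure) W s y. brownian_motion M W \<Longrightarrow> 0 \<le> s \<Longrightarrow> 0 < y \<Longrightarrow>
      c0 \<le> measure M (swing_event M W s y)"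
    using swing_event_prob by blast
  define p where "p = min p0 1"
  define c where "c = min c0 1"
  have p: "0 < p" "p \<le> 1" "p \<le> p0" and c: "0 < c" "c \<le> 1" "c \<le> c0"
    using p0 c0 by (auto simp: p_def c_def)
  \<comment> \<open>The maximum with 1/2 absorbs the errors \<epsilon> = (1 / 2) ^ n.\<close>
  define q where "q = max (1 - p * c) (1 / 2)"
  have pc: "0 < p * c" "p * c \<le> 1" using p c by (auto intro: mult_le_one)
  have q: "0 < q" "q < 1" "1 - p * c \<le> q" "1 / 2 \<le> q" using pc by (auto simp: q_def)
  have main: "\<exists>S. finite S \<and> S \<subseteq> {0..16 ^ n\<^sup>2 * \<rho>\<^sup>2} \<and> (\<forall>z. \<bar>z\<bar> \<le> \<rho> \<longrightarrow>
      measure M (no_climb M W z S) \<le> 3 * real n * q ^ n)"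
    if W: "brownian_motion M W" and n: "1 \<le> n" and \<rho>: "1 \<le> \<rho>"
    for M :: "'a measure" and W n and \<rho> :: real
  proof -
    interpret prob_space M by (rule brownian_motion_prob_space[OF W])
    \<comment> \<open>Since t j \<ge> 1, the factor 8 + 2 ^ n leaves room for a time window of
      length (y j)^2 = 2 ^ n * t j followed by a climb of duration 7. By Chebyshev's inequality the
      choice of y j makes |W| exceed y j at time t j with probability at most 2 ^ (-n).\<close>
    define t where "t j = (8 + 2 ^ n) ^ j * \<rho>\<^sup>2" for j :: nat
    define y where "y j = sqrt (2 ^ n * t j)" for j :: nat
    define \<epsilon> :: real where "\<epsilon> = (1 / 2) ^ n"
    have \<epsilon>: "0 < \<epsilon>" by (simp add: \<epsilon>_def)
    have \<rho>2: "1 \<le> \<rho>\<^sup>2" using \<rho> by (simp add: one_le_power)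
    have t\<rho>: "\<rho>\<^sup>2 \<le> t j" for j
    proof -
      have "(1 :: real) \<le> (8 + 2 ^ n) ^ j" by (intro one_le_power) (simp add: add_increasing2)
      then show ?thesis unfolding t_def using mult_right_mono[of 1 _ "\<rho>\<^sup>2"] by fastforce
    qed
    have t1: "1 \<le> t j" and t0: "0 \<le> t j" for j using t\<rho>[of j] \<rho>2 by linarith+
    have y2: "(y j)\<^sup>2 = 2 ^ n * t j" for j using t0 by (simp add: y_def)
    have y\<rho>: "\<rho> \<le> y j" for j
    proof -
      have "\<rho>\<^sup>2 \<le> 1 * t j" using t\<rho> by simp
      also have "\<dots> \<le> 2 ^ n * t j" using t0 by (intro mult_right_mono) auto
      finally show ?thesis unfolding y_def using \<rho> by (intro real_le_rsqrt)
    qed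
    have t_Suc: "t j + (y j)\<^sup>2 + 7 \<le> t (Suc j)" for j
      using t1[of j] unfolding y2 by (simp add: t_def algebra_simps)
    have t_mono: "t i \<le> t j" if "i \<le> j" for i j
      by (rule lift_Suc_mono_le[OF _ that]) (use t_Suc t0 zero_le_power2 in \<open>smt (verit)\<close>)
    define Q where "Q j S \<longleftrightarrow> finite S \<and> S \<subseteq> {t j..t j + (y j)\<^sup>2} \<and> (\<forall>z F. \<bar>z\<bar> \<le> y j \<longrightarrow> F \<in> sets (past M W (t j)) \<longrightarrow>
        (\<forall>\<omega>\<in>F. \<bar>W \<omega> (t j)\<bar> \<le> y j) \<longrightarrow>
        prob (F \<inter> no_climb M W z S) \<le> (1 - p * c) * prob F + \<epsilon>)" for j S
    have "\<exists>S. Q j S" for j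
      unfolding Q_def
    proof (rule climbs_single_scale[OF W t0 _ \<epsilon>])
      show "1 \<le> y j" using y\<rho>[of j] \<rho> by linarith
      then show "c \<le> prob (swing_event M W (t j) (y j))" using c0(2)[OF W t0, of "y j" j] c(3) by linarith
      show "p \<le> prob (stair_event M W s)" if "0 \<le> s" for s using p0(2)[OF W that] p(3) by linarith
    qed (use p in auto)
    then obtain S where "\<And>j. Q j (S j)" by metis
    then have S: "\<And>j. finite (S j)" "\<And>j. S j \<subseteq> {t j..t j + (y j)\<^sup>2}"
      "\<And>j z F. \<bar>z\<bar> \<le> y j \<Longrightarrow> F \<in> sets (past M W (t j)) \<Longrightarrow> (\<forall>\<omega>\<in>F. \<bar>W \<omega> (t j)\<bar> \<le> y j) \<Longrightarrow>
        prob (F \<inter> no_climb M W z (S j)) \<le> (1 - p * c) * prob F + \<epsilon>"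
      unfolding Q_def by blast+
    define SS where "SS = (\<Union>j<n. S j)"
    have Sj0: "0 \<le> s" if "s \<in> S j" for s j using S(2)[of j] that t0[of j] by auto
    have "finite SS" using S(1) by (simp add: SS_def)
    moreover have "SS \<subseteq> {0..16 ^ n\<^sup>2 * \<rho>\<^sup>2}"
    proof
      fix s assume "s \<in> SS"
      then obtain j where j: "j < n" "s \<in> S j" by (auto simp: SS_def)
      have "s \<le> t j + (y j)\<^sup>2" using S(2)[of j] j by auto
      also have "\<dots> \<le> t (Suc j)" using t_Suc[of j] by linarith
      also have "\<dots> \<le> t n" using j by (intro t_mono) auto
      also have "\<dots> \<le> 16 ^ n\<^sup>2 * \<rho>\<^sup>2" unfolding t_def using scale_count_bound[OF n] by (intro mult_right_mono) auto
      finally show "s \<in> {0..16 ^ n\<^sup>2 * \<rho>\<^sup>2}" using Sj0[OF j(2)] by simp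
    qed
    moreover have "prob (no_climb M W z SS) \<le> 3 * real n * q ^ n"
      if z: "\<bar>z\<bar> \<le> \<rho>" for z
    proof -
      define G where "G j = {\<omega>\<in>space M. \<bar>W \<omega> (t j)\<bar> \<le> y j}" for j
      define D where "D j = no_climb M W z (S j)" for j
      define F where "F j = {\<omega>\<in>space M. \<forall>i<j. \<omega> \<in> G i \<and> \<omega> \<in> D i}" for j
      have F_Suc: "F (Suc j) = (F j \<inter> G j) \<inter> D j" for j
        by (auto simp: F_def G_def less_Suc_eq)
      have G_past: "G j \<in> sets (past M W (t j))" for j
      proof -
        have "{\<omega>\<in>space (past M W (t j)). \<bar>W \<omega> (t j)\<bar> \<le> y j} \<in> sets (past M W (t j))"
          using t0 by (intro borel_measurable_le borel_measurable_abs measurable_past) auto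
        then show ?thesis by (simp add: G_def)
      qed
      have D_past: "D j \<in> sets (past M W (t (Suc j)))" for j
        unfolding D_def
      proof (rule no_climb_measurable[OF W S(1)])
        show "S j \<subseteq> {0..}" using Sj0 by auto
        show "(\<lambda>\<omega>. W \<omega> r) \<in> borel_measurable (past M W (t (Suc j)))"
          if "s \<in> S j" "s \<le> r" "r \<le> s + 7" for r s
          using that Sj0[OF that(1)] t_Suc[of j] S(2)[of j] by (intro measurable_past) auto
      qed simp
      have past_mono: "A \<in> sets (past M W (t (Suc j)))" if "A \<in> sets (past M W (t j))" for A j
        using sets_past_mono[OF t_mono[of j "Suc j"], of M W] that by auto
      have F_past: "F j \<in> sets (past M W (t j))" for j
      proof (induction j)
        case 0 then show ?case using sets.top[of "past M W (t 0)"] by (simp add: F_def)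
      next
        case (Suc j)
        then show ?case unfolding F_Suc using G_past D_past past_mono by (intro sets.Int) auto
      qed
      have ev: "F j \<in> events" "G j \<in> events" "D j \<in> events" for j
        using F_past[of j] G_past[of j] D_past[of j] sets_past_subset[OF W] by blast+
      have Fb: "prob (F j) \<le> (1 - p * c) ^ j + j * \<epsilon>" for j
      proof (induction j)
        case 0 then show ?case by simp
      next
        case (Suc j)
        have "prob (F (Suc j)) \<le> (1 - p * c) * prob (F j \<inter> G j) + \<epsilon>"
          unfolding F_Suc D_def
        proof (rule S(3))
          show "\<bar>z\<bar> \<le> y j" using z y\<rho>[of j] by linarith
          show "F j \<inter> G j \<in> sets (past M W (t j))" using F_past G_past by (intro sets.Int)
        qed (auto simp: G_def)
        also have "\<dots> \<le> (1 - p * c) * ((1 - p * c) ^ j + j * \<epsilon>) + \<epsilon>"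
          using pc Suc finite_measure_mono[of "F j \<inter> G j" "F j"] ev
          by (intro add_right_mono mult_left_mono) auto
        also have "\<dots> \<le> (1 - p * c) ^ Suc j + Suc j * \<epsilon>"
          using pc mult_right_mono[of "1 - p * c" 1 "j * \<epsilon>"] \<epsilon> by (simp add: algebra_simps)
        finally show ?case .
      qed
      have Gb: "prob (space M - G j) \<le> \<epsilon>" for j
      proof -
        have "prob (space M - G j) \<le> prob {\<omega>\<in>space M. y j \<le> \<bar>W \<omega> (t j) - W \<omega> 0\<bar>}"
        proof (rule finite_measure_mono)
          have [measurable]: "(\<lambda>\<omega>. W \<omega> (t j)) \<in> borel_measurable M" "(\<lambda>\<omega>. W \<omega> 0) \<in> borel_measurable M"
            using t0 by (auto intro: brownian_motion_measurable[OF W])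
          show "{\<omega>\<in>space M. y j \<le> \<bar>W \<omega> (t j) - W \<omega> 0\<bar>} \<in> events" by measurable
        qed (auto simp: G_def brownian_motion_zero[OF W])
        also have "\<dots> \<le> (t j - 0) / (y j)\<^sup>2"
          using y\<rho>[of j] \<rho> t0 by (intro brownian_motion_Chebyshev[OF W]) auto
        also have "\<dots> = \<epsilon>" using t1[of j] by (simp add: y2 \<epsilon>_def power_one_over)
        finally show ?thesis .
      qed
      have U: "(\<Union>j<n. space M - G j) \<in> events"
        using ev by (intro sets.finite_UN sets.compl_sets) auto
      have "prob (no_climb M W z SS) \<le> prob (F n \<union> (\<Union>j<n. space M - G j))"
      proof (rule finite_measure_mono)
        show "no_climb M W z SS \<subseteq> F n \<union> (\<Union>j<n. space M - G j)"
          by (auto simp: SS_def F_def D_def)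
      qed (intro sets.Un ev U)
      also have "\<dots> \<le> prob (F n) + prob (\<Union>j<n. space M - G j)"
        by (intro measure_Un_le ev U)
      also have "prob (\<Union>j<n. space M - G j) \<le> (\<Sum>j<n. prob (space M - G j))"
        using ev by (intro finite_measure_subadditive_finite) auto
      also have "\<dots> \<le> (\<Sum>j<n. \<epsilon>)" using Gb by (intro sum_mono)
      finally have "prob (no_climb M W z SS) \<le> (1 - p * c) ^ n + 2 * (n * \<epsilon>)"
        using Fb[of n] by simp
      also have "(1 - p * c) ^ n \<le> 1 * q ^ n" using q pc by (simp add: power_mono)
      also have "1 * q ^ n \<le> n * q ^ n" using n q by (intro mult_right_mono) auto
      also have "n * \<epsilon> \<le> n * q ^ n" unfolding \<epsilon>_def using q by (intro mult_left_mono power_mono) auto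
      finally show ?thesis by simp
    qed
    ultimately show ?thesis by blast
  qed
  show ?thesis unfolding climb_rate_def using main q by (intro exI[of _ q]) blast
qed

section \<open>Inverse limits of intervals\<close>

lemma compact_decreasing_Inter_nonempty:
  fixes U :: "nat \<Rightarrow> 'b::t2_space set"
  assumes U: "\<And>n. compact (U n)" "\<And>n. U n \<noteq> {}" "\<And>n. U (Suc n) \<subseteq> U n"
  shows "(\<Inter>n. U n) \<noteq> {}"
proof -
  have mono: "U n \<subseteq> U m" if "m \<le> n" for m n
    using lift_Suc_antimono_le[of U m n] U(3) that by blast
  have "U 0 \<inter> (\<Inter>n\<in>UNIV. U n) \<noteq> {}"
  proof (rule compact_imp_fip_image)
    show "compact (U 0)" by (rule U)
    show "closed (U n)" for n using U(1) by (rule compact_imp_closed)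
    show "U 0 \<inter> (\<Inter>n\<in>I. U n) \<noteq> {}" if "finite I" for I
    proof -
      have "U (Max (insert 0 I)) \<subseteq> U 0 \<inter> (\<Inter>n\<in>I. U n)"
        using that mono by (intro Int_greatest INT_greatest mono) auto
      then show ?thesis using U(2) by blast
    qed
  qed
  then show ?thesis by blast
qed

text \<open>A separation of the intersection into compact parts at distance d extends to disjoint
  open neighbourhoods P and Q. Each U n meets both, so by connectedness it is not covered by P
  \<union> Q; by compactness a point outside P \<union> Q remains in the intersection.\<close>

lemma connected_decreasing_Inter:
  fixes U :: "nat \<Rightarrow> 'b::metric_space set"
  assumes U: "\<And>n. compact (U n)" "\<And>n. connected (U n)" "\<And>n. U (Suc n) \<subseteq> U n"
  shows "connected (\<Inter>n. U n)"
proof -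
  define V where "V = (\<Inter>n. U n)"
  have "closed V" unfolding V_def using U(1) by (intro closed_INT) (auto intro: compact_imp_closed)
  then have "compact (U 0 \<inter> V)" using U(1) by (intro compact_Int_closed) auto
  moreover have "U 0 \<inter> V = V" unfolding V_def by blast
  ultimately have V: "compact V" by simp
  have False if AB: "closed A" "closed B" "V \<subseteq> A \<union> B" "A \<inter> B \<inter> V = {}" "A \<inter> V \<noteq> {}" "B \<inter> V \<noteq> {}" for A B
  proof -
  have cA: "compact (A \<inter> V)" and cB: "compact (B \<inter> V)"
    using AB(1,2) V by (simp_all add: closed_Int_compact)
  obtain a where a: "a \<in> A \<inter> V" "\<And>x. x \<in> A \<inter> V \<Longrightarrow> infdist a (B \<inter> V) \<le> infdist x (B \<inter> V)"
    using continuous_attains_inf[OF cA AB(5) continuous_on_infdist[OF continuous_on_id, of _ "B \<inter> V"]] by blast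
  define d where "d = infdist a (B \<inter> V)"
  have "a \<notin> B \<inter> V" using a(1) AB(4) by blast
  then have d0: "0 < d"
    unfolding d_def using infdist_pos_not_in_closed[OF compact_imp_closed[OF cB] AB(6)] by simp
  have "d \<le> dist x y" if "x \<in> A \<inter> V" "y \<in> B \<inter> V" for x y
    using a(2)[OF that(1)] infdist_le[OF that(2), of x] unfolding d_def by linarith
  note d = d0 this
  define P where "P = (\<Union>x\<in>A \<inter> V. ball x (d / 2))"
  define Q where "Q = (\<Union>x\<in>B \<inter> V. ball x (d / 2))"
  have PQ: "open P" "open Q" by (auto simp: P_def Q_def)
  have disj: "P \<inter> Q = {}"
  proof (rule ccontr)
    assume "P \<inter> Q \<noteq> {}"
    then obtain z where z: "z \<in> P" "z \<in> Q" by blast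
    obtain x where x: "x \<in> A \<inter> V" "dist x z < d / 2"
      using z(1) unfolding P_def UN_iff mem_ball by blast
    obtain y where y: "y \<in> B \<inter> V" "dist y z < d / 2"
      using z(2) unfolding Q_def UN_iff mem_ball by blast
    have "dist x y < d" using x(2) y(2) dist_triangle_half_r[of z x d y] by (simp add: dist_commute)
    then show False using d(2)[OF x(1) y(1)] by simp
  qed
  have "V \<subseteq> P \<union> Q" using AB(3) d(1) unfolding P_def Q_def by force
  moreover have "(\<Inter>n. U n - (P \<union> Q)) \<noteq> {}"
  proof (rule compact_decreasing_Inter_nonempty)
    show "compact (U n - (P \<union> Q))" for n using U(1) PQ by (intro compact_diff) auto
    show "U (Suc n) - (P \<union> Q) \<subseteq> U n - (P \<union> Q)" for n using U(3) by blast
    show "U n - (P \<union> Q) \<noteq> {}" for n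
    proof
      assume "U n - (P \<union> Q) = {}"
      then have "U n \<subseteq> P \<union> Q" by blast
      moreover have "A \<inter> V \<subseteq> P" "B \<inter> V \<subseteq> Q" using d(1) by (auto simp: P_def Q_def)
      then have "P \<inter> U n \<noteq> {}" "Q \<inter> U n \<noteq> {}" using AB(5,6) unfolding V_def by blast+
      ultimately show False
        using connectedD[OF U(2) PQ, of n] disj by blast
    qed
  qed
  ultimately show False unfolding V_def by blast
  qed
  then show ?thesis unfolding connected_closed V_def[symmetric] by blast
qed

text \<open>Keeps the coordinates from n on and recomputes the lower ones from them. On the product
  of the X i below, this is a continuous retraction onto the sequences that satisfy the first n
  bonding relations.\<close>

fun pull_back :: "(nat \<Rightarrow> real \<Rightarrow> real) \<Rightarrow> nat \<Rightarrow> (nat \<Rightarrow> real) \<Rightarrow> nat \<Rightarrow> real" where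
  "pull_back f 0 x = x"
| "pull_back f (Suc n) x = pull_back f n (x(n := f n (x (Suc n))))"

lemma pull_back_ge: "n \<le> i \<Longrightarrow> pull_back f n x i = x i"
  by (induction f n x rule: pull_back.induct) auto

lemma pull_back_less: "i < n \<Longrightarrow> pull_back f n x i = f i (pull_back f n x (Suc i))"
proof (induction f n x rule: pull_back.induct)
  case (2 f n x)
  show ?case
  proof (cases "i = n")
    case True
    then show ?thesis by (simp add: pull_back_ge)
  next
    case False
    with 2 show ?thesis unfolding pull_back.simps less_Suc_eq by blast
  qed
qed simp

lemma pull_back_fixed: "(\<And>i. i < n \<Longrightarrow> f i (x (Suc i)) = x i) \<Longrightarrow> pull_back f n x = x"
  by (induction n) (auto simp: fun_upd_idem)

context
  fixes X :: "nat \<Rightarrow> real set" and f :: "nat \<Rightarrow> real \<Rightarrow> real"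
  assumes X: "\<And>i. continuum (X i)"
    and f: "\<And>i. continuous_on (X (Suc i)) (f i)" "\<And>i. f i ` X (Suc i) = X i"
begin

lemma pull_back_mem: "x \<in> Pi UNIV X \<Longrightarrow> pull_back f n x \<in> Pi UNIV X"
proof (induction n arbitrary: x)
  case (Suc n)
  have "x(n := f n (x (Suc n))) \<in> Pi UNIV X"
    using Suc.prems f(2)[of n] by (auto simp: Pi_iff)
  then show ?case using Suc.IH by simp
qed simp

lemma continuous_on_pull_back: "continuous_on (Pi UNIV X) (pull_back f n)"
proof (induction n)
  case 0
  have "pull_back f 0 = (\<lambda>x. x)" by (rule ext) simp
  then show ?case by simp
next
  case (Suc n)
  have c: "continuous_on S (\<lambda>x :: nat \<Rightarrow> real. x i)" for S i
    by (rule continuous_on_product_then_coordinatewise) (rule continuous_on_id)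
  have "continuous_on (Pi UNIV X) (\<lambda>x. x(n := f n (x (Suc n))))"
  proof (rule continuous_on_coordinatewise_then_product)
    fix i
    have "continuous_on (Pi UNIV X) (\<lambda>x. f n (x (Suc n)))"
      by (rule continuous_on_compose2[OF f(1) c]) auto
    then show "continuous_on (Pi UNIV X) (\<lambda>x. (x(n := f n (x (Suc n)))) i)"
      using c[of "Pi UNIV X" i] by (cases "i = n") auto
  qed
  moreover have "(\<lambda>x. x(n := f n (x (Suc n)))) ` Pi UNIV X \<subseteq> Pi UNIV X"
    using f(2)[of n] by (auto simp: Pi_iff)
  ultimately have "continuous_on (Pi UNIV X) (\<lambda>x. pull_back f n (x(n := f n (x (Suc n)))))"
    by (rule continuous_on_compose2[OF Suc])
  then show ?case by simp
qed

text \<open>Surjectivity of the bonding maps lets a thread through v be continued level by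
  level.\<close>

lemma inverse_limit_point:
  assumes v: "v \<in> X 0"
  shows "\<exists>x\<in>inverse_limit X f. x 0 = v"
proof -
  have "\<exists>x. \<forall>n. (x n \<in> X n \<and> (n = 0 \<longrightarrow> x n = v)) \<and> f n (x (Suc n)) = x n"
  proof (rule dependent_nat_choice)
    show "\<exists>x. x \<in> X 0 \<and> (0 = 0 \<longrightarrow> x = v)" using v by blast
    show "\<exists>y. (y \<in> X (Suc n) \<and> (Suc n = 0 \<longrightarrow> y = v)) \<and> f n y = x"
      if "x \<in> X n \<and> (n = 0 \<longrightarrow> x = v)" for x n
    proof -
      have "x \<in> f n ` X (Suc n)" using that f(2) by simp
      then show ?thesis by auto
    qed
  qed
  then show ?thesis unfolding inverse_limit_def by auto
qed

text \<open>The sequences that satisfy the first n relations form a continuous image of the product,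
  hence a compact connected set; the inverse limit is the decreasing intersection of these
  sets.\<close>

lemma continuum_inverse_limit: "continuum (inverse_limit X f)"
proof -
  define U where "U n = pull_back f n ` Pi UNIV X" for n
  have P: "Pi UNIV X = PiE UNIV X" by (simp add: PiE_UNIV_domain)
  have "compactin (product_topology (\<lambda>_. euclidean) UNIV) (PiE UNIV X)"
    using X by (simp add: compactin_PiE continuum_def)
  then have cP: "compact (Pi UNIV X)" by (simp add: euclidean_product_topology P)
  have "connectedin (product_topology (\<lambda>_. euclidean) UNIV) (PiE UNIV X)"
    using X by (simp add: connectedin_PiE continuum_def)
  then have nP: "connected (Pi UNIV X)" by (simp add: euclidean_product_topology P)
  have cU: "compact (U n)" and nU: "connected (U n)" for n
    unfolding U_def using continuous_on_pull_back cP nP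
    by (auto intro: compact_continuous_image connected_continuous_image)
  have U: "U n = {x \<in> Pi UNIV X. \<forall>i<n. f i (x (Suc i)) = x i}" for n
  proof
    show "U n \<subseteq> {x \<in> Pi UNIV X. \<forall>i<n. f i (x (Suc i)) = x i}"
      unfolding U_def using pull_back_mem by (auto simp: pull_back_less[symmetric])
    show "{x \<in> Pi UNIV X. \<forall>i<n. f i (x (Suc i)) = x i} \<subseteq> U n"
    proof
      fix x assume "x \<in> {x \<in> Pi UNIV X. \<forall>i<n. f i (x (Suc i)) = x i}"
      then have "x \<in> Pi UNIV X" "pull_back f n x = x" by (auto intro: pull_back_fixed)
      then show "x \<in> U n" unfolding U_def by (metis image_eqI)
    qed
  qed
  have I: "inverse_limit X f = (\<Inter>n. U n)"
    unfolding U inverse_limit_def by (auto simp: Pi_iff)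
  have mono: "U (Suc n) \<subseteq> U n" for n unfolding U by auto
  have "closed (\<Inter>n. U n)" using cU by (intro closed_INT) (auto intro: compact_imp_closed)
  then have "compact (U 0 \<inter> (\<Inter>n. U n))" using cU by (intro compact_Int_closed) auto
  then have "compact (\<Inter>n. U n)" by (simp add: Int_absorb1 Inter_lower)
  moreover have "connected (\<Inter>n. U n)" using cU nU mono by (rule connected_decreasing_Inter)
  moreover have "inverse_limit X f \<noteq> {}"
  proof -
    have "X 0 \<noteq> {}" using X[of 0] by (simp add: continuum_def)
    then show ?thesis using inverse_limit_point by blast
  qed
  ultimately show ?thesis unfolding continuum_def I by blast
qed

end

text \<open>The overlap at every level keeps the unions connected. Properness is demanded at level
  0, from where it carries over to the inverse limits because their projections to level 0 are
  onto.\<close>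

definition decomposition_chain ::
    "(nat \<Rightarrow> real \<Rightarrow> real) \<Rightarrow> (nat \<Rightarrow> real set) \<Rightarrow> (nat \<Rightarrow> real set) \<Rightarrow> bool" where
  "decomposition_chain f A D \<longleftrightarrow>
     (\<forall>i. continuum (A i) \<and> continuum (D i) \<and> A i \<inter> D i \<noteq> {} \<and>
       f i ` A (Suc i) = A i \<and> f i ` D (Suc i) = D i) \<and>
     \<not> A 0 \<subseteq> D 0 \<and> \<not> D 0 \<subseteq> A 0"

text \<open>Membership at one level passes down to all lower levels. A thread in the unions is in A
  i infinitely often, hence always, or else in D i eventually, hence always; so the inverse limit of
  the unions is the union of the two inverse limits.\<close>

lemma not_hereditarily_indecomposable_inverse_limit:
  assumes chain: "decomposition_chain f A D"
    and f: "\<And>i. continuous_on UNIV (f i)"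
    and I: "\<And>i. A i \<union> D i \<subseteq> I i"
  shows "\<not> hereditarily_indecomposable (inverse_limit I f)"
proof -
  define K where "K i = A i \<union> D i" for i
  have A: "continuum (A i)" "f i ` A (Suc i) = A i" and D: "continuum (D i)" "f i ` D (Suc i) = D i"
    and AD: "A i \<inter> D i \<noteq> {}" for i
    using chain by (auto simp: decomposition_chain_def)
  have K1: "continuum (K i)" for i
    using A(1)[of i] D(1)[of i] AD[of i]
    unfolding K_def continuum_def by (simp add: compact_Un connected_Un)
  have K2: "f i ` K (Suc i) = K i" for i
    unfolding K_def image_Un A(2) D(2) ..
  note K = K1 K2
  have c: "continuous_on S (f i)" for S i using f by (rule continuous_on_subset) auto
  let ?A = "inverse_limit A f" and ?D = "inverse_limit D f" and ?K = "inverse_limit K f"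
  have cont: "continuum ?A" "continuum ?D" "continuum ?K"
    by (rule continuum_inverse_limit[OF _ c]; rule A D K)+
  have down: "x i \<in> Y i" if "\<forall>i. f i (x (Suc i)) = x i" "\<And>i. f i ` Y (Suc i) = Y i" "x m \<in> Y m" "i \<le> m"
    for x :: "nat \<Rightarrow> real" and Y i m
    using that(4,3)
  proof (induction rule: inc_induct)
    case (step n)
    then have "x (Suc n) \<in> Y (Suc n)" by blast
    then show ?case using that(1,2) by (metis imageI)
  qed simp
  have K_eq: "?K = ?A \<union> ?D"
  proof
    show "?A \<union> ?D \<subseteq> ?K" by (auto simp: inverse_limit_def K_def)
    show "?K \<subseteq> ?A \<union> ?D"
    proof
      fix x assume "x \<in> ?K"
      then have x: "\<forall>i. f i (x (Suc i)) = x i" "\<And>i. x i \<in> A i \<or> x i \<in> D i"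
        by (auto simp: inverse_limit_def K_def)
      show "x \<in> ?A \<union> ?D"
      proof (cases "\<forall>n. \<exists>m\<ge>n. x m \<in> A m")
        case True
        then have "x i \<in> A i" for i using down[OF x(1) A(2)] by blast
        then show ?thesis using x(1) by (simp add: inverse_limit_def)
      next
        case False
        then obtain n where "\<And>m. n \<le> m \<Longrightarrow> x m \<in> D m" using x(2) by blast
        then have "x i \<in> D i" for i using down[OF x(1) D(2), of "max n i" i] by simp
        then show ?thesis using x(1) by (simp add: inverse_limit_def)
      qed
    qed
  qed
  obtain u v where u: "u \<in> A 0" "u \<notin> D 0" and v: "v \<in> D 0" "v \<notin> A 0"
    using chain unfolding decomposition_chain_def by blast
  obtain x where x: "x \<in> ?A" "x 0 = u" using inverse_limit_point[of A f, OF A(1) c A(2) u(1)] by blast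
  obtain y where y: "y \<in> ?D" "y 0 = v" using inverse_limit_point[of D f, OF D(1) c D(2) v(1)] by blast
  have xD: "x \<notin> ?D" and yA: "y \<notin> ?A"
    using x(2) y(2) u(2) v(2) by (auto simp: inverse_limit_def)
  have "?A \<noteq> ?K" "?D \<noteq> ?K" using xD yA x(1) y(1) K_eq by blast+
  then have "decomposable ?K" unfolding decomposable_def using cont K_eq by blast
  moreover have "\<not> is_singleton ?K"
  proof
    assume "is_singleton ?K"
    then obtain w where "?K = {w}" by (rule is_singletonE)
    then have w: "z = w" if "z \<in> ?A \<or> z \<in> ?D" for z using that K_eq by auto
    have "x = y" using w[of x] w[of y] x(1) y(1) by simp
    then show False using xD y(1) by simp
  qed
  moreover have "?K \<subseteq> inverse_limit I f"
    using I unfolding inverse_limit_def K_def by blast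
  ultimately show ?thesis unfolding hereditarily_indecomposable_def using cont(3) by blast
qed

text \<open>\<open>iterated_image f i m\<close> applies the m + 1 maps f i, ..., f (i + m), which is
  why J is compared with level i + m + 1.\<close>

lemma subset_iterated_image:
  assumes "\<And>i. f i ` K (Suc i) = K i" and "K (Suc (i + m)) \<subseteq> J"
  shows "K i \<subseteq> iterated_image f i m J"
  using assms(2)
proof (induction m arbitrary: i)
  case 0
  then have "f i ` K (Suc i) \<subseteq> f i ` J" by (intro image_mono) simp
  then show ?case using assms(1)[of i] by simp
next
  case (Suc m)
  then have "K (Suc i) \<subseteq> iterated_image f (Suc i) m J" by simp
  then have "f i ` K (Suc i) \<subseteq> f i ` iterated_image f (Suc i) m J" by (intro image_mono)
  then show ?case using assms(1)[of i] by simp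
qed

lemma bounded_iterated_image:
  assumes f: "\<And>i. continuous_on UNIV (f i)" and J: "bounded J"
  shows "bounded (iterated_image f i m J)"
proof (induction m arbitrary: i)
  have b: "bounded (f i ` S)" if "bounded S" for i S
  proof -
    have "continuous_on (closure S) (f i)" using f by (rule continuous_on_subset) auto
    then have "compact (f i ` closure S)" using that by (intro compact_continuous_image) auto
    then show ?thesis
      by (rule bounded_subset[OF compact_imp_bounded]) (intro image_mono closure_subset)
  qed
  { case 0 then show ?case using b J by simp
  next
    case (Suc m) then show ?case using b by simp }
qed

text \<open>The endpoint sequences are eventually constant, so \<open>lim\<close> has its intended
  value; boundedness ensures that Inf and Sup enclose the image.\<close>

lemma subset_limit_interval:
  assumes f: "\<And>i. continuous_on UNIV (f i)" and J: "bounded J"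
    and conv: "\<forall>\<^sub>F m in sequentially. iterated_image f i m J = X"
    and K: "\<forall>\<^sub>F m in sequentially. K \<subseteq> iterated_image f i m J"
  shows "K \<subseteq> limit_interval f J i"
proof -
  obtain m where m: "iterated_image f i m J = X" "K \<subseteq> iterated_image f i m J"
    using eventually_happens'[OF sequentially_bot eventually_conj[OF conv K]] by blast
  then have X: "bounded X" "K \<subseteq> X" using bounded_iterated_image[OF f J] by auto
  have "(\<lambda>m. Inf (iterated_image f i m J)) \<longlonglongrightarrow> Inf X"
    by (rule tendsto_eventually) (use conv in eventually_elim, simp)
  moreover have "(\<lambda>m. Sup (iterated_image f i m J)) \<longlonglongrightarrow> Sup X"
    by (rule tendsto_eventually) (use conv in eventually_elim, simp)
  ultimately have "limit_interval f J i = {Inf X..Sup X}"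
    unfolding limit_interval_def by (simp add: limI)
  moreover have "X \<subseteq> {Inf X..Sup X}"
    using bounded_imp_bdd_above[OF X(1)] bounded_imp_bdd_below[OF X(1)]
    by (auto intro: cInf_lower cSup_upper)
  ultimately show ?thesis using X(2) by blast
qed

section \<open>From staircases to chains of intervals\<close>

text \<open>Supplies left endpoints: after its last hit of y the path does not go below y
  again.\<close>

lemma last_hit:
  fixes g :: "real \<Rightarrow> real"
  assumes c: "continuous_on {u..v} g" and uv: "u \<le> v" and y: "g u \<le> y" "y \<le> g v"
  shows "\<exists>t\<in>{u..v}. g t = y \<and> (\<forall>x\<in>{t..v}. y \<le> g x)"
proof -
  define A where "A = {t\<in>{u..v}. g t \<le> y}"
  have "closed A"
    unfolding A_def using continuous_on_closed_Collect_le[OF c continuous_on_const closed_atLeastAtMost] by simp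
  moreover have "A \<subseteq> {u..v}" by (auto simp: A_def)
  ultimately have "compact A" by (metis compact_Icc closed_Int_compact inf.absorb1)
  moreover have "u \<in> A" using uv y by (simp add: A_def)
  then have "A \<noteq> {}" by blast
  ultimately obtain t where t: "t \<in> A" "\<And>x. x \<in> A \<Longrightarrow> x \<le> t"
    using compact_attains_sup[of A] by blast
  have tuv: "u \<le> t" "t \<le> v" "g t \<le> y" using t(1) by (auto simp: A_def)
  have "continuous_on {t..v} g" using c by (rule continuous_on_subset) (use tuv in auto)
  from IVT'[OF tuv(3) y(2) tuv(2) this] obtain x where x: "t \<le> x" "x \<le> v" "g x = y" by blast
  then have "x \<in> A" using tuv by (auto simp: A_def)
  then have "x = t" using t(2) x(1) by fastforce
  then have gt: "g t = y" using x by simp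
  have "y \<le> g x" if "x \<in> {t..v}" for x
  proof (rule ccontr)
    assume "\<not> y \<le> g x"
    then have "x \<in> A" "x \<noteq> t" using that tuv gt by (auto simp: A_def)
    then show False using t(2)[of x] that by simp
  qed
  then show ?thesis using gt tuv by auto
qed

text \<open>Supplies right endpoints; reversing both time and sign reduces it to
  \<open>last_hit\<close>.\<close>

lemma first_hit:
  fixes g :: "real \<Rightarrow> real"
  assumes c: "continuous_on {u..v} g" and uv: "u \<le> v" and y: "g u \<le> y" "y \<le> g v"
  shows "\<exists>t\<in>{u..v}. g t = y \<and> (\<forall>x\<in>{u..t}. g x \<le> y)"
proof -
  have "continuous_on {- v..- u} (\<lambda>t. - g (- t))"
    by (intro continuous_intros continuous_on_compose2[OF c]) auto
  from last_hit[OF this, of "- y"] uv y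
  obtain t where t: "t \<in> {- v..- u}" "g (- t) = y" "\<And>x. x \<in> {t..- u} \<Longrightarrow> g (- x) \<le> y" by auto
  have "g x \<le> y" if "x \<in> {u..- t}" for x using t(3)[of "- x"] that by simp
  then show ?thesis using t(1,2) by (intro bexI[of _ "- t"]) auto
qed

lemma image_Icc_eq:
  fixes g :: "real \<Rightarrow> real"
  assumes "continuous_on {u..v} g" "u \<le> v" "\<And>x. x \<in> {u..v} \<Longrightarrow> g u \<le> g x \<and> g x \<le> g v"
  shows "g ` {u..v} = {g u..g v}"
proof
  show "g ` {u..v} \<subseteq> {g u..g v}" using assms(3) by auto
  show "{g u..g v} \<subseteq> g ` {u..v}"
  proof
    fix y assume "y \<in> {g u..g v}"
    then show "y \<in> g ` {u..v}" using IVT'[OF _ _ assms(2,1), of y] by auto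
  qed
qed

lemma ramp_simps: "0 \<le> ramp x" "ramp x \<le> 1" "1 \<le> x \<Longrightarrow> ramp x = 1" "x \<le> 0 \<Longrightarrow> ramp x = 0"
  by (auto simp: ramp_def)

text \<open>The start lies between z - 5/8 and z - 1/2 and the tube adds an error of 1/8, so after k
  steps of height 2 the plateau lies between z + 2k - 3/4 and z + 2k - 3/8. The plateaus therefore
  stay strictly outside the four unit windows.\<close>

lemma climbs_bounds:
  assumes "climbs g z s"
  shows "g s < z"
    and "\<And>x. x \<in> {s + 1..s + 7} \<Longrightarrow> z + 1 < g x"
    and "\<And>x. x \<in> {s + 3..s + 7} \<Longrightarrow> z + 3 < g x"
    and "\<And>x. x \<in> {s + 5..s + 7} \<Longrightarrow> z + 5 < g x"
    and "z + 7 < g (s + 7)"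
    and "\<And>x. x \<in> {s..s + 2} \<Longrightarrow> g x < z + 2"
    and "\<And>x. x \<in> {s..s + 4} \<Longrightarrow> g x < z + 4"
    and "\<And>x. x \<in> {s..s + 6} \<Longrightarrow> g x < z + 6"
proof -
  have s: "- 5 / 8 \<le> g s - z" "g s - z \<le> - 1 / 2" and
    tube: "\<forall>t\<in>{0..7}. \<bar>g (s + t) - g s - staircase t\<bar> \<le> 1 / 8"
    using assms unfolding climbs_def by blast+
  have t: "g x - g s - 2 * (ramp (x - s) + ramp (x - s - 2) + ramp (x - s - 4) + ramp (x - s - 6)) \<le> 1 / 8"
    "- 1 / 8 \<le> g x - g s - 2 * (ramp (x - s) + ramp (x - s - 2) + ramp (x - s - 4) + ramp (x - s - 6))"
    if "s \<le> x" "x \<le> s + 7" for x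
  proof -
    have "\<bar>g (s + (x - s)) - g s - staircase (x - s)\<bar> \<le> 1 / 8"
      by (rule bspec[OF tube]) (use that in simp)
    from abs_le_D1[OF this] abs_le_D2[OF this] show
      "g x - g s - 2 * (ramp (x - s) + ramp (x - s - 2) + ramp (x - s - 4) + ramp (x - s - 6)) \<le> 1 / 8"
      "- 1 / 8 \<le> g x - g s - 2 * (ramp (x - s) + ramp (x - s - 2) + ramp (x - s - 4) + ramp (x - s - 6))"
      unfolding staircase_def by simp_all
  qed
  note r = ramp_simps(1,2)
  show "g s < z" using s by simp
  show "z + 1 < g x" if "x \<in> {s + 1..s + 7}" for x
  proof -
    have "s \<le> x" "x \<le> s + 7" using that by auto
    note T = t[OF this]
    have "ramp (x - s) = 1" using that by (simp_all add: ramp_simps)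
    then show ?thesis using T s r(1)[of "x - s - 2"] r(1)[of "x - s - 4"] r(1)[of "x - s - 6"] by argo
  qed
  show "z + 3 < g x" if "x \<in> {s + 3..s + 7}" for x
  proof -
    have "s \<le> x" "x \<le> s + 7" using that by auto
    note T = t[OF this]
    have "ramp (x - s) = 1" "ramp (x - s - 2) = 1" using that by (simp_all add: ramp_simps)
    then show ?thesis using T s r(1)[of "x - s - 4"] r(1)[of "x - s - 6"] by argo
  qed
  show "z + 5 < g x" if "x \<in> {s + 5..s + 7}" for x
  proof -
    have "s \<le> x" "x \<le> s + 7" using that by auto
    note T = t[OF this]
    have "ramp (x - s) = 1" "ramp (x - s - 2) = 1" "ramp (x - s - 4) = 1" using that by (simp_all add: ramp_simps)
    then show ?thesis using T s r(1)[of "x - s - 6"] by argo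
  qed
  show "z + 7 < g (s + 7)"
    using t(2)[of "s + 7"] s by (simp add: ramp_simps)
  show "g x < z + 2" if "x \<in> {s..s + 2}" for x
  proof -
    have "s \<le> x" "x \<le> s + 7" using that by auto
    note T = t[OF this]
    have "ramp (x - s - 2) = 0" "ramp (x - s - 4) = 0" "ramp (x - s - 6) = 0" using that by (simp_all add: ramp_simps)
    then show ?thesis using T s r(2)[of "x - s"] by argo
  qed
  show "g x < z + 4" if "x \<in> {s..s + 4}" for x
  proof -
    have "s \<le> x" "x \<le> s + 7" using that by auto
    note T = t[OF this]
    have "ramp (x - s - 4) = 0" "ramp (x - s - 6) = 0" using that by (simp_all add: ramp_simps)
    then show ?thesis using T s r(2)[of "x - s"] r(2)[of "x - s - 2"] by argo
  qed
  show "g x < z + 6" if "x \<in> {s..s + 6}" for x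
  proof -
    have "s \<le> x" "x \<le> s + 7" using that by auto
    note T = t[OF this]
    have "ramp (x - s - 6) = 0" using that by (simp_all add: ramp_simps)
    then show ?thesis using T s r(2)[of "x - s"] r(2)[of "x - s - 2"] r(2)[of "x - s - 4"] by argo
  qed
qed

text \<open>The components are in increasing order; the two intervals are [a, d] and [c, b]. Only
  windows are prescribed, since the exact endpoints vary with the paths.\<close>

definition cell :: "real \<Rightarrow> real \<times> real \<times> real \<times> real \<Rightarrow> bool" where
  "cell z = (\<lambda>(a, c, d, b). a \<in> {z..z + 1} \<and> c \<in> {z + 2..z + 3} \<and> d \<in> {z + 4..z + 5} \<and> b \<in> {z + 6..z + 7})"

definition linked :: "(real \<Rightarrow> real) \<Rightarrow> real \<times> real \<times> real \<times> real \<Rightarrow> real \<times> real \<times> real \<times> real \<Rightarrow> bool" where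
  "linked g = (\<lambda>(a, c, d, b) (a', c', d', b'). g ` {a'..d'} = {a..d} \<and> g ` {c'..b'} = {c..b})"

text \<open>Left ends are last hits and right ends are first hits, each within its own crossing, so
  that between them the path leaves [a, d], respectively [c, b], neither below nor above. The new
  endpoints are times in the windows at s and hence form a cell again.\<close>

lemma climbs_linked:
  assumes cont: "continuous_on {s..s + 7} g" and cl: "climbs g z s" and Q: "cell z Q"
  shows "\<exists>Q'. cell s Q' \<and> linked g Q Q'"
proof -
  obtain a c d b where Q_eq: "Q = (a, c, d, b)" by (cases Q) auto
  have q: "a \<in> {z..z + 1}" "c \<in> {z + 2..z + 3}" "d \<in> {z + 4..z + 5}" "b \<in> {z + 6..z + 7}"
    using Q by (auto simp: Q_eq cell_def)
  note B = climbs_bounds[OF cl]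
  have sub: "continuous_on {u..v} g" if "s \<le> u" "v \<le> s + 7" for u v
    using cont by (rule continuous_on_subset) (use that in auto)
  have "g s \<le> a" "a \<le> g (s + 1)" using B(1) B(2)[of "s + 1"] q by auto
  from last_hit[OF sub _ this] obtain a' where a': "a' \<in> {s..s + 1}" "g a' = a"
    "\<And>x. x \<in> {a'..s + 1} \<Longrightarrow> a \<le> g x" by auto
  have "g (s + 2) \<le> c" "c \<le> g (s + 3)" using B(6)[of "s + 2"] B(3)[of "s + 3"] q by auto
  from last_hit[OF sub _ this] obtain c' where c': "c' \<in> {s + 2..s + 3}" "g c' = c"
    "\<And>x. x \<in> {c'..s + 3} \<Longrightarrow> c \<le> g x" by auto
  have "g (s + 4) \<le> d" "d \<le> g (s + 5)" using B(7)[of "s + 4"] B(4)[of "s + 5"] q by auto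
  from first_hit[OF sub _ this] obtain d' where d': "d' \<in> {s + 4..s + 5}" "g d' = d"
    "\<And>x. x \<in> {s + 4..d'} \<Longrightarrow> g x \<le> d" by auto
  have "g (s + 6) \<le> b" "b \<le> g (s + 7)" using B(8)[of "s + 6"] B(5) q by auto
  from first_hit[OF sub _ this] obtain b' where b': "b' \<in> {s + 6..s + 7}" "g b' = b"
    "\<And>x. x \<in> {s + 6..b'} \<Longrightarrow> g x \<le> b" by auto
  have lo_a: "a \<le> g x" if "x \<in> {a'..s + 7}" for x
    using that a'(3)[of x] B(2)[of x] q(1) by (cases "x \<le> s + 1") auto
  have lo_c: "c \<le> g x" if "x \<in> {c'..s + 7}" for x
    using that c'(3)[of x] B(3)[of x] q(2) by (cases "x \<le> s + 3") auto
  have hi_d: "g x \<le> d" if "x \<in> {s..d'}" for x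
    using that d'(3)[of x] B(7)[of x] q(3) by (cases "s + 4 \<le> x") auto
  have hi_b: "g x \<le> b" if "x \<in> {s..b'}" for x
    using that b'(3)[of x] B(8)[of x] q(4) by (cases "s + 6 \<le> x") auto
  have "g ` {a'..d'} = {g a'..g d'}"
    using a' d' lo_a hi_d by (intro image_Icc_eq sub) auto
  moreover have "g ` {c'..b'} = {g c'..g b'}"
    using c' b' lo_c hi_b by (intro image_Icc_eq sub) auto
  ultimately show ?thesis
    using a' b' c' d' by (intro exI[of _ "(a', c', d', b')"]) (auto simp: cell_def linked_def Q_eq)
qed

text \<open>Because l (i + 1) = (l i)^2, a time of the rescaled path at level i is a position at
  level i + 1 in the unit used there, and cells can be linked by dependent choice.\<close>

lemma decomposition_chain_of_climbs:
  fixes f :: "nat \<Rightarrow> real \<Rightarrow> real" and l s :: "nat \<Rightarrow> real"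
  assumes f: "\<And>i. continuous_on {0..} (f i)" and l: "\<And>i. 0 < l i" "\<And>i. l (Suc i) = (l i)\<^sup>2"
    and s: "\<And>i. 0 \<le> s i"
    and cl: "\<And>i. climbs (\<lambda>t. f i ((l i)\<^sup>2 * t) / l i) (s i) (s (Suc i))"
  shows "\<exists>A D. decomposition_chain f A D \<and> (\<forall>i. A i \<union> D i \<subseteq> {0..l i * (s i + 7)})"
proof -
  define g where "g i t = f i ((l i)\<^sup>2 * t) / l i" for i t
  have gc: "continuous_on {s (Suc i)..s (Suc i) + 7} (g i)" for i
    unfolding g_def using l(1)[of i] s[of "Suc i"]
    by (intro continuous_intros continuous_on_compose2[OF f]) (auto intro!: mult_nonneg_nonneg)
  have "\<exists>Q. \<forall>n. cell (s n) (Q n) \<and> linked (g n) (Q n) (Q (Suc n))"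
  proof (rule dependent_nat_choice)
    show "\<exists>Q. cell (s 0) Q"
      by (intro exI[of _ "(s 0, s 0 + 2, s 0 + 4, s 0 + 6)"]) (simp add: cell_def)
    show "\<exists>Q'. cell (s (Suc n)) Q' \<and> linked (g n) Q Q'" if "cell (s n) Q" for Q n
      using climbs_linked[OF gc cl[of n, folded g_def] that] .
  qed
  then obtain Q where Q: "\<And>n. cell (s n) (Q n)" "\<And>n. linked (g n) (Q n) (Q (Suc n))" by blast
  define a where "a n = fst (Q n)" for n
  define c where "c n = fst (snd (Q n))" for n
  define d where "d n = fst (snd (snd (Q n)))" for n
  define b where "b n = snd (snd (snd (Q n)))" for n
  have Qe: "Q n = (a n, c n, d n, b n)" for n by (simp add: a_def b_def c_def d_def)
  have q: "a n \<in> {s n..s n + 1}" "c n \<in> {s n + 2..s n + 3}" "d n \<in> {s n + 4..s n + 5}" "b n \<in> {s n + 6..s n + 7}" for n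
    using Q(1)[of n] unfolding Qe cell_def by auto
  have im: "g n ` {a (Suc n)..d (Suc n)} = {a n..d n}" "g n ` {c (Suc n)..b (Suc n)} = {c n..b n}" for n
    using Q(2)[of n] unfolding Qe linked_def by auto
  define A where "A n = {l n * a n..l n * d n}" for n
  define D where "D n = {l n * c n..l n * b n}" for n
  have scale: "(*) (l n) ` {u..v} = {l n * u..l n * v}" if "u \<le> v" for n u v
    using l(1)[of n] that by (simp add: image_mult_atLeastAtMost)
  have ff: "f n ` {l (Suc n) * u..l (Suc n) * v} = (*) (l n) ` g n ` {u..v}" if "u \<le> v" for n u v
  proof -
    have "f n (l (Suc n) * t) = l n * g n t" for t
      using l(1)[of n] by (simp add: g_def l(2))
    then show ?thesis unfolding scale[OF that, symmetric] image_image by simp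
  qed
  have "f n ` A (Suc n) = A n" "f n ` D (Suc n) = D n" for n
    using q[of "Suc n"] q[of n] by (simp_all add: A_def D_def ff im scale)
  moreover have "continuum (A n)" "continuum (D n)" "A n \<inter> D n \<noteq> {}" for n
  proof -
    have "a n \<le> c n" "c n \<le> d n" "d n \<le> b n" using q[of n] by auto
    then have "l n * a n \<le> l n * c n" "l n * c n \<le> l n * d n" "l n * d n \<le> l n * b n"
      using l(1)[of n] by simp_all
    then show "continuum (A n)" "continuum (D n)" "A n \<inter> D n \<noteq> {}"
      unfolding A_def D_def continuum_def by auto
  qed
  moreover have "\<not> A 0 \<subseteq> D 0" "\<not> D 0 \<subseteq> A 0"
    unfolding A_def D_def using q[of 0] l(1)[of 0] by (auto simp: mult_le_cancel_left)
  moreover have "A n \<union> D n \<subseteq> {0..l n * (s n + 7)}" for n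
  proof -
    have "0 \<le> l n * a n" "0 \<le> l n * c n" "l n * d n \<le> l n * (s n + 7)" "l n * b n \<le> l n * (s n + 7)"
      using q[of n] s[of n] l(1)[of n] by (auto intro!: mult_nonneg_nonneg)
    then show ?thesis unfolding A_def D_def by auto
  qed
  ultimately show ?thesis unfolding decomposition_chain_def by blast
qed

section \<open>Existence of an infinite chain of staircases\<close>

lemma (in prob_space) indep_sets_sigma_disjoint:
  assumes ind: "indep_sets E UNIV" and st: "\<And>i. Int_stable (E i)" and IJ: "I \<inter> J = {}"
    and a: "a \<in> sigma_sets (space M) (\<Union>i\<in>I. E i)" and b: "b \<in> sigma_sets (space M) (\<Union>i\<in>J. E i)"
  shows "prob (a \<inter> b) = prob a * prob b"
proof -
  define K where "K = case_bool I J"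
  have "indep_sets (\<lambda>j. sigma_sets (space M) (\<Union>i\<in>K j. E i)) UNIV"
  proof (rule indep_sets_collect_sigma)
    show "indep_sets E (\<Union>j\<in>UNIV. K j)" using ind by (rule indep_sets_mono_index[rotated]) simp
    show "disjoint_family_on K UNIV"
      using IJ by (auto simp: disjoint_family_on_def K_def split: bool.splits)
  qed (rule st)
  then have "indep_set (sigma_sets (space M) (\<Union>i\<in>I. E i)) (sigma_sets (space M) (\<Union>i\<in>J. E i))"
    unfolding indep_set_def by (rule indep_sets_mono_sets) (auto simp: K_def split: bool.split)
  from indep_setD[OF this a b] show ?thesis .
qed

text \<open>The exponent solves the recursion of \<open>radius_Suc\<close> forced by \<open>climb_rate\<close>.\<close>

definition radius :: "nat \<Rightarrow> real" where
  "radius x = (1 / 16) ^ (x\<^sup>2 + 2 * x + 4)"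

lemma radius_pos: "0 < radius x"
  by (simp add: radius_def)

lemma radius_Suc: "radius (Suc x) = 16 ^ (x\<^sup>2 + 1) * (radius x)\<^sup>2"
proof -
  have "(1 / 16 :: real) ^ (x\<^sup>2 + 1) * radius (Suc x) = (1 / 16) ^ (2 * (x\<^sup>2 + 2 * x + 4))"
    unfolding radius_def power_add[symmetric]
    by (rule arg_cong[where f="(^) (1 / 16)"]) (simp add: power2_eq_square)
  also have "\<dots> = (radius x)\<^sup>2"
    unfolding radius_def by (simp add: power_mult mult.commute flip: power_mult)
  finally have "16 ^ (x\<^sup>2 + 1) * (radius x)\<^sup>2 = (16 ^ (x\<^sup>2 + 1) * (1 / 16) ^ (x\<^sup>2 + 1)) * radius (Suc x)"
    by (simp only: mult.assoc)
  then show ?thesis by (simp flip: power_mult_distrib)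
qed

lemma radius_tendsto_0: "radius \<longlonglongrightarrow> 0"
proof -
  have "filterlim (\<lambda>x :: nat. x\<^sup>2 + 2 * x + 4) at_top sequentially"
    by (rule filterlim_at_top_mono[OF filterlim_ident]) (auto simp: power2_eq_square)
  moreover have "(\<lambda>n. (1 / 16 :: real) ^ n) \<longlonglongrightarrow> 0" by (rule LIMSEQ_power_zero) simp
  ultimately show ?thesis unfolding radius_def[abs_def] by (rule filterlim_compose[rotated])
qed

text \<open>Positions at level \<open>i\<close> are measured in units of \<open>l i\<close>; the time unit of the path at level \<open>i\<close> is \<open>(l i)\<^sup>2\<close>,
  the length unit of the next level.\<close>

definition climb_chain :: "(nat \<Rightarrow> real \<Rightarrow> real) \<Rightarrow> bool" where
  "climb_chain f \<longleftrightarrow> (\<exists>l s. (\<forall>i. 0 < l i \<and> l (Suc i) = (l i)\<^sup>2 \<and> 0 \<le> s i \<and>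
      climbs (\<lambda>t. f i ((l i)\<^sup>2 * t) / l i) (s i) (s (Suc i))) \<and>
    (\<lambda>i. l i * (s i + 7)) \<longlonglongrightarrow> 0)"

text \<open>A measurable choice among finitely many times. The default 0 keeps the position in a
  finite set of admissible targets even after a failure.\<close>

definition first_of :: "real set \<Rightarrow> real" where
  "first_of A = (if A = {} then 0 else Min A)"

lemma first_of_mem: "finite A \<Longrightarrow> A \<noteq> {} \<Longrightarrow> first_of A \<in> A"
  by (simp add: first_of_def)

text \<open>The position at level i is a function of the paths below i and has finitely many values.
  For each value, path i is independent of the event that it occurs and fails with the probability
  of a fixed target; the failures of all levels are then summed.\<close>

lemma climb_chain_prob:
  fixes M :: "'a measure" and X :: "nat \<Rightarrow> 'a \<Rightarrow> real \<Rightarrow> real"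
  assumes X: "\<And>i. brownian_motion M (X i)"
    and ind: "prob_space.indep_sets M (\<lambda>i. sets (generated M (\<lambda>t \<omega>. X i \<omega> t) {0..})) UNIV"
    and q: "0 < q" "q < 1"
    and scale: "climb_rate M q"
    and sm: "summable (\<lambda>n. 3 * real n * q ^ n)" and L: "1 \<le> L"
  shows "\<exists>E\<in>sets M. measure M E \<le> (\<Sum>i. 3 * real (i + L) * q ^ (i + L)) \<and>
    (\<forall>\<omega>\<in>space M - E. climb_chain (\<lambda>i. X i \<omega>))"
proof -
  interpret prob_space M by (rule brownian_motion_prob_space[OF X])
  define G where "G i = generated M (\<lambda>t \<omega>. X i \<omega> t) {0..}" for i
  have spG: "space (G i) = space M" for i by (simp add: G_def)
  have mG: "(\<lambda>\<omega>. X i \<omega> t) \<in> borel_measurable (G i)" if "0 \<le> t" for i t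
    unfolding G_def by (rule measurable_generated[where X="\<lambda>t \<omega>. X i \<omega> t"]) (use that in simp)
  have GM: "sets (G i) \<subseteq> events" for i
    unfolding G_def by (rule sets_generated_subset) (auto intro: brownian_motion_measurable[OF X])
  define l where "l = rec_nat (radius L) (\<lambda>_ x. x\<^sup>2)"
  have l0: "l 0 = radius L" and lS: "l (Suc i) = (l i)\<^sup>2" for i by (simp_all add: l_def)
  have lpos: "0 < l i" for i by (induction i) (simp_all add: l0 lS radius_pos)
  \<comment> \<open>Positions at level i stay within r i. The unit l i starts at the same value but
    is only squared, without the extra factor, so it does not exceed r i; the quotient \<rho> i is
    the distance in units of l i.\<close>
  define r where "r i = radius (i + L)" for i
  have rS: "16 ^ (i + L)\<^sup>2 * (r i)\<^sup>2 \<le> r (Suc i)" for i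
    by (simp add: r_def radius_Suc)
  have r2: "(r i)\<^sup>2 \<le> r (Suc i)" for i
  proof -
    have "1 * (r i)\<^sup>2 \<le> 16 ^ (i + L)\<^sup>2 * (r i)\<^sup>2" by (intro mult_right_mono one_le_power) auto
    then show ?thesis using rS[of i] by linarith
  qed
  have lr: "l i \<le> r i" for i
  proof (induction i)
    case 0 then show ?case by (simp add: l0 r_def)
  next
    case (Suc i)
    have "l (Suc i) \<le> (r i)\<^sup>2" unfolding lS using Suc lpos[of i] by (intro power_mono) auto
    then show ?case using r2[of i] by linarith
  qed
  define \<rho> where "\<rho> i = r i / l i" for i
  have \<rho>1: "1 \<le> \<rho> i" for i using lr[of i] lpos[of i] by (simp add: \<rho>_def)
  have \<rho>S: "16 ^ (i + L)\<^sup>2 * (\<rho> i)\<^sup>2 \<le> \<rho> (Suc i)" for i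
    using rS[of i] lpos[of i] by (simp add: \<rho>_def lS power_divide divide_right_mono)
  define V where "V i \<omega> t = X i \<omega> ((l i)\<^sup>2 * t) / l i" for i \<omega> t
  have V: "brownian_motion M (V i)" for i
    using brownian_motion_scale[OF X[of i] lpos[of i]] unfolding V_def by (simp add: fun_eq_iff[symmetric])
  define \<eta> where "\<eta> n = 3 * real n * q ^ n" for n
  define Q where "Q i S \<longleftrightarrow> finite S \<and> S \<subseteq> {0..16 ^ (i + L)\<^sup>2 * (\<rho> i)\<^sup>2} \<and> (\<forall>z. \<bar>z\<bar> \<le> \<rho> i \<longrightarrow>
        prob (no_climb M (V i) z S) \<le> \<eta> (i + L))" for i S
  have "\<exists>S. Q i S" for i
    unfolding \<eta>_def Q_def by (rule scale[unfolded climb_rate_def, rule_format, OF V _ \<rho>1]) (use L in simp)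
  then obtain S where "\<And>i. Q i (S i)" by metis
  then have S: "finite (S i)" "S i \<subseteq> {0..16 ^ (i + L)\<^sup>2 * (\<rho> i)\<^sup>2}"
    "\<bar>z\<bar> \<le> \<rho> i \<Longrightarrow> prob (no_climb M (V i) z (S i)) \<le> \<eta> (i + L)" for i z
    unfolding Q_def by blast+
  define N where "N i z \<omega> = first_of {s\<in>S i. climbs (V i \<omega>) z s}" for i z \<omega>
  define sq where "sq \<omega> = rec_nat 0 (\<lambda>i z. N i z \<omega>)" for \<omega>
  have sq0: "sq \<omega> 0 = 0" and sqS: "sq \<omega> (Suc i) = N i (sq \<omega> i) \<omega>" for \<omega> i
    by (simp_all add: sq_def)
  \<comment> \<open>Contains all possible positions at level i, among them the default 0 of
    \<open>first_of\<close>.\<close>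
  define R where "R i = (case i of 0 \<Rightarrow> {0} | Suc j \<Rightarrow> insert 0 (S j))" for i
  have R: "finite (R i)" for i using S(1) by (simp add: R_def split: nat.split)
  have N_mem: "N i z \<omega> \<in> insert 0 (S i)" for i z \<omega>
  proof (cases "{s\<in>S i. climbs (V i \<omega>) z s} = {}")
    case False
    then have "N i z \<omega> \<in> {s\<in>S i. climbs (V i \<omega>) z s}"
      unfolding N_def using S(1)[of i] by (intro first_of_mem) auto
    then show ?thesis by simp
  qed (simp add: N_def first_of_def)
  have sqR: "sq \<omega> i \<in> R i" for \<omega> i
    using N_mem by (cases i) (simp_all add: R_def sq0 sqS)
  have R_bd: "0 \<le> z" "z \<le> \<rho> i" if "z \<in> R i" for z i
  proof -
    have "0 \<le> z \<and> z \<le> \<rho> i"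
    proof (cases i)
      case 0 then show ?thesis using that \<rho>1[of 0] by (simp add: R_def)
    next
      case (Suc j)
      show ?thesis
      proof (cases "z = 0")
        case False
        then have "z \<in> S j" using that Suc by (simp add: R_def)
        then show ?thesis using S(2)[of j] \<rho>S[of j] Suc by fastforce
      qed (use \<rho>1[of i] in simp)
    qed
    then show "0 \<le> z" "z \<le> \<rho> i" by auto
  qed
  have climbs_G: "{\<omega>\<in>space M. climbs (V i \<omega>) z s} \<in> sets (G i)" if "s \<in> S i" for i z s
  proof (rule climbs_measurable[OF V _ spG])
    show s: "0 \<le> s" using S(2)[of i] that by auto
    show "(\<lambda>\<omega>. V i \<omega> t) \<in> borel_measurable (G i)" if "s \<le> t" for t
      unfolding V_def using s that by (intro borel_measurable_divide mG borel_measurable_const) auto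
  qed
  have no_climb_G: "no_climb M (V i) z (S i) \<in> sets (G i)" for i z
  proof -
    have "{\<omega>\<in>space (G i). \<forall>s\<in>S i. \<not> climbs (V i \<omega>) z s} \<in> sets (G i)"
      by (intro sets.sets_Collect_finite_All S(1) sets.sets_Collect_neg) (simp add: spG climbs_G)
    then show ?thesis by (simp add: spG)
  qed
  \<comment> \<open>The choice depends only on which of the finitely many times succeed, so its
    level sets are finite unions over the possible sets A of successful times.\<close>
  have N_G: "{\<omega>\<in>space M. N i z \<omega> = w} \<in> sets (G i)" for i z w
  proof -
    have "{\<omega>\<in>space M. N i z \<omega> = w} =
        (\<Union>A\<in>{A\<in>Pow (S i). first_of A = w}. {\<omega>\<in>space (G i). \<forall>s\<in>S i. climbs (V i \<omega>) z s \<longleftrightarrow> s \<in> A})"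
      (is "?L = ?R")
    proof
      show "?L \<subseteq> ?R"
      proof
        fix \<omega> assume "\<omega> \<in> ?L"
        then show "\<omega> \<in> ?R"
          by (intro UN_I[of "{s\<in>S i. climbs (V i \<omega>) z s}"]) (auto simp: N_def spG)
      qed
      show "?R \<subseteq> ?L"
      proof
        fix \<omega> assume "\<omega> \<in> ?R"
        then obtain A where A: "A \<subseteq> S i" "first_of A = w" "\<omega> \<in> space M" "\<forall>s\<in>S i. climbs (V i \<omega>) z s \<longleftrightarrow> s \<in> A"
          by (auto simp: spG)
        then have "{s\<in>S i. climbs (V i \<omega>) z s} = A" by blast
        then show "\<omega> \<in> ?L" using A by (simp add: N_def)
      qed
    qed
    also have "\<dots> \<in> sets (G i)"
    proof (intro sets.finite_UN)
      show "finite {A\<in>Pow (S i). first_of A = w}" using S(1) by simp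
      fix A
      have "{\<omega>\<in>space (G i). climbs (V i \<omega>) z s \<longleftrightarrow> s \<in> A} \<in> sets (G i)" if "s \<in> S i" for s
      proof (cases "s \<in> A")
        case True then show ?thesis using climbs_G[OF that] by (simp add: spG)
      next
        case False
        have "{\<omega>\<in>space (G i). \<not> climbs (V i \<omega>) z s} \<in> sets (G i)"
          by (rule sets.sets_Collect_neg) (simp add: spG climbs_G[OF that])
        then show ?thesis using False by simp
      qed
      then show "{\<omega>\<in>space (G i). \<forall>s\<in>S i. climbs (V i \<omega>) z s \<longleftrightarrow> s \<in> A} \<in> sets (G i)"
        by (intro sets.sets_Collect_finite_All S(1))
    qed
    finally show ?thesis .
  qed
  define H where "H i = sigma (space M) (\<Union>j\<in>{..<i}. sets (G j))" for i
  have Hsub: "(\<Union>j\<in>{..<i}. sets (G j)) \<subseteq> Pow (space M)" for i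
    using sets.sets_into_space[of _ "G _"] by (auto simp: spG)
  have spH: "space (H i) = space M" for i unfolding H_def by (rule space_measure_of[OF Hsub])
  have setsH: "sets (H i) = sigma_sets (space M) (\<Union>j\<in>{..<i}. sets (G j))" for i
    unfolding H_def by (rule sets_measure_of[OF Hsub])
  have GH: "A \<in> sets (H (Suc i))" if "A \<in> sets (G i)" for A i
    unfolding setsH using that by (intro sigma_sets.Basic) auto
  have HH: "A \<in> sets (H (Suc i))" if "A \<in> sets (H i)" for A i
  proof -
    have "(\<Union>j\<in>{..<i}. sets (G j)) \<subseteq> (\<Union>j\<in>{..<Suc i}. sets (G j))" by (intro UN_mono) auto
    from subsetD[OF sigma_sets_mono'[OF this]] that show ?thesis unfolding setsH .
  qed
  have HM: "sets (H i) \<subseteq> events" for i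
    unfolding setsH using GM by (intro sets.sigma_sets_subset) auto
  have sqH: "{\<omega>\<in>space M. sq \<omega> i = w} \<in> sets (H i)" for i w
  proof (induction i arbitrary: w)
    case 0
    show ?case using sets.top[of "H 0"] by (cases "w = 0") (simp_all add: sq0 spH)
  next
    case (Suc i)
    have "{\<omega>\<in>space M. sq \<omega> (Suc i) = w} =
        (\<Union>z\<in>R i. {\<omega>\<in>space M. sq \<omega> i = z} \<inter> {\<omega>\<in>space M. N i z \<omega> = w})"
      using sqR by (auto simp: sqS)
    also have "\<dots> \<in> sets (H (Suc i))"
      by (intro sets.finite_UN R sets.Int[OF HH[OF Suc] GH[OF N_G]])
    finally show ?case .
  qed
  have st: "Int_stable (sets (G i))" for i by (rule sets.Int_stable)
  have ind': "indep_sets (\<lambda>i. sets (G i)) UNIV" using ind by (simp add: G_def)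
  have prod: "prob (a \<inter> b) = prob a * prob b" if "a \<in> sets (H i)" "b \<in> sets (G i)" for a b i
    by (rule indep_sets_sigma_disjoint[OF ind' st, of "{..<i}" "{i}"])
      (use that setsH in \<open>auto intro: sigma_sets.Basic\<close>)
  define Bad where "Bad i = {\<omega>\<in>space M. \<forall>s\<in>S i. \<not> climbs (V i \<omega>) (sq \<omega> i) s}" for i
  define Z where "Z i z = {\<omega>\<in>space M. sq \<omega> i = z} \<inter> no_climb M (V i) z (S i)" for i z
  have Bad_eq: "Bad i = (\<Union>z\<in>R i. Z i z)" for i
    using sqR by (auto simp: Bad_def Z_def)
  have Ze: "Z i z \<in> events" for i z
    unfolding Z_def using subsetD[OF HM sqH] subsetD[OF GM no_climb_G] by (rule sets.Int)
  have Bade: "Bad i \<in> events" for i unfolding Bad_eq using R Ze by (intro sets.finite_UN) auto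
  have \<eta>0: "0 \<le> \<eta> n" for n using q by (simp add: \<eta>_def)
  have Badp: "prob (Bad i) \<le> \<eta> (i + L)" for i
  proof -
    have "prob (Bad i) \<le> (\<Sum>z\<in>R i. prob (Z i z))"
      unfolding Bad_eq using R Ze by (intro finite_measure_subadditive_finite) auto
    also have "\<dots> \<le> (\<Sum>z\<in>R i. prob {\<omega>\<in>space M. sq \<omega> i = z} * \<eta> (i + L))"
    proof (rule sum_mono)
      fix z assume z: "z \<in> R i"
      have "prob (Z i z) = prob {\<omega>\<in>space M. sq \<omega> i = z} * prob (no_climb M (V i) z (S i))"
        unfolding Z_def by (rule prod[OF sqH no_climb_G])
      also have "\<dots> \<le> prob {\<omega>\<in>space M. sq \<omega> i = z} * \<eta> (i + L)"
        using R_bd[OF z] by (intro mult_left_mono S(3)) auto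
      finally show "prob (Z i z) \<le> prob {\<omega>\<in>space M. sq \<omega> i = z} * \<eta> (i + L)" .
    qed
    also have "\<dots> = (\<Sum>z\<in>R i. prob {\<omega>\<in>space M. sq \<omega> i = z}) * \<eta> (i + L)"
      by (simp add: sum_distrib_right)
    also have "(\<Sum>z\<in>R i. prob {\<omega>\<in>space M. sq \<omega> i = z}) = prob (\<Union>z\<in>R i. {\<omega>\<in>space M. sq \<omega> i = z})"
      using R subsetD[OF HM sqH]
      by (intro finite_measure_finite_Union[symmetric]) (auto simp: disjoint_family_on_def)
    also have "\<dots> * \<eta> (i + L) \<le> 1 * \<eta> (i + L)" using \<eta>0 by (intro mult_right_mono) auto
    finally show ?thesis by simp
  qed
  have smL: "summable (\<lambda>i. \<eta> (i + L))"
    using sm unfolding \<eta>_def by (subst summable_iff_shift)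
  have smB: "summable (\<lambda>i. prob (Bad i))"
    by (rule summable_comparison_test'[OF smL, of 0]) (use Badp in simp)
  have "prob (\<Union>i. Bad i) \<le> (\<Sum>i. prob (Bad i))"
    using Bade smB by (intro finite_measure_subadditive_countably) auto
  also have "\<dots> \<le> (\<Sum>i. \<eta> (i + L))" by (rule suminf_le[OF Badp smB smL])
  finally have bound: "prob (\<Union>i. Bad i) \<le> (\<Sum>i. \<eta> (i + L))" .
  have chain: "climb_chain (\<lambda>i. X i \<omega>)" if w: "\<omega> \<in> space M - (\<Union>i. Bad i)" for \<omega>
  proof -
    have cl: "climbs (V i \<omega>) (sq \<omega> i) (sq \<omega> (Suc i))" for i
    proof -
      have "\<omega> \<notin> Bad i" using w by blast
      then have ne: "{s\<in>S i. climbs (V i \<omega>) (sq \<omega> i) s} \<noteq> {}" using w unfolding Bad_def by blast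
      have "sq \<omega> (Suc i) \<in> {s\<in>S i. climbs (V i \<omega>) (sq \<omega> i) s}"
        unfolding sqS N_def using S(1) ne by (intro first_of_mem) simp_all
      then show ?thesis by blast
    qed
    have lim: "(\<lambda>i. l i * (sq \<omega> i + 7)) \<longlonglongrightarrow> 0"
    proof (rule tendsto_sandwich)
      show "\<forall>\<^sub>F i in sequentially. 0 \<le> l i * (sq \<omega> i + 7)"
        using lpos R_bd(1)[OF sqR] by (intro always_eventually allI mult_nonneg_nonneg) (auto intro: less_imp_le add_nonneg_nonneg)
      \<comment> \<open>The constant is 8 = 1 + 7: the position contributes at most r i, and l i
        \<le> r i bounds the width of the cell.\<close>
      show "\<forall>\<^sub>F i in sequentially. l i * (sq \<omega> i + 7) \<le> 8 * radius (i + L)"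
      proof (intro always_eventually allI)
        fix i
        have "l i * sq \<omega> i \<le> l i * \<rho> i" using lpos[of i] R_bd(2)[OF sqR] by (intro mult_left_mono) auto
        also have "\<dots> = r i" using lpos[of i] by (simp add: \<rho>_def)
        finally show "l i * (sq \<omega> i + 7) \<le> 8 * radius (i + L)"
          using lr[of i] by (simp add: r_def distrib_left)
      qed
      show "(\<lambda>i. 8 * radius (i + L)) \<longlonglongrightarrow> 0"
        using tendsto_mult_left[OF LIMSEQ_ignore_initial_segment[OF radius_tendsto_0, of L], of 8] by simp
    qed simp
    show ?thesis
      unfolding climb_chain_def
      using lpos lS R_bd(1)[OF sqR] cl[unfolded V_def] lim
      by (intro exI[of _ l] exI[of _ "sq \<omega>"]) blast
  qed
  show ?thesis
    using Bade bound chain unfolding \<eta>_def by (intro bexI[of _ "\<Union>i. Bad i"]) auto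
qed

text \<open>Comparison with the derivative of the geometric series.\<close>

lemma summable_climb_bound:
  fixes q :: real
  assumes q: "0 < q" "q < 1"
  shows "summable (\<lambda>n. 3 * real n * q ^ n)"
proof -
  have "summable (\<lambda>n. 3 * (real (Suc n) * q ^ n))"
    using geometric_deriv_sums[of q] q by (intro summable_mult) (auto simp: sums_iff)
  then show ?thesis
    by (rule summable_comparison_test'[where N=0]) (use q in \<open>simp add: mult_right_mono\<close>)
qed

text \<open>\<open>climb_chain\<close> does not mention L, so it holds outside the intersection of
  the exceptional sets for all L, and the tail sums that bound them tend to 0.\<close>

lemma AE_climb_chain:
  fixes M :: "'a measure" and X :: "nat \<Rightarrow> 'a \<Rightarrow> real \<Rightarrow> real"
  assumes X: "\<And>i. brownian_motion M (X i)"
    and ind: "prob_space.indep_sets M (\<lambda>i. sets (generated M (\<lambda>t \<omega>. X i \<omega> t) {0..})) UNIV"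
  shows "AE \<omega> in M. climb_chain (\<lambda>i. X i \<omega>)"
proof -
  interpret prob_space M by (rule brownian_motion_prob_space[OF X])
  obtain q where q: "0 < q" "q < 1" and scale: "climb_rate M q"
    using climbs_multi_scale by blast
  define \<eta> where "\<eta> n = 3 * real n * q ^ n" for n
  have sm: "summable \<eta>" unfolding \<eta>_def by (rule summable_climb_bound[OF q])
  define Q where "Q L E \<longleftrightarrow> E \<in> events \<and> prob E \<le> (\<Sum>i. \<eta> (i + Suc L)) \<and>
    (\<forall>\<omega>\<in>space M - E. climb_chain (\<lambda>i. X i \<omega>))" for L E
  have "\<exists>E. Q L E" for L
    using climb_chain_prob[OF X ind q scale sm[unfolded \<eta>_def], of "Suc L"]
    unfolding \<eta>_def Q_def by auto
  then obtain E where "\<And>L. Q L (E L)" by metis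
  then have E: "\<And>L. E L \<in> events" "\<And>L. prob (E L) \<le> (\<Sum>i. \<eta> (i + Suc L))"
    "\<And>L \<omega>. \<omega> \<in> space M - E L \<Longrightarrow> climb_chain (\<lambda>i. X i \<omega>)"
    unfolding Q_def by blast+
  have null: "(\<Inter>L. E L) \<in> events" using E(1) by auto
  have "prob (\<Inter>L. E L) \<le> (\<Sum>i. \<eta> (i + Suc L))" for L
    using finite_measure_mono[of "\<Inter>L. E L" "E L"] E(1,2)[of L] by fastforce
  moreover have "(\<lambda>L. \<Sum>i. \<eta> (i + Suc L)) \<longlonglongrightarrow> 0"
    using LIMSEQ_Suc[OF suminf_exist_split2[OF sm]] .
  ultimately have "prob (\<Inter>L. E L) \<le> 0" by (intro LIMSEQ_le_const) auto
  then have "prob (\<Inter>L. E L) = 0" using measure_nonneg[of M] by (intro antisym) auto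
  then have "AE \<omega> in M. \<omega> \<notin> (\<Inter>L. E L)" using null by (simp add: prob_eq_0)
  then show ?thesis
  proof (rule AE_mp, intro AE_I2 impI)
    fix \<omega> assume "\<omega> \<in> space M" "\<omega> \<notin> (\<Inter>L. E L)"
    then show "climb_chain (\<lambda>i. X i \<omega>)" using E(3) by blast
  qed
qed

section \<open>Convergence of the iterated images\<close>

text \<open>A normalised form: paths vanish at 0 everywhere and not only almost surely, and the
  independence of the two halves is a product formula for events.\<close>

definition two_sided_paths :: "'a measure \<Rightarrow> ('a \<Rightarrow> real \<Rightarrow> real) \<Rightarrow> bool" where
  "two_sided_paths M B \<longleftrightarrow>
     brownian_motion M B \<and> brownian_motion M (\<lambda>\<omega> t. B \<omega> (- t)) \<and>
     (\<forall>\<omega>\<in>space M. continuous_on UNIV (B \<omega>)) \<and>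
     (\<forall>a\<in>sets (generated M (\<lambda>t \<omega>. B \<omega> t) {0..}). \<forall>b\<in>sets (generated M (\<lambda>t \<omega>. B \<omega> (- t)) {0..}).
       measure M (a \<inter> b) = measure M a * measure M b)"

text \<open>Negated non-strict bounds are used because the events they negate are measurable by
  \<open>sets_Collect_Ball_le\<close>.\<close>

definition swings :: "(real \<Rightarrow> real) \<Rightarrow> real \<Rightarrow> real \<Rightarrow> bool" where
  "swings f r' r \<longleftrightarrow> \<not> (\<forall>t\<in>{0..r'}. f t \<le> r) \<and> \<not> (\<forall>t\<in>{0..r'}. - f t \<le> r) \<and>
     \<not> (\<forall>t\<in>{0..r'}. f (- t) \<le> r) \<and> \<not> (\<forall>t\<in>{0..r'}. - f (- t) \<le> r)"

definition confined :: "(real \<Rightarrow> real) \<Rightarrow> real \<Rightarrow> real \<Rightarrow> bool" where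
  "confined f R' R \<longleftrightarrow> (\<forall>t\<in>{0..R'}. \<bar>f t\<bar> \<le> R) \<and> (\<forall>t\<in>{0..R'}. \<bar>f (- t)\<bar> \<le> R)"

text \<open>A path close to this function on \<open>[0, R]\<close> attains its maximum and its minimum within \<open>[0, r]\<close>.\<close>

definition spike :: "real \<Rightarrow> real \<Rightarrow> real" where
  "spike r t = (18 / r) * (t - 3 * max 0 (t - r / 3) + 3 * max 0 (t - 2 * r / 3) - max 0 (t - r))"

definition peaked :: "(real \<Rightarrow> real) \<Rightarrow> real \<Rightarrow> real \<Rightarrow> bool" where
  "peaked f r R \<longleftrightarrow> (\<forall>t\<in>{0..R}. \<bar>f t - spike r t\<bar> \<le> 1) \<and> (\<forall>t\<in>{0..R}. \<bar>f (- t)\<bar> \<le> 1)"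

lemma spike_lipschitz: "0 < r \<Longrightarrow> (144 / r)-lipschitz_on S (spike r)"
proof (rule lipschitz_onI)
  fix x y :: real assume r: "0 < r"
  define h where "h t = t - 3 * max 0 (t - r / 3) + 3 * max 0 (t - 2 * r / 3) - max 0 (t - r)" for t
  have m: "\<bar>max 0 (x - c) - max 0 (y - c)\<bar> \<le> \<bar>x - y\<bar>" for c by (auto simp: max_def abs_if)
  have "\<bar>h x - h y\<bar> \<le> 8 * \<bar>x - y\<bar>"
    unfolding h_def using m[of "r / 3"] m[of "2 * r / 3"] m[of r] by argo
  then have "(18 / r) * \<bar>h x - h y\<bar> \<le> (18 / r) * (8 * \<bar>x - y\<bar>)"
    using r by (intro mult_left_mono) auto
  moreover have "dist (spike r x) (spike r y) = (18 / r) * \<bar>h x - h y\<bar>"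
    unfolding spike_def h_def[symmetric] dist_real_def right_diff_distrib[symmetric] abs_mult using r by simp
  ultimately show "dist (spike r x) (spike r y) \<le> 144 / r * dist x y"
    by (simp add: dist_real_def)
qed simp

lemma spike_values:
  assumes r: "0 < r"
  shows "spike r 0 = 0" "spike r (r / 3) = 6" "spike r (2 * r / 3) = - 6" "r \<le> t \<Longrightarrow> spike r t = 0"
  using r by (auto simp: spike_def max_def field_simps)

text \<open>Left of 0 and beyond r the path has modulus at most 1, whereas between r / 3 and 2 * r /
  3 it runs from at least 5 to at most -5. All values taken outside [-r, r] are thus attained
  inside.\<close>

lemma image_peaked:
  assumes f: "continuous_on UNIV f" and pk: "peaked f r R" and r: "0 < r" "r \<le> R"
  shows "f ` {- R..R} = f ` {- r..r}"
proof
  show "f ` {- r..r} \<subseteq> f ` {- R..R}" using r by (intro image_mono) auto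
  have tube: "\<bar>f t - spike r t\<bar> \<le> 1" if "0 \<le> t" "t \<le> R" for t
    using pk that by (auto simp: peaked_def)
  have left: "\<bar>f t\<bar> \<le> 1" if "- R \<le> t" "t \<le> 0" for t
  proof -
    have "- t \<in> {0..R}" using that by simp
    then have "\<bar>f (- (- t))\<bar> \<le> 1" using pk unfolding peaked_def by blast
    then show ?thesis by simp
  qed
  have hi: "1 \<le> f (r / 3)" and lo: "f (2 * r / 3) \<le> - 1"
    using tube[of "r / 3"] tube[of "2 * r / 3"] r by (auto simp: spike_values[OF r(1)])
  have cv: "continuous_on S f" for S using f by (rule continuous_on_subset) auto
  show "f ` {- R..R} \<subseteq> f ` {- r..r}"
  proof
    fix y assume "y \<in> f ` {- R..R}"
    then obtain t where t: "- R \<le> t" "t \<le> R" "y = f t" by auto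
    show "y \<in> f ` {- r..r}"
    proof (cases "- r \<le> t \<and> t \<le> r")
      case True then show ?thesis using t by auto
    next
      case False
      have "\<bar>y\<bar> \<le> 1"
      proof (cases "t \<le> 0")
        case True then show ?thesis using left t by simp
      next
        case False
        then have "r \<le> t" using \<open>\<not> (- r \<le> t \<and> t \<le> r)\<close> r by auto
        then show ?thesis using tube[of t] t r spike_values(4)[OF r(1), of t] by simp
      qed
      then have "f (2 * r / 3) \<le> y" "y \<le> f (r / 3)" using hi lo by auto
      moreover have "r / 3 \<le> 2 * r / 3" using r by simp
      ultimately obtain x where "r / 3 \<le> x" "x \<le> 2 * r / 3" "f x = y"
        using IVT2'[OF _ _ _ cv] by blast
      then show ?thesis using r by (intro image_eqI[of _ _ x]) auto
    qed
  qed
qed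

text \<open>Swings on both sides of 0 are demanded because J may lie on one side only; its image is
  a full neighbourhood of 0 in either case.\<close>

lemma image_swings:
  assumes f: "continuous_on UNIV f" and sw: "swings f r' r" and J: "{0..r'} \<subseteq> J \<or> {- r'..0} \<subseteq> J"
  shows "{- r..r} \<subseteq> f ` J"
proof -
  have cn: "{- r..r} \<subseteq> f ` S" if S: "connected S" "x \<in> S" "y \<in> S" "r < f x" "f y < - r" for S x y
  proof -
    have "connected (f ` S)"
      using S(1) f by (intro connected_continuous_image) (auto intro: continuous_on_subset)
    then have "{f y..f x} \<subseteq> f ` S" using S by (intro connected_contains_Icc) auto
    then show ?thesis using S by force
  qed
  obtain t1 t2 t3 t4 where t: "t1 \<in> {0..r'}" "r < f t1" "t2 \<in> {0..r'}" "f t2 < - r"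
    "t3 \<in> {0..r'}" "r < f (- t3)" "t4 \<in> {0..r'}" "f (- t4) < - r"
    using sw unfolding swings_def by (auto simp: not_le)
  have "{- r..r} \<subseteq> f ` {0..r'}" using t by (intro cn[of _ t1 t2]) auto
  moreover have "{- r..r} \<subseteq> f ` {- r'..0}" using t by (intro cn[of _ "- t3" "- t4"]) auto
  ultimately show ?thesis using J by blast
qed

lemma image_confined: "confined f R' R \<Longrightarrow> J \<subseteq> {- R'..R'} \<Longrightarrow> f ` J \<subseteq> {- R..R}"
proof
  fix y assume c: "confined f R' R" and J: "J \<subseteq> {- R'..R'}" and "y \<in> f ` J"
  then obtain t where t: "t \<in> J" "y = f t" by blast
  have "\<bar>f t\<bar> \<le> R"
  proof (cases "0 \<le> t")
    case True then show ?thesis using c J t by (auto simp: confined_def)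
  next
    case False
    then have "- t \<in> {0..R'}" using J t by auto
    then have "\<bar>f (- (- t))\<bar> \<le> R" using c unfolding confined_def by blast
    then show ?thesis by simp
  qed
  then show "y \<in> {- R..R}" using t by auto
qed

text \<open>One map at offset k turns radius r (k + 1) into r k, so the innermost set is compared
  with the index k + n + 1. Only this innermost set may be one-sided.\<close>

lemma iterated_image_supset:
  assumes f: "\<And>i. continuous_on UNIV (f i)" and sw: "\<And>k. swings (f (m + k)) (r (Suc k)) (r k)"
    and r: "\<And>k. 0 \<le> r k" and J: "{0..r (Suc (k + n))} \<subseteq> J \<or> {- r (Suc (k + n))..0} \<subseteq> J"
  shows "{- r k..r k} \<subseteq> iterated_image f (m + k) n J"
  using J
proof (induction n arbitrary: k)
  case 0 then show ?case using image_swings[OF f sw] by simp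
next
  case (Suc n)
  have "{- r (Suc k)..r (Suc k)} \<subseteq> iterated_image f (m + Suc k) n J"
    by (rule Suc.IH) (use Suc.prems in simp)
  then have "{0..r (Suc k)} \<subseteq> iterated_image f (m + Suc k) n J" using r[of "Suc k"] by fastforce
  then show ?case using image_swings[OF f sw] by simp
qed

lemma iterated_image_subset:
  assumes cf: "\<And>k. confined (f (m + k)) (R (Suc k)) (R k)"
    and J: "J \<subseteq> {- R (Suc (k + n))..R (Suc (k + n))}"
  shows "iterated_image f (m + k) n J \<subseteq> {- R k..R k}"
  using J
proof (induction n arbitrary: k)
  case 0 then show ?case using image_confined[OF cf] by simp
next
  case (Suc n)
  have "iterated_image f (m + Suc k) n J \<subseteq> {- R (Suc k)..R (Suc k)}"
    by (rule Suc.IH) (use Suc.prems in simp)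
  then show ?case using image_confined[OF cf] by simp
qed

lemma iterated_image_eventually_constant_Suc:
  assumes "\<forall>\<^sub>F n in sequentially. iterated_image f (Suc i) n J = X"
  shows "\<forall>\<^sub>F n in sequentially. iterated_image f i n J = f i ` X"
proof -
  have "\<forall>\<^sub>F n in sequentially. iterated_image f i (Suc n) J = f i ` X"
    using assms by eventually_elim simp
  then show ?thesis
    by (rule eventually_sequentially_Suc[of "\<lambda>n. iterated_image f i n J = f i ` X", THEN iffD1])
qed

lemma interval_one_sided_neighbourhood:
  fixes J :: "real set"
  assumes J: "is_interval J" "0 \<in> J" "J \<noteq> {0}"
  shows "\<exists>e>0. {0..e} \<subseteq> J \<or> {- e..0} \<subseteq> J"
proof -
  obtain x where x: "x \<in> J" "x \<noteq> 0" using J(2,3) by blast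
  have ivl: "y \<in> J" if "u \<in> J" "v \<in> J" "u \<le> y" "y \<le> v" for u v y
    using J(1) that unfolding is_interval_1 by blast
  show ?thesis
  proof (cases "0 < x")
    case True
    have "{0..x} \<subseteq> J" using ivl[OF J(2) x(1)] by auto
    with True show ?thesis by blast
  next
    case False
    have "{- (- x)..0} \<subseteq> J" using ivl[OF x(1) J(2)] by auto
    with False x(2) show ?thesis by (intro exI[of _ "- x"]) auto
  qed
qed

text \<open>The squeeze between the radii r 0 and R 0 settles level m. Lower levels follow by
  downward induction, since they apply further maps to an eventually constant set.\<close>

lemma iterated_image_eventually_constant:
  assumes f: "\<And>i. continuous_on UNIV (f i)"
    and pk: "peaked (f m) (r 0) (R 0)"
    and sw: "\<And>k. swings (f (Suc m + k)) (r (Suc k)) (r k)"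
    and cf: "\<And>k. confined (f (Suc m + k)) (R (Suc k)) (R k)"
    and r: "\<And>k. 0 < r k" "r \<longlonglongrightarrow> 0" "r 0 \<le> R 0" and R: "filterlim R at_top sequentially"
    and J: "is_interval J" "bounded J" "0 \<in> J" "J \<noteq> {0}" and im: "i \<le> m"
  shows "\<exists>X. \<forall>\<^sub>F n in sequentially. iterated_image f i n J = X"
  using im
proof (induction rule: inc_induct)
  case base
  obtain e where e: "0 < e" "{0..e} \<subseteq> J \<or> {- e..0} \<subseteq> J"
    using interval_one_sided_neighbourhood[OF J(1,3,4)] by blast
  obtain b where b: "\<And>x. x \<in> J \<Longrightarrow> \<bar>x\<bar> \<le> b" using J(2) unfolding bounded_real by blast
  have "\<forall>\<^sub>F n in sequentially. r n < e" using r(2) e(1) by (rule order_tendstoD)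
  moreover have "\<forall>\<^sub>F n in sequentially. b \<le> R n" using R by (simp add: filterlim_at_top)
  ultimately have "\<forall>\<^sub>F n in sequentially. r n < e \<and> b \<le> R n" by (rule eventually_conj)
  \<comment> \<open>Above level m there are n + 1 maps, so J is compared with the radii of index n +
    1.\<close>
  then have "\<forall>\<^sub>F n in sequentially. r (Suc n) < e \<and> b \<le> R (Suc n)"
    by (rule eventually_sequentially_Suc[of "\<lambda>n. r n < e \<and> b \<le> R n", THEN iffD2])
  then have "\<forall>\<^sub>F n in sequentially. iterated_image f m (Suc n) J = f m ` {- R 0..R 0}"
  proof eventually_elim
    case (elim n)
    have "{0..r (Suc (0 + n))} \<subseteq> J \<or> {- r (Suc (0 + n))..0} \<subseteq> J"
      using e(2) elim by (auto simp: subset_iff)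
    from iterated_image_supset[OF f sw less_imp_le[OF r(1)] this]
    have 1: "{- r 0..r 0} \<subseteq> iterated_image f (Suc m) n J" by simp
    have "J \<subseteq> {- R (Suc (0 + n))..R (Suc (0 + n))}" using b elim by (fastforce simp: abs_le_iff)
    from iterated_image_subset[OF cf this]
    have 2: "iterated_image f (Suc m) n J \<subseteq> {- R 0..R 0}" by simp
    have "f m ` {- R 0..R 0} = f m ` {- r 0..r 0}" by (rule image_peaked[OF f pk r(1,3)])
    then show ?case using image_mono[OF 1, of "f m"] image_mono[OF 2, of "f m"] by auto
  qed
  then have "\<forall>\<^sub>F n in sequentially. iterated_image f m n J = f m ` {- R 0..R 0}"
    by (rule eventually_sequentially_Suc[of "\<lambda>n. iterated_image f m n J = f m ` {- R 0..R 0}", THEN iffD1])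
  then show ?case by blast
next
  case (step n)
  then show ?case using iterated_image_eventually_constant_Suc by blast
qed

text \<open>In units of \<open>radius x\<close>, a climb with z = 2 starts at or above 2 - 5/8 > 1,
  so a path that stays below this radius makes no such climb. The candidate times reach up to 4 * 16
  ^ x^2 time units, which the factor 16 ^ (x^2 + 1) in \<open>radius_Suc\<close> covers.\<close>

lemma stays_below_prob:
  fixes M :: "'a measure"
  assumes W: "brownian_motion M W" and x: "1 \<le> x"
    and scale: "climb_rate M q"
  shows "measure M {\<omega>\<in>space M. \<forall>t\<in>{0..radius (Suc x)}. W \<omega> t \<le> radius x} \<le> 3 * real x * q ^ x"
proof -
  interpret prob_space M by (rule brownian_motion_prob_space[OF W])
  define d where "d = radius x"
  have d: "0 < d" by (simp add: d_def radius_pos)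
  define V where "V \<omega> t = W \<omega> (d\<^sup>2 * t) / d" for \<omega> t
  have V: "brownian_motion M V"
    using brownian_motion_scale[OF W d] unfolding V_def .
  obtain S where S: "finite S" "S \<subseteq> {0..16 ^ x\<^sup>2 * 2\<^sup>2}"
    "\<And>z. \<bar>z\<bar> \<le> 2 \<Longrightarrow> prob (no_climb M V z S) \<le> 3 * real x * q ^ x"
    using scale[unfolded climb_rate_def, rule_format, OF V x, of 2] by auto
  have "prob {\<omega>\<in>space M. \<forall>t\<in>{0..radius (Suc x)}. W \<omega> t \<le> d} \<le> prob (no_climb M V 2 S)"
  proof (rule finite_measure_mono)
    show "no_climb M V 2 S \<in> events"
      using S(2) by (intro no_climb_measurable[OF V S(1)] brownian_motion_measurable[OF V]) auto
    have "\<not> climbs (V \<omega>) 2 s" if s: "s \<in> S" and w: "\<forall>t\<in>{0..radius (Suc x)}. W \<omega> t \<le> d" for s \<omega>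
    proof
      assume "climbs (V \<omega>) 2 s"
      then have "1 < V \<omega> s" by (simp add: climbs_def)
      then have "d < W \<omega> (d\<^sup>2 * s)" using d by (simp add: V_def less_divide_eq)
      moreover have "d\<^sup>2 * s \<in> {0..radius (Suc x)}"
      proof -
        have "0 \<le> s" "s \<le> 16 ^ x\<^sup>2 * 4" using S(2) s by auto
        then have "d\<^sup>2 * s \<le> d\<^sup>2 * (16 ^ x\<^sup>2 * 16)" by (intro mult_left_mono) auto
        then show ?thesis using \<open>0 \<le> s\<close> by (simp add: radius_Suc d_def algebra_simps)
      qed
      ultimately show False using w by force
    qed
    then show "{\<omega>\<in>space M. \<forall>t\<in>{0..radius (Suc x)}. W \<omega> t \<le> d} \<subseteq> no_climb M V 2 S"
      by blast
  qed
  also have "\<dots> \<le> 3 * real x * q ^ x" by (rule S(3)) simp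
  finally show ?thesis by (simp add: d_def)
qed

section \<open>Measurability and probability of swinging, confined and peaked paths\<close>

definition path_sets :: "'a measure \<Rightarrow> ('a \<Rightarrow> real \<Rightarrow> real) \<Rightarrow> 'a measure" where
  "path_sets M B = generated M (\<lambda>t \<omega>. B \<omega> t) UNIV"

lemma space_path_sets: "space (path_sets M B) = space M"
  by (simp add: path_sets_def)

lemma path_sets_measurable: "(\<lambda>\<omega>. B \<omega> t) \<in> borel_measurable (path_sets M B)"
  unfolding path_sets_def by (rule measurable_generated[where X="\<lambda>t \<omega>. B \<omega> t"]) simp

context
  fixes M :: "'a measure" and B :: "'a \<Rightarrow> real \<Rightarrow> real"
  assumes B: "two_sided_paths M B"
begin

lemma paths_right: "brownian_motion M B"
  and paths_left: "brownian_motion M (\<lambda>\<omega> t. B \<omega> (- t))"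
  and paths_continuous: "\<omega> \<in> space M \<Longrightarrow> continuous_on S (B \<omega>)"
  using B by (auto simp: two_sided_paths_def intro: continuous_on_subset)

lemma paths_continuous_uminus: "\<omega> \<in> space M \<Longrightarrow> continuous_on S (\<lambda>t. B \<omega> (- t))"
  by (rule continuous_on_compose2[OF paths_continuous[of _ UNIV]]) (auto intro: continuous_intros)

lemma path_measurable: "(\<lambda>\<omega>. B \<omega> t) \<in> borel_measurable M"
  using brownian_motion_measurable[OF paths_right, of t] brownian_motion_measurable[OF paths_left, of "- t"]
  by (cases "0 \<le> t") auto

lemma path_sets_subset: "sets (path_sets M B) \<subseteq> sets M"
  unfolding path_sets_def by (rule sets_generated_subset) (auto intro: path_measurable)

lemma path_sets_Ball:
  fixes X :: "real \<Rightarrow> 'a \<Rightarrow> real"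
  assumes m: "\<And>t. X t \<in> borel_measurable (path_sets M B)"
    and c: "\<And>\<omega>. \<omega> \<in> space M \<Longrightarrow> continuous_on {0..T} (\<lambda>t. X t \<omega>)"
  shows "{\<omega>\<in>space M. \<forall>t\<in>{0..T}. X t \<omega> \<le> e} \<in> sets (path_sets M B)"
  using sets_Collect_Ball_le[of "{0..T}" X "path_sets M B" e] m c by (simp add: space_path_sets)

lemma below_measurable:
  "{\<omega>\<in>space M. \<forall>t\<in>{0..T}. B \<omega> t \<le> e} \<in> sets (path_sets M B)"
  "{\<omega>\<in>space M. \<forall>t\<in>{0..T}. - B \<omega> t \<le> e} \<in> sets (path_sets M B)"
  "{\<omega>\<in>space M. \<forall>t\<in>{0..T}. B \<omega> (- t) \<le> e} \<in> sets (path_sets M B)"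
  "{\<omega>\<in>space M. \<forall>t\<in>{0..T}. - B \<omega> (- t) \<le> e} \<in> sets (path_sets M B)"
  "{\<omega>\<in>space M. \<forall>t\<in>{0..T}. \<bar>B \<omega> t\<bar> \<le> e} \<in> sets (path_sets M B)"
  "{\<omega>\<in>space M. \<forall>t\<in>{0..T}. \<bar>B \<omega> (- t)\<bar> \<le> e} \<in> sets (path_sets M B)"
  by (intro path_sets_Ball borel_measurable_uminus borel_measurable_abs path_sets_measurable
      continuous_on_minus continuous_on_rabs paths_continuous paths_continuous_uminus; assumption)+

lemma swings_measurable: "{\<omega>\<in>space M. swings (B \<omega>) r' r} \<in> sets (path_sets M B)"
proof -
  have "{\<omega>\<in>space M. swings (B \<omega>) r' r} =
    (space M - {\<omega>\<in>space M. \<forall>t\<in>{0..r'}. B \<omega> t \<le> r}) \<inter> (space M - {\<omega>\<in>space M. \<forall>t\<in>{0..r'}. - B \<omega> t \<le> r}) \<inter>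
    (space M - {\<omega>\<in>space M. \<forall>t\<in>{0..r'}. B \<omega> (- t) \<le> r}) \<inter> (space M - {\<omega>\<in>space M. \<forall>t\<in>{0..r'}. - B \<omega> (- t) \<le> r})"
    unfolding swings_def by blast
  also have "\<dots> \<in> sets (path_sets M B)"
    by (intro sets.Int sets.compl_sets[of _ "path_sets M B", unfolded space_path_sets] below_measurable)
  finally show ?thesis .
qed

lemma confined_measurable: "{\<omega>\<in>space M. confined (B \<omega>) R' R} \<in> sets (path_sets M B)"
proof -
  have "{\<omega>\<in>space M. confined (B \<omega>) R' R} =
    {\<omega>\<in>space M. \<forall>t\<in>{0..R'}. \<bar>B \<omega> t\<bar> \<le> R} \<inter> {\<omega>\<in>space M. \<forall>t\<in>{0..R'}. \<bar>B \<omega> (- t)\<bar> \<le> R}"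
    unfolding confined_def by blast
  then show ?thesis using below_measurable(5,6) by (simp add: sets.Int)
qed

lemma swings_prob:
  assumes x: "1 \<le> x"
    and scale: "climb_rate M q"
  shows "measure M (space M - {\<omega>\<in>space M. swings (B \<omega>) (radius (Suc x)) (radius x)}) \<le> 4 * (3 * real x * q ^ x)"
proof -
  interpret prob_space M by (rule brownian_motion_prob_space[OF paths_right])
  let ?A = "{\<omega>\<in>space M. \<forall>t\<in>{0..radius (Suc x)}. B \<omega> t \<le> radius x}"
  let ?B = "{\<omega>\<in>space M. \<forall>t\<in>{0..radius (Suc x)}. - B \<omega> t \<le> radius x}"
  let ?C = "{\<omega>\<in>space M. \<forall>t\<in>{0..radius (Suc x)}. B \<omega> (- t) \<le> radius x}"
  let ?D = "{\<omega>\<in>space M. \<forall>t\<in>{0..radius (Suc x)}. - B \<omega> (- t) \<le> radius x}"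
  note s = stays_below_prob[OF _ x scale]
  have p: "prob ?A \<le> 3 * real x * q ^ x" "prob ?B \<le> 3 * real x * q ^ x"
    "prob ?C \<le> 3 * real x * q ^ x" "prob ?D \<le> 3 * real x * q ^ x"
    by (rule s[OF paths_right] s[OF brownian_motion_uminus[OF paths_right]] s[OF paths_left]
        s[OF brownian_motion_uminus[OF paths_left]]; assumption)+
  note ev = subsetD[OF path_sets_subset below_measurable(1)] subsetD[OF path_sets_subset below_measurable(2)]
    subsetD[OF path_sets_subset below_measurable(3)] subsetD[OF path_sets_subset below_measurable(4)]
  have "prob (space M - {\<omega>\<in>space M. swings (B \<omega>) (radius (Suc x)) (radius x)}) \<le> prob (?A \<union> ?B \<union> (?C \<union> ?D))"
  proof (rule finite_measure_mono)
    show "space M - {\<omega>\<in>space M. swings (B \<omega>) (radius (Suc x)) (radius x)} \<subseteq> ?A \<union> ?B \<union> (?C \<union> ?D)"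
      unfolding swings_def by blast
  qed (intro sets.Un ev)
  also have "\<dots> \<le> (prob ?A + prob ?B) + (prob ?C + prob ?D)"
    by (intro order.trans[OF measure_Un_le] add_mono measure_Un_le sets.Un ev)
  finally show ?thesis using p by simp
qed

lemma confined_prob:
  assumes T: "0 \<le> T" and a: "0 < a"
  shows "measure M (space M - {\<omega>\<in>space M. confined (B \<omega>) T (2 * a)}) \<le> 4 * T / a\<^sup>2"
proof -
  interpret prob_space M by (rule brownian_motion_prob_space[OF paths_right])
  let ?A = "{\<omega>\<in>space M. \<forall>t\<in>{0..T}. \<bar>B \<omega> t\<bar> \<le> 2 * a}"
  let ?B = "{\<omega>\<in>space M. \<forall>t\<in>{0..T}. \<bar>B \<omega> (- t)\<bar> \<le> 2 * a}"
  have ev: "?A \<in> events" "?B \<in> events"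
    using path_sets_subset below_measurable(5,6) by blast+
  have "prob (space M - {\<omega>\<in>space M. confined (B \<omega>) T (2 * a)}) \<le> prob ((space M - ?A) \<union> (space M - ?B))"
  proof (rule finite_measure_mono)
    show "space M - {\<omega>\<in>space M. confined (B \<omega>) T (2 * a)} \<subseteq> (space M - ?A) \<union> (space M - ?B)"
      unfolding confined_def by blast
  qed (intro sets.Un sets.compl_sets ev)
  also have "\<dots> \<le> prob (space M - ?A) + prob (space M - ?B)"
    using ev by (intro measure_Un_le sets.compl_sets)
  also have "\<dots> \<le> 2 * T / a\<^sup>2 + 2 * T / a\<^sup>2"
    using brownian_motion_maximal[OF paths_right T a] brownian_motion_maximal[OF paths_left T a]
    unfolding prob_compl[OF ev(1)] prob_compl[OF ev(2)] by (intro add_mono) auto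
  finally show ?thesis by simp
qed

lemma peaked_right: "tube M B R (spike r) 1 \<in> sets (generated M (\<lambda>t \<omega>. B \<omega> t) {0..})"
  if "0 < r"
proof -
  have "{\<omega>\<in>space (generated M (\<lambda>t \<omega>. B \<omega> t) {0..}). \<forall>t\<in>{0..R}. \<bar>B \<omega> t - spike r t\<bar> \<le> 1}
      \<in> sets (generated M (\<lambda>t \<omega>. B \<omega> t) {0..})"
    using lipschitz_on_continuous_on[OF spike_lipschitz[OF that]]
    by (intro sets_Collect_tube measurable_generated[where X="\<lambda>t \<omega>. B \<omega> t"]) (auto intro: paths_continuous)
  then show ?thesis by simp
qed

lemma peaked_left: "{\<omega>\<in>space M. \<forall>t\<in>{0..R}. \<bar>B \<omega> (- t)\<bar> \<le> 1} \<in> sets (generated M (\<lambda>t \<omega>. B \<omega> (- t)) {0..})"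
proof -
  have "{\<omega>\<in>space (generated M (\<lambda>t \<omega>. B \<omega> (- t)) {0..}). \<forall>t\<in>{0..R}. \<bar>B \<omega> (- t) - 0\<bar> \<le> 1}
      \<in> sets (generated M (\<lambda>t \<omega>. B \<omega> (- t)) {0..})"
    by (intro sets_Collect_tube measurable_generated[where X="\<lambda>t \<omega>. B \<omega> (- t)"])
      (auto intro: paths_continuous_uminus)
  then show ?thesis by simp
qed

lemma peaked_eq: "{\<omega>\<in>space M. peaked (B \<omega>) r R} =
  tube M B R (spike r) 1 \<inter> {\<omega>\<in>space M. \<forall>t\<in>{0..R}. \<bar>B \<omega> (- t)\<bar> \<le> 1}"
  unfolding peaked_def by blast

lemma peaked_measurable: "0 < r \<Longrightarrow> {\<omega>\<in>space M. peaked (B \<omega>) r R} \<in> sets (path_sets M B)"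
proof -
  assume r: "0 < r"
  have "sets (generated M (\<lambda>t \<omega>. B \<omega> t) {0..}) \<subseteq> sets (path_sets M B)"
    by (rule sets_generated_subset) (auto simp: space_path_sets path_sets_measurable)
  then show ?thesis
    unfolding peaked_eq using peaked_right[OF r, of R] below_measurable(6)[of R 1] by (intro sets.Int) auto
qed

lemma peaked_prob_eq:
  "0 < r \<Longrightarrow> measure M {\<omega>\<in>space M. peaked (B \<omega>) r R} =
    measure M (tube M B R (spike r) 1) *
    measure M {\<omega>\<in>space M. \<forall>t\<in>{0..R}. \<bar>B \<omega> (- t)\<bar> \<le> 1}"
proof -
  assume r: "0 < r"
  have ind: "\<forall>a\<in>sets (generated M (\<lambda>t \<omega>. B \<omega> t) {0..}). \<forall>b\<in>sets (generated M (\<lambda>t \<omega>. B \<omega> (- t)) {0..}).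
      measure M (a \<inter> b) = measure M a * measure M b"
    using B unfolding two_sided_paths_def by (elim conjE)
  show ?thesis
    unfolding peaked_eq by (rule bspec[OF bspec[OF ind peaked_right[OF r]] peaked_left])
qed

end

text \<open>The support theorem is applied to the spike on the right and to the zero function on the
  left, and the halves are independent. The bound is the same for all processes, hence for all
  levels.\<close>

lemma peaked_prob:
  assumes r: "0 < r" and R: "0 < R"
  shows "\<exists>p>0. \<forall>(M :: 'a measure) B. two_sided_paths M B \<longrightarrow> p \<le> measure M {\<omega>\<in>space M. peaked (B \<omega>) r R}"
proof -
  obtain p1 where p1: "0 < p1" "\<And>(M :: 'a measure) W. brownian_motion M W \<Longrightarrow>
      p1 \<le> measure M (tube M W R (spike r) 1)"
    using brownian_motion_support[OF R zero_less_one spike_lipschitz[OF r] spike_values(1)[OF r]] by blast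
  have "1-lipschitz_on {0..R} (\<lambda>_ :: real. 0 :: real)" by (rule lipschitz_onI) auto
  then obtain p2 where p2: "0 < p2" "\<And>(M :: 'a measure) W. brownian_motion M W \<Longrightarrow>
      p2 \<le> measure M {\<omega>\<in>space M. \<forall>t\<in>{0..R}. \<bar>W \<omega> t - 0\<bar> \<le> 1}"
    using brownian_motion_support[OF R zero_less_one, of 1 "\<lambda>_. 0"] by blast
  have "p1 * p2 \<le> measure M {\<omega>\<in>space M. peaked (B \<omega>) r R}"
    if B: "two_sided_paths M B" for M :: "'a measure" and B
    unfolding peaked_prob_eq[OF B r]
    using p1(1) p1(2)[OF paths_right[OF B]] p2(1) p2(2)[OF paths_left[OF B]] by (intro mult_mono) auto
  then show ?thesis using p1(1) p2(1) by (intro exI[of _ "p1 * p2"]) auto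
qed

text \<open>The events \<open>G m\<close> for different levels involve the same later paths and are
  not claimed to be independent. Their limit superior is a tail event of positive probability, which
  is enough for the zero-one law.\<close>

lemma AE_iterated_image_eventually_constant:
  fixes M :: "'a measure" and B :: "nat \<Rightarrow> 'a \<Rightarrow> real \<Rightarrow> real"
  assumes B: "\<And>i. two_sided_paths M (B i)"
    and ind: "prob_space.indep_sets M (\<lambda>i. sets (path_sets M (B i))) UNIV"
    and J: "is_interval J" "bounded J" "0 \<in> J" "J \<noteq> {0}"
  shows "AE \<omega> in M. \<forall>i. \<exists>X. \<forall>\<^sub>F n in sequentially. iterated_image (\<lambda>i. B i \<omega>) i n J = X"
proof -
  interpret prob_space M by (rule brownian_motion_prob_space[OF paths_right[OF B]])
  obtain q where q: "0 < q" "q < 1" and scale: "climb_rate M q"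
    using climbs_multi_scale by blast
  define \<eta> where "\<eta> n = 4 * (3 * real n * q ^ n)" for n
  have \<eta>0: "0 \<le> \<eta> n" for n using q by (simp add: \<eta>_def)
  have sm: "summable \<eta>" unfolding \<eta>_def by (intro summable_mult summable_climb_bound q)
  have "(\<lambda>L. \<Sum>i. \<eta> (i + Suc L)) \<longlonglongrightarrow> 0"
    using LIMSEQ_Suc[OF suminf_exist_split2[OF sm]] .
  then have "\<forall>\<^sub>F L in sequentially. (\<Sum>i. \<eta> (i + Suc L)) < 1 / 4"
    by (rule order_tendstoD) simp
  \<comment> \<open>The swings may fail with total probability 1/4; another 1/4 is left for
    confinement.\<close>
  then obtain L where L: "(\<Sum>i. \<eta> (i + Suc L)) < 1 / 4" by (auto simp: eventually_sequentially)
  define r where "r k = radius (k + Suc L)" for k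
  \<comment> \<open>With a = 128 * 2 ^ k, which is half of R k, confinement fails with probability
    at most 4 * R (k + 1) / a^2 = (1 / 8) * (1 / 2) ^ k, and these bounds sum to 1/4.\<close>
  define R :: "nat \<Rightarrow> real" where "R k = 256 * 2 ^ k" for k
  have r: "0 < r k" "r \<longlonglongrightarrow> 0" "r 0 \<le> R 0" for k
    using LIMSEQ_ignore_initial_segment[OF radius_tendsto_0, of "Suc L"]
    by (simp_all add: r_def[abs_def] r_def radius_pos R_def)
      (simp add: radius_def power_le_one order.trans[of _ 1])
  have Rlim: "filterlim R at_top sequentially"
    unfolding R_def by real_asymp
  define Good where "Good k i = {\<omega>\<in>space M. swings (B i \<omega>) (r (Suc k)) (r k)} \<inter>
    {\<omega>\<in>space M. confined (B i \<omega>) (R (Suc k)) (R k)}" for k i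
  have Good_sets: "Good k i \<in> sets (path_sets M (B i))" for k i
    unfolding Good_def by (intro sets.Int swings_measurable confined_measurable B)
  have sub: "sets (path_sets M (B i)) \<subseteq> events" for i by (rule path_sets_subset[OF B])
  have Good_e: "Good k i \<in> events" for k i by (rule subsetD[OF sub Good_sets])
  define \<beta> where "\<beta> k = \<eta> (k + Suc L) + (1 / 8) * (1 / 2) ^ k" for k
  have Good_prob: "prob (space M - Good k i) \<le> \<beta> k" for k i
  proof -
    let ?A = "{\<omega>\<in>space M. swings (B i \<omega>) (r (Suc k)) (r k)}"
    let ?C = "{\<omega>\<in>space M. confined (B i \<omega>) (R (Suc k)) (R k)}"
    have ev: "?A \<in> events" "?C \<in> events"
      by (rule subsetD[OF sub swings_measurable[OF B]] subsetD[OF sub confined_measurable[OF B]])+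
    have "prob (space M - Good k i) \<le> prob (space M - ?A) + prob (space M - ?C)"
      unfolding Good_def Diff_Int by (intro measure_Un_le sets.compl_sets ev)
    also have "prob (space M - ?A) \<le> \<eta> (k + Suc L)"
      using swings_prob[OF B _ scale, where x="k + Suc L"] by (simp add: r_def \<eta>_def)
    also have "prob (space M - ?C) \<le> 4 * R (Suc k) / (128 * 2 ^ k)\<^sup>2"
      using confined_prob[OF B, of "R (Suc k)" "128 * 2 ^ k"] by (simp add: R_def)
    also have "4 * R (Suc k) / (128 * 2 ^ k)\<^sup>2 = (1 / 8) * (1 / 2) ^ k"
      by (simp add: R_def power2_eq_square power_one_over)
    finally show ?thesis by (simp add: \<beta>_def)
  qed
  have smL: "summable (\<lambda>k. \<eta> (k + Suc L))" using sm by (subst summable_iff_shift)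
  have geo: "(\<lambda>k. (1 / 8) * (1 / 2 :: real) ^ k) sums (1 / 4)"
    using sums_mult[OF geometric_sums[of "1 / 2 :: real"], of "1 / 8"] by simp
  have sm\<beta>: "summable \<beta>" unfolding \<beta>_def using smL sums_summable[OF geo] by (rule summable_add)
  have sum\<beta>: "(\<Sum>k. \<beta> k) \<le> 1 / 2"
    unfolding \<beta>_def using suminf_add[OF smL sums_summable[OF geo]] L sums_unique[OF geo] by simp
  define H where "H m = (\<Inter>k. Good k (m + k))" for m
  have H_prob: "1 / 2 \<le> prob (H m)" for m
  proof -
    have He: "H m \<in> events" unfolding H_def using Good_e by auto
    have smp: "summable (\<lambda>k. prob (space M - Good k (m + k)))"
      by (rule summable_comparison_test'[OF sm\<beta>, of 0]) (use Good_prob in simp)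
    have "prob (space M - H m) = prob (\<Union>k. space M - Good k (m + k))"
      unfolding H_def by (rule arg_cong[where f=prob]) auto
    also have "\<dots> \<le> (\<Sum>k. prob (space M - Good k (m + k)))"
      using Good_e smp by (intro finite_measure_subadditive_countably) auto
    also have "\<dots> \<le> (\<Sum>k. \<beta> k)" by (rule suminf_le[OF Good_prob smp sm\<beta>])
    finally show ?thesis using sum\<beta> prob_compl[OF He] by simp
  qed
  define P where "P m = {\<omega>\<in>space M. peaked (B m \<omega>) (r 0) (R 0)}" for m
  have P_sets: "P m \<in> sets (path_sets M (B m))" for m
    unfolding P_def by (rule peaked_measurable[OF B r(1)])
  obtain p where p: "0 < p" "\<And>m. p \<le> prob (P m)"
    using peaked_prob[OF r(1), of "R 0" 0] B unfolding P_def by (auto simp: R_def)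
  define T where "T m = sigma_sets (space M) (\<Union>i\<in>{m..}. sets (path_sets M (B i)))" for m
  have T_space: "(\<Union>i\<in>{m..}. sets (path_sets M (B i))) \<subseteq> Pow (space M)" for m
    using sets.sets_into_space[of _ "path_sets M (B _)"] by (auto simp: space_path_sets)
  interpret T: sigma_algebra "space M" "T m" for m
    unfolding T_def by (rule sigma_algebra_sigma_sets[OF T_space])
  have T_Basic: "a \<in> T m" if "a \<in> sets (path_sets M (B i))" "m \<le> i" for a i m
    unfolding T_def using that by (intro sigma_sets.Basic) auto
  have H_T: "H m \<in> T m'" if "m' \<le> m" for m m'
    unfolding H_def using that by (intro T.countable_INT) (auto intro!: T_Basic[OF Good_sets])
  define G where "G m = P m \<inter> H (Suc m)" for m
  have G_T: "G m \<in> T m'" if "m' \<le> m" for m m'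
    unfolding G_def using that by (intro T.Int T_Basic[OF P_sets] H_T) auto
  have st: "Int_stable (sets (path_sets M (B i)))" for i by (rule sets.Int_stable)
  have T_e: "T m \<subseteq> events" for m
    unfolding T_def using sub by (intro sets.sigma_sets_subset) auto
  have G_e: "G m \<in> events" for m by (rule subsetD[OF T_e G_T[OF order_refl]])
  have G_prob: "p / 2 \<le> prob (G m)" for m
  proof -
    \<comment> \<open>\<open>P m\<close> concerns path m alone and \<open>H (Suc m)\<close> the
      later paths, so the two are independent.\<close>
    have "prob (G m) = prob (P m) * prob (H (Suc m))"
      unfolding G_def
      by (rule indep_sets_sigma_disjoint[OF ind st, of "{m}" "{Suc m..}"])
        (use P_sets H_T[of "Suc m" "Suc m"] in \<open>auto simp: T_def intro: sigma_sets.Basic\<close>)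
    then show ?thesis using mult_mono[OF p(2) H_prob, of m "Suc m"] by simp
  qed
  define U where "U n = (\<Union>j. G (n + j))" for n
  define V where "V = (\<Inter>n. U n)"
  have U_e: "U n \<in> events" for n unfolding U_def using G_e by auto
  have U_dec: "decseq U"
  proof (rule decseq_SucI)
    have "G (Suc n + j) \<subseteq> U n" for n j
      unfolding U_def using UN_upper[of "Suc j" UNIV "\<lambda>j. G (n + j)"] by simp
    then show "U (Suc n) \<subseteq> U n" for n unfolding U_def[of "Suc n"] by (rule UN_least)
  qed
  have U_T: "U k \<in> T n" if "n \<le> k" for k n
    unfolding U_def using that by (intro T.countable_UN image_subsetI G_T) simp
  have V_tail: "V \<in> tail_events (\<lambda>i. sets (path_sets M (B i)))"
    unfolding tail_events_def
  proof
    fix n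
    have "V = (\<Inter>k. U (n + k))"
    proof
      show "V \<subseteq> (\<Inter>k. U (n + k))" unfolding V_def by blast
      have "U (n + k) \<subseteq> U k" for k using decseqD[OF U_dec, of k "n + k"] by simp
      then show "(\<Inter>k. U (n + k)) \<subseteq> V" unfolding V_def by blast
    qed
    also have "\<dots> \<in> T n"
      by (intro T.countable_INT image_subsetI U_T) simp_all
    finally show "V \<in> sigma_sets (space M) (\<Union> ((\<lambda>i. sets (path_sets M (B i))) ` {n..}))"
      by (simp add: T_def)
  qed
  have sa: "sigma_algebra (space M) (sets (path_sets M (B i)))" for i
    using sets.sigma_algebra_axioms[of "path_sets M (B i)"] by (simp add: space_path_sets)
  have "(\<lambda>n. prob (U n)) \<longlonglongrightarrow> prob V"
    unfolding V_def using U_e U_dec by (intro finite_Lim_measure_decseq) auto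
  moreover have "p / 2 \<le> prob (U n)" for n
  proof -
    have "G (n + 0) \<subseteq> U n" unfolding U_def by (rule UN_upper) simp
    then show ?thesis using G_prob[of n] finite_measure_mono[OF _ U_e, of "G n" n] by simp
  qed
  ultimately have "p / 2 \<le> prob V" by (intro LIMSEQ_le_const) auto
  then have "prob V = 1" using kolmogorov_0_1_law[OF sa ind V_tail] p(1) by auto
  moreover have "V \<in> events" unfolding V_def using U_e by auto
  ultimately have "AE \<omega> in M. \<omega> \<in> V" by (simp add: prob_eq_1)
  then show ?thesis
  proof (rule AE_mp, intro AE_I2 impI allI)
    fix \<omega> i assume w: "\<omega> \<in> space M" "\<omega> \<in> V"
    then have "\<omega> \<in> U i" by (simp add: V_def)
    then obtain j where "\<omega> \<in> G (i + j)" by (auto simp: U_def)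
    then obtain m where m: "i \<le> m" "\<omega> \<in> P m" "\<omega> \<in> H (Suc m)"
      unfolding G_def by (intro that[of "i + j"]) auto
    have Gd: "\<omega> \<in> Good k (Suc m + k)" for k using m(3) by (simp add: H_def)
    have cont: "continuous_on UNIV (B i \<omega>)" for i by (rule paths_continuous[OF B w(1)])
    show "\<exists>X. \<forall>\<^sub>F n in sequentially. iterated_image (\<lambda>i. B i \<omega>) i n J = X"
    proof (rule iterated_image_eventually_constant[where r=r and R=R, OF _ _ _ _ r Rlim J m(1)])
      show "peaked (B m \<omega>) (r 0) (R 0)" using m(2) by (simp add: P_def)
      show "swings (B (Suc m + k) \<omega>) (r (Suc k)) (r k)" "confined (B (Suc m + k) \<omega>) (R (Suc k)) (R k)" for k
        using Gd[of k] by (auto simp: Good_def)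
    qed (rule cont)
  qed
qed

section \<open>Decomposability of the limit\<close>

text \<open>Subtracting the value at 0 makes the paths vanish there everywhere and leaves all
  increments unchanged.\<close>

lemma brownian_motion_normalize:
  assumes M: "prob_space M" and W: "std_brownian_motion M W"
  shows "brownian_motion M (\<lambda>\<omega> t. W \<omega> t - W \<omega> 0)"
  using assms unfolding brownian_motion_def std_brownian_motion_def
  by (auto intro!: continuous_on_diff borel_measurable_diff)

text \<open>Transfers independence from random elements of the path space to
  \<open>generated\<close>: each normalised coordinate is a measurable function of Z, so the events
  it generates are preimages under Z.\<close>

lemma sets_generated_vimage:
  fixes Z :: "'a \<Rightarrow> real \<Rightarrow> real" and T :: "real set"
  assumes Z: "Z \<in> measurable M (Pi\<^sub>M T (\<lambda>_. borel))" and T: "0 \<in> T"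
    and X: "\<And>\<omega> t. t \<in> T \<Longrightarrow> X t \<omega> = Z \<omega> t - Z \<omega> 0"
  shows "sets (generated M X T) \<subseteq> {Z -` A \<inter> space M | A. A \<in> sets (Pi\<^sub>M T (\<lambda>_. borel))}"
proof -
  define N where "N = vimage_algebra (space M) Z (Pi\<^sub>M T (\<lambda>_. borel :: real measure))"
  have Zs: "Z \<in> space M \<rightarrow> space (Pi\<^sub>M T (\<lambda>_. borel :: real measure))"
    using measurable_space[OF Z] by auto
  have Z': "Z \<in> measurable N (Pi\<^sub>M T (\<lambda>_. borel))"
    unfolding N_def by (rule measurable_vimage_algebra1[OF Zs])
  have c: "(\<lambda>\<omega>. Z \<omega> t) \<in> borel_measurable N" if "t \<in> T" for t
    using measurable_compose[OF Z' measurable_component_singleton[OF that]] .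
  have "sets (generated M X T) \<subseteq> sets N"
  proof (rule sets_generated_subset)
    show "space N = space M" by (simp add: N_def)
    show "X t \<in> borel_measurable N" if "t \<in> T" for t
    proof -
      have "X t = (\<lambda>\<omega>. Z \<omega> t - Z \<omega> 0)" using X[OF that] by auto
      then show ?thesis using c[OF that] c[OF T] by simp
    qed
  qed
  then show ?thesis unfolding N_def sets_vimage_algebra2[OF Zs] .
qed

lemma two_sided_paths_normalize:
  assumes M: "prob_space M" and B: "two_sided_brownian_motion M B"
  shows "two_sided_paths M (\<lambda>\<omega> t. B \<omega> t - B \<omega> 0)"
proof -
  interpret prob_space M by (rule M)
  let ?P = "Pi\<^sub>M {0..} (\<lambda>_ :: real. borel :: real measure)"
  define R where "R \<omega> = (\<lambda>t\<in>{0..}. B \<omega> t)" for \<omega>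
  define L where "L \<omega> = (\<lambda>t\<in>{0..}. B \<omega> (- t))" for \<omega>
  have B': "\<forall>\<omega>\<in>space M. continuous_on UNIV (B \<omega>)" "std_brownian_motion M B"
    "std_brownian_motion M (\<lambda>\<omega> t. B \<omega> (- t))" "indep_var ?P R ?P L"
    using B unfolding two_sided_brownian_motion_def R_def L_def by auto
  have m: "R \<in> measurable M ?P" "L \<in> measurable M ?P"
    using indep_var_rv1[OF B'(4)] indep_var_rv2[OF B'(4)] by auto
  have "prob (a \<inter> b) = prob a * prob b"
    if ab: "a \<in> sets (generated M (\<lambda>t \<omega>. B \<omega> t - B \<omega> 0) {0..})"
      "b \<in> sets (generated M (\<lambda>t \<omega>. B \<omega> (- t) - B \<omega> 0) {0..})" for a b
  proof -
    have "sets (generated M (\<lambda>t \<omega>. B \<omega> t - B \<omega> 0) {0..}) \<subseteq> {R -` A \<inter> space M | A. A \<in> sets ?P}"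
      by (rule sets_generated_vimage[OF m(1)]) (auto simp: R_def)
    then obtain A where A: "a = R -` A \<inter> space M" "A \<in> sets ?P" using ab(1) by blast
    have "sets (generated M (\<lambda>t \<omega>. B \<omega> (- t) - B \<omega> 0) {0..}) \<subseteq> {L -` A \<inter> space M | A. A \<in> sets ?P}"
      by (rule sets_generated_vimage[OF m(2)]) (auto simp: L_def)
    then obtain A' where A': "b = L -` A' \<inter> space M" "A' \<in> sets ?P" using ab(2) by blast
    have "a \<inter> b = (\<lambda>\<omega>. (R \<omega>, L \<omega>)) -` (A \<times> A') \<inter> space M" unfolding A(1) A'(1) by blast
    then show ?thesis
      using indep_varD[OF B'(4) A(2) A'(2)] unfolding A(1) A'(1) by simp
  qed
  then show ?thesis
    unfolding two_sided_paths_def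
    using brownian_motion_normalize[OF M B'(2)] brownian_motion_normalize[OF M B'(3)] B'(1)
    by (auto intro!: continuous_on_diff)
qed

lemma indep_path_sets_normalize:
  fixes B :: "nat \<Rightarrow> 'a \<Rightarrow> real \<Rightarrow> real"
  assumes M: "prob_space M" and B: "prob_space.indep_vars M (\<lambda>_. \<Pi>\<^sub>M t\<in>UNIV. borel) B UNIV"
  shows "prob_space.indep_sets M (\<lambda>i. sets (path_sets M (\<lambda>\<omega> t. B i \<omega> t - B i \<omega> 0))) UNIV"
proof -
  interpret prob_space M by (rule M)
  have rv: "B i \<in> measurable M (\<Pi>\<^sub>M t\<in>UNIV. borel)" for i
    using B unfolding indep_vars_def2 by auto
  have "indep_sets (\<lambda>i. {B i -` A \<inter> space M | A. A \<in> sets (\<Pi>\<^sub>M t\<in>UNIV. borel)}) UNIV"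
    using B unfolding indep_vars_def2 by auto
  then show ?thesis
  proof (rule indep_sets_mono_sets)
    show "sets (path_sets M (\<lambda>\<omega> t. B i \<omega> t - B i \<omega> 0)) \<subseteq> {B i -` A \<inter> space M | A. A \<in> sets (\<Pi>\<^sub>M t\<in>UNIV. borel)}" for i
      unfolding path_sets_def by (rule sets_generated_vimage[OF rv]) auto
  qed
qed

lemma not_hereditarily_indecomposable_limit:
  assumes f: "\<And>i. continuous_on UNIV (f i)" and J: "bounded J"
    and conv: "\<And>i. \<exists>X. \<forall>\<^sub>F n in sequentially. iterated_image f i n J = X"
    and chain: "decomposition_chain f A D" and small: "\<forall>\<^sub>F n in sequentially. A n \<union> D n \<subseteq> J"
  shows "\<not> hereditarily_indecomposable (inverse_limit (limit_interval f J) f)"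
proof (rule not_hereditarily_indecomposable_inverse_limit[OF chain f])
  fix i
  define K where "K n = A n \<union> D n" for n
  have K: "f i ` K (Suc i) = K i" for i
    using chain unfolding decomposition_chain_def K_def image_Un by simp
  obtain n where n: "\<And>m. n \<le> m \<Longrightarrow> K m \<subseteq> J"
    using small unfolding eventually_sequentially K_def by blast
  have "K i \<subseteq> iterated_image f i m J" if "n \<le> m" for m
    using that by (intro subset_iterated_image[of f K, OF K] n) simp
  then have ev: "\<forall>\<^sub>F m in sequentially. K i \<subseteq> iterated_image f i m J"
    unfolding eventually_sequentially by blast
  obtain X where "\<forall>\<^sub>F n in sequentially. iterated_image f i n J = X" using conv by blast
  from subset_limit_interval[OF f J this ev]
  show "A i \<union> D i \<subseteq> limit_interval f J i" by (simp add: K_def)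
qed

text \<open>Reflection at 0, for an interval J that covers a left neighbourhood of 0.\<close>

lemma decomposition_chain_uminus:
  assumes "decomposition_chain (\<lambda>i t. - f i (- t)) A D"
  shows "decomposition_chain f (\<lambda>i. uminus ` A i) (\<lambda>i. uminus ` D i)"
proof -
  have im: "f i ` uminus ` S = uminus ` (\<lambda>t. - f i (- t)) ` S" for i S
    by (simp add: image_image)
  have c: "continuum (uminus ` S)" if "continuum S" for S :: "real set"
    using that unfolding continuum_def
    by (auto intro!: compact_continuous_image connected_continuous_image continuous_intros)
  have inj: "uminus ` S \<subseteq> uminus ` S' \<longleftrightarrow> S \<subseteq> S'" for S S' :: "real set"
    by (rule inj_image_subset_iff) simp
  have int: "uminus ` S \<inter> uminus ` S' \<noteq> {}" if "S \<inter> S' \<noteq> {}" for S S' :: "real set"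
    using that by blast
  show ?thesis
    using assms unfolding decomposition_chain_def im inj by (auto intro: c dest!: int)
qed

lemma climb_chain_decomposition:
  assumes f: "\<And>i. continuous_on {0..} (f i)" and cl: "climb_chain f" and e: "0 < e"
  shows "\<exists>A D. decomposition_chain f A D \<and> (\<forall>\<^sub>F n in sequentially. A n \<union> D n \<subseteq> {0..e})"
proof -
  obtain l s where ls: "\<And>i. 0 < l i" "\<And>i. l (Suc i) = (l i)\<^sup>2" "\<And>i. 0 \<le> s i"
    "\<And>i. climbs (\<lambda>t. f i ((l i)\<^sup>2 * t) / l i) (s i) (s (Suc i))"
    "(\<lambda>i. l i * (s i + 7)) \<longlonglongrightarrow> 0"
    using cl unfolding climb_chain_def by blast
  obtain A D where AD: "decomposition_chain f A D" "\<And>i. A i \<union> D i \<subseteq> {0..l i * (s i + 7)}"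
    using decomposition_chain_of_climbs[of f l s, OF f ls(1-4)] by blast
  have "\<forall>\<^sub>F i in sequentially. l i * (s i + 7) < e" using ls(5) e by (rule order_tendstoD)
  then have "\<forall>\<^sub>F n in sequentially. A n \<union> D n \<subseteq> {0..e}"
  proof eventually_elim
    case (elim n)
    then show ?case using AD(2)[of n] by fastforce
  qed
  then show ?thesis using AD(1) by blast
qed

theorem theorem1:
  fixes M :: "'a measure"
    and B :: "nat \<Rightarrow> 'a \<Rightarrow> real \<Rightarrow> real"
    and J :: "real set"
  assumes "prob_space M"
    and "iid_two_sided_brownian_motions M B"
    and "is_interval J" and "bounded J" and "0 \<in> J" and "J \<noteq> {0}"
  shows "AE \<omega> in M.
    (let f = (\<lambda>i. B i \<omega>); C = inverse_limit (limit_interval f J) f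
     in \<not> hereditarily_indecomposable C \<and> \<not> is_pseudo_arc C)"
proof -
  interpret prob_space M by fact
  define B' where "B' i \<omega> t = B i \<omega> t - B i \<omega> 0" for i \<omega> t
  have B: "two_sided_brownian_motion M (B i)" for i
    using assms(2) by (simp add: iid_two_sided_brownian_motions_def)
  have B': "two_sided_paths M (B' i)" for i
    unfolding B'_def by (rule two_sided_paths_normalize[OF assms(1) B])
  have ind: "indep_sets (\<lambda>i. sets (path_sets M (B' i))) UNIV"
    unfolding B'_def
    by (rule indep_path_sets_normalize[OF assms(1)])
      (use assms(2) in \<open>simp add: iid_two_sided_brownian_motions_def\<close>)
  have conv: "AE \<omega> in M. \<forall>i. \<exists>X. \<forall>\<^sub>F n in sequentially. iterated_image (\<lambda>i. B' i \<omega>) i n J = X"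
    by (rule AE_iterated_image_eventually_constant[OF B' ind assms(3-6)])
  \<comment> \<open>c = 1 gives the path itself and c = -1 its reflection at the origin; both
    generate sub-sigma-algebras of the same independent family.\<close>
  have sub: "sets (generated M (\<lambda>t \<omega>. c * B' i \<omega> (c * t)) {0..}) \<subseteq> sets (path_sets M (B' i))" for c i
    by (rule sets_generated_subset)
      (auto simp: space_path_sets intro!: borel_measurable_times borel_measurable_const path_sets_measurable)
  have right: "AE \<omega> in M. climb_chain (\<lambda>i. B' i \<omega>)"
    by (rule AE_climb_chain[OF paths_right[OF B'] indep_sets_mono_sets[OF ind]])
      (use sub[of 1] in simp)
  have left: "AE \<omega> in M. climb_chain (\<lambda>i t. - B' i \<omega> (- t))"
    by (rule AE_climb_chain[OF brownian_motion_uminus[OF paths_left[OF B']] indep_sets_mono_sets[OF ind]])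
      (use sub[of "-1"] in simp)
  have zero: "AE \<omega> in M. \<forall>i. B i \<omega> 0 = 0"
    using B by (auto simp: AE_all_countable two_sided_brownian_motion_def std_brownian_motion_def)
  obtain e where e: "0 < e" "{0..e} \<subseteq> J \<or> {- e..0} \<subseteq> J"
    using interval_one_sided_neighbourhood[OF assms(3,5,6)] by blast
  from conv right left zero AE_space show ?thesis
  proof eventually_elim
    case (elim \<omega>)
    define f where "f i = B i \<omega>" for i
    have ff: "B' i \<omega> = f i" for i using elim(4) by (auto simp: B'_def f_def)
    have f: "continuous_on S (f i)" for S i
      using paths_continuous[OF B' elim(5)] by (simp add: ff)
    \<comment> \<open>Climbs exist almost surely on both sides of 0, so the chain can be taken on a
      side on which J covers a neighbourhood of 0.\<close>
    have "\<exists>A D. decomposition_chain f A D \<and> (\<forall>\<^sub>F n in sequentially. A n \<union> D n \<subseteq> J)"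
      using e(2)
    proof
      assume e2: "{0..e} \<subseteq> J"
      have "climb_chain f" using elim(2) by (simp add: ff)
      then obtain A D where AD: "decomposition_chain f A D" "\<forall>\<^sub>F n in sequentially. A n \<union> D n \<subseteq> {0..e}"
        using climb_chain_decomposition[of f, OF f _ e(1)] by blast
      from AD(2) have "\<forall>\<^sub>F n in sequentially. A n \<union> D n \<subseteq> J"
        by eventually_elim (use e2 in blast)
      then show ?thesis using AD(1) by blast
    next
      assume e2: "{- e..0} \<subseteq> J"
      have cl: "climb_chain (\<lambda>i t. - f i (- t))" using elim(3) by (simp add: ff)
      have "continuous_on {0..} (\<lambda>t. - f i (- t))" for i
        by (intro continuous_intros continuous_on_compose2[OF f[of UNIV]]) auto
      from climb_chain_decomposition[of "\<lambda>i t. - f i (- t)", OF this cl e(1)] obtain A D where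
        AD: "decomposition_chain (\<lambda>i t. - f i (- t)) A D" "\<forall>\<^sub>F n in sequentially. A n \<union> D n \<subseteq> {0..e}"
        by blast
      from AD(2) have "\<forall>\<^sub>F n in sequentially. uminus ` A n \<union> uminus ` D n \<subseteq> J"
      proof eventually_elim
        case (elim n)
        then have "uminus ` A n \<union> uminus ` D n \<subseteq> {- e..0}" by auto
        then show ?case using e2 by blast
      qed
      then show ?thesis using decomposition_chain_uminus[OF AD(1)] by blast
    qed
    then obtain A D where "decomposition_chain f A D" "\<forall>\<^sub>F n in sequentially. A n \<union> D n \<subseteq> J"
      by blast
    moreover have "\<exists>X. \<forall>\<^sub>F n in sequentially. iterated_image f i n J = X" for i
      using elim(1) by (simp add: ff)
    ultimately have "\<not> hereditarily_indecomposable (inverse_limit (limit_interval f J) f)"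
      by (intro not_hereditarily_indecomposable_limit[of f, OF f assms(4)])
    then show ?case by (simp add: Let_def is_pseudo_arc_def f_def[abs_def])
  qed
qed

end
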